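(* Let $1/4<H<1$, $T>0$, and let $b,\sigma$ satisfy the standing assumption (A) of the context. Suppose that $$\nabla\cdot b_t(x)=C_t,\qquad (t,x)\in[0,T]\times\mathbb R^n,$$ where $C_t$ does not depend on $x$. Then, for every initial condition $x_0\in\mathbb R^n$ and every $\epsilon>0$, the corresponding deterministic trajectory $\bar X$ (the solution of $\bar X_t'=b_t(\bar X_t)$, $\bar X_0=x_0$ on $[0,T]$) persists as both the unique most probable evolution path (the unique global minimizer of $J_\epsilon$ over $x_0+\mathcal H_H^\sigma([0,T];\mathbb R^n)$) and the unique most probable transition path (the unique global minimizer of $J_\epsilon$ over $\mathcal H^{\sigma,T}_{H;x_0,x_T}$ with $x_T=\bar X_T$).
   Context: Standing assumption (A): $b\in C_b^{1,3}([0,T]\times\mathbb R^n;\mathbb R^n)$ (bounded, with bounded continuous derivatives up to order one in $t$ and order three in $x$); $\sigma_t=\operatorname{diag}(\sigma_t^1,\dots,\sigma_t^n)$ with $\sigma^i\in C^1([0,T])$ and $0<m_i\le\sigma_t^i\le M_i$. $\nabla\cdot$ acts in the space variable. Kernel, for $0<s<t$: $K_H(t,s)=c_H\left[(t/s)^{H-\frac12}(t-s)^{H-\frac12}-(H-\frac12)s^{\frac12-H}\int_s^tu^{H-\frac32}(u-s)^{H-\frac12}du\right]$, $c_H=\sqrt{\frac{2H\Gamma(3/2-H)}{\Gamma(H+1/2)\Gamma(2-2H)}}$. For $u\in L^2([0,T];\mathbb R^n)$: $(K_Hu)(t)=\int_0^tK_H(t,s)u(s)ds$, $(K_H^\sigma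 u)(t)=\int_0^t\sigma_s\,d(K_Hu)(s)$ (Young integral). $K_H^\sigma$ is injective; $\mathcal H_H^\sigma([0,T];\mathbb R^n):=K_H^\sigma(L^2)$. $d_H=\sqrt{2H\Gamma(H+\frac12)\Gamma(\frac32-H)/\Gamma(2-2H)}$. For $\phi\in x_0+\mathcal H_H^\sigma([0,T];\mathbb R^n)$, $$J_\epsilon(\phi)=\frac1{2\epsilon}\int_0^T\left|(K_H^\sigma)^{-1}\left(\phi_\cdot-x_0-\int_0^\cdot b_s(\phi_s)ds\right)(t)\right|^2dt+\frac{d_H}2\int_0^T\nabla\cdot b_t(\phi_t)\,dt .$$ $\mathcal H^{\sigma,T}_{H;x_0,x_T}=\{\phi\in x_0+\mathcal H_H^\sigma([0,T];\mathbb R^n):\phi_T=x_T\}$. *)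

theory Defs
  imports "HOL-Analysis.Analysis"
begin

text \<open>
  Paths and controls on \<open>[0,T]\<close> are total functions \<open>real \<Rightarrow> real ^ 'n\<close> of which only the values on
  \<open>{0..T}\<close> matter; path equality always means equality on \<open>{0..T}\<close>.
\<close>

definition bdd_cont :: "real \<Rightarrow> (real \<Rightarrow> real ^ 'n \<Rightarrow> 'b :: real_normed_vector) \<Rightarrow> bool" where
  "bdd_cont T f \<longleftrightarrow>
     continuous_on ({0..T} \<times> UNIV) (\<lambda>(t, x). f t x) \<and>
     bounded ((\<lambda>(t, x). f t x) ` ({0..T} \<times> UNIV))"

text \<open>
  The class \<open>C_b^{1,3}([0,T] \<times> R^n; R^n)\<close>. Space derivatives are Frechet derivatives, the time
  derivative is one-sided at \<open>0\<close> and \<open>T\<close>; no mixed space-time derivatives are required.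
\<close>

definition Cb13 :: "real \<Rightarrow> (real \<Rightarrow> real ^ 'n \<Rightarrow> real ^ 'n) \<Rightarrow> bool" where
  "Cb13 T b \<longleftrightarrow>
     bdd_cont T b \<and>
     (\<exists>Dt :: real \<Rightarrow> real ^ 'n \<Rightarrow> real ^ 'n.
        bdd_cont T Dt \<and>
        (\<forall>t\<in>{0..T}. \<forall>x. ((\<lambda>s. b s x) has_vector_derivative Dt t x) (at t within {0..T}))) \<and>
     (\<exists>(D1 :: real \<Rightarrow> real ^ 'n \<Rightarrow> (real ^ 'n) \<Rightarrow>\<^sub>L (real ^ 'n))
       (D2 :: real \<Rightarrow> real ^ 'n \<Rightarrow> (real ^ 'n) \<Rightarrow>\<^sub>L ((real ^ 'n) \<Rightarrow>\<^sub>L (real ^ 'n)))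
       (D3 :: real \<Rightarrow> real ^ 'n \<Rightarrow> (real ^ 'n) \<Rightarrow>\<^sub>L ((real ^ 'n) \<Rightarrow>\<^sub>L ((real ^ 'n) \<Rightarrow>\<^sub>L (real ^ 'n)))).
        bdd_cont T D1 \<and> bdd_cont T D2 \<and> bdd_cont T D3 \<and>
        (\<forall>t\<in>{0..T}. \<forall>x.
           (b t has_derivative blinfun_apply (D1 t x)) (at x) \<and>
           (D1 t has_derivative blinfun_apply (D2 t x)) (at x) \<and>
           (D2 t has_derivative blinfun_apply (D3 t x)) (at x)))"

definition C1_on_interval :: "real \<Rightarrow> (real \<Rightarrow> real) \<Rightarrow> bool" where
  "C1_on_interval T f \<longleftrightarrow>
     (\<exists>f'. continuous_on {0..T} f' \<and>
           (\<forall>t\<in>{0..T}. (f has_real_derivative f' t) (at t within {0..T})))"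

definition admissible_diffusion :: "real \<Rightarrow> (real \<Rightarrow> real ^ 'n ^ 'n) \<Rightarrow> bool" where
  "admissible_diffusion T \<sigma> \<longleftrightarrow>
     (\<forall>t\<in>{0..T}. \<forall>i j. i \<noteq> j \<longrightarrow> \<sigma> t $ i $ j = 0) \<and>
     (\<forall>i. C1_on_interval T (\<lambda>t. \<sigma> t $ i $ i)) \<and>
     (\<forall>i. \<exists>m M. 0 < m \<and> (\<forall>t\<in>{0..T}. m \<le> \<sigma> t $ i $ i \<and> \<sigma> t $ i $ i \<le> M))"

definition divergence :: "(real ^ 'n \<Rightarrow> real ^ 'n) \<Rightarrow> real ^ 'n \<Rightarrow> real" where
  "divergence F x = (\<Sum>i\<in>UNIV. jacobian F (at x) $ i $ i)"

definition c_const :: "real \<Rightarrow> real" where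
  "c_const H = sqrt (2 * H * Gamma (3/2 - H) / (Gamma (H + 1/2) * Gamma (2 - 2 * H)))"

definition d_const :: "real \<Rightarrow> real" where
  "d_const H = sqrt (2 * H * Gamma (H + 1/2) * Gamma (3/2 - H) / Gamma (2 - 2 * H))"

text \<open>Meaningful for \<open>0 < s < t\<close> only; \<open>powr\<close> is then applied to positive bases up to null sets.\<close>

definition K_kernel :: "real \<Rightarrow> real \<Rightarrow> real \<Rightarrow> real" where
  "K_kernel H t s =
     c_const H * ((t / s) powr (H - 1/2) * (t - s) powr (H - 1/2)
       - (H - 1/2) * s powr (1/2 - H) *
         (LINT u:{s..t}|lebesgue. u powr (H - 3/2) * (u - s) powr (H - 1/2)))"

definition L2_fun :: "real \<Rightarrow> (real \<Rightarrow> real ^ 'n) set" where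
  "L2_fun T = {u. set_borel_measurable lebesgue {0..T} u \<and>
                  set_integrable lebesgue {0..T} (\<lambda>t. (norm (u t))\<^sup>2)}"

definition K_op :: "real \<Rightarrow> (real \<Rightarrow> real ^ 'n) \<Rightarrow> real \<Rightarrow> real ^ 'n" where
  "K_op H u t = (LINT s:{0..t}|lebesgue. K_kernel H t s *\<^sub>R u s)"

text \<open>
  The Young integral of \<open>A\<close> against \<open>g\<close> over \<open>[a,b]\<close>: the limit of the tagged Riemann-Stieltjes
  sums as the mesh of the partition tends to \<open>0\<close>. The gauge \<open>\<lambda>x. ball x \<delta>\<close> is constant, so that
  this is the mesh limit and not a gauge (Henstock-Stieltjes) integral.
\<close>

definition has_young_integral ::
    "(real \<Rightarrow> real ^ 'n ^ 'n) \<Rightarrow> (real \<Rightarrow> real ^ 'n) \<Rightarrow> real \<Rightarrow> real \<Rightarrow> real ^ 'n \<Rightarrow> bool" where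
  "has_young_integral A g a b I \<longleftrightarrow>
     (\<forall>e>0. \<exists>\<delta>>0. \<forall>p. p tagged_division_of {a..b} \<and> (\<lambda>x. ball x \<delta>) fine p \<longrightarrow>
        norm ((\<Sum>(x, k)\<in>p. A x *v (g (Sup k) - g (Inf k))) - I) < e)"

definition young_integral ::
    "(real \<Rightarrow> real ^ 'n ^ 'n) \<Rightarrow> (real \<Rightarrow> real ^ 'n) \<Rightarrow> real \<Rightarrow> real \<Rightarrow> real ^ 'n" where
  "young_integral A g a b = (THE I. has_young_integral A g a b I)"

definition K_sigma ::
    "real \<Rightarrow> (real \<Rightarrow> real ^ 'n ^ 'n) \<Rightarrow> (real \<Rightarrow> real ^ 'n) \<Rightarrow> real \<Rightarrow> real ^ 'n" where
  "K_sigma H \<sigma> u t = young_integral \<sigma> (K_op H u) 0 t"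

definition CM_space :: "real \<Rightarrow> real \<Rightarrow> (real \<Rightarrow> real ^ 'n ^ 'n) \<Rightarrow> (real \<Rightarrow> real ^ 'n) set" where
  "CM_space H T \<sigma> = {h. \<exists>u\<in>L2_fun T. \<forall>t\<in>{0..T}. h t = K_sigma H \<sigma> u t}"

text \<open>
  \<open>K_sigma\<close> is injective on \<open>L^2\<close> classes, so the preimage of an element of \<open>CM_space H T \<sigma>\<close> is
  determined up to a null set, which suffices for its \<open>L^2\<close> norm.
\<close>

definition K_sigma_inv ::
    "real \<Rightarrow> real \<Rightarrow> (real \<Rightarrow> real ^ 'n ^ 'n) \<Rightarrow> (real \<Rightarrow> real ^ 'n) \<Rightarrow> real \<Rightarrow> real ^ 'n" where
  "K_sigma_inv H T \<sigma> h = (SOME u. u \<in> L2_fun T \<and> (\<forall>t\<in>{0..T}. h t = K_sigma H \<sigma> u t))"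

definition OM_functional ::
    "real \<Rightarrow> real \<Rightarrow> (real \<Rightarrow> real ^ 'n \<Rightarrow> real ^ 'n) \<Rightarrow> (real \<Rightarrow> real ^ 'n ^ 'n) \<Rightarrow> real ^ 'n \<Rightarrow>
     real \<Rightarrow> (real \<Rightarrow> real ^ 'n) \<Rightarrow> real" where
  "OM_functional H T b \<sigma> x0 \<epsilon> \<phi> =
     1 / (2 * \<epsilon>) *
       (LINT t:{0..T}|lebesgue.
          (norm (K_sigma_inv H T \<sigma> (\<lambda>r. \<phi> r - x0 - (LINT s:{0..r}|lebesgue. b s (\<phi> s))) t))\<^sup>2)
     + d_const H / 2 * (LINT t:{0..T}|lebesgue. divergence (b t) (\<phi> t))"

definition paths_from ::
    "real \<Rightarrow> real \<Rightarrow> (real \<Rightarrow> real ^ 'n ^ 'n) \<Rightarrow> real ^ 'n \<Rightarrow> (real \<Rightarrow> real ^ 'n) set" where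
  "paths_from H T \<sigma> x0 = {\<phi>. (\<lambda>t. \<phi> t - x0) \<in> CM_space H T \<sigma>}"

definition paths_between ::
    "real \<Rightarrow> real \<Rightarrow> (real \<Rightarrow> real ^ 'n ^ 'n) \<Rightarrow> real ^ 'n \<Rightarrow> real ^ 'n \<Rightarrow>
     (real \<Rightarrow> real ^ 'n) set" where
  "paths_between H T \<sigma> x0 xT = {\<phi> \<in> paths_from H T \<sigma> x0. \<phi> T = xT}"

definition global_minimizer :: "('a \<Rightarrow> real) \<Rightarrow> 'a set \<Rightarrow> 'a \<Rightarrow> bool" where
  "global_minimizer J S \<phi> \<longleftrightarrow> \<phi> \<in> S \<and> (\<forall>\<psi>\<in>S. J \<phi> \<le> J \<psi>)"

definition unique_global_minimizer ::
    "real \<Rightarrow> ((real \<Rightarrow> real ^ 'n) \<Rightarrow> real) \<Rightarrow> (real \<Rightarrow> real ^ 'n) set \<Rightarrow> (real \<Rightarrow> real ^ 'n) \<Rightarrow> bool"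
  where
  "unique_global_minimizer T J S \<phi> \<longleftrightarrow>
     global_minimizer J S \<phi> \<and>
     (\<forall>\<psi>. global_minimizer J S \<psi> \<longrightarrow> (\<forall>t\<in>{0..T}. \<psi> t = \<phi> t))"

definition solves_ode ::
    "real \<Rightarrow> (real \<Rightarrow> real ^ 'n \<Rightarrow> real ^ 'n) \<Rightarrow> real ^ 'n \<Rightarrow> (real \<Rightarrow> real ^ 'n) \<Rightarrow> bool" where
  "solves_ode T b x0 X \<longleftrightarrow>
     X 0 = x0 \<and>
     (\<forall>t\<in>{0..T}. (X has_vector_derivative b t (X t)) (at t within {0..T}))"

end

theory Submission
  imports Defs
begin

text \<open>
  Since the divergence of \<open>b\<close> does not depend on the path, the second term of the functional is a
  constant, and the deterministic trajectory makes the first term vanish. What has to be proved is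
  that the first term is well behaved: the operator is injective, so that a vanishing first term
  forces the integral equation \<open>\<psi> = x0 + \<integral> b(\<psi>)\<close>, and \<open>\<integral> b(\<psi>)\<close> lies in the range of the operator for
  every admissible \<open>\<psi>\<close>, so that the inverse is not evaluated at a junk argument.

  With \<open>a = H - 1/2\<close> and \<open>Y(t) = \<integral>\<^sub>0\<^sup>t (t - s)\<^sup>a s\<^sup>-\<^sup>a w(s) ds\<close>, Fubini gives
  \<open>K\<^sub>H w(t) = c\<^sub>H (t\<^sup>a Y(t) - a \<integral>\<^sub>0\<^sup>t q\<^sup>a\<^sup>-\<^sup>1 Y(q) dq)\<close> for all \<open>H\<close> at once, and this equals \<open>\<integral>\<^sub>0\<^sup>t f\<close> as soon as
  \<open>c\<^sub>H Y(t) = \<integral>\<^sub>0\<^sup>t s\<^sup>-\<^sup>a f(s) ds\<close>, an Abel equation for \<open>w\<close>. For \<open>H \<le> 1/2\<close> it is solvable for every bounded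
  \<open>f\<close>. For \<open>H > 1/2\<close> a fractional derivative of \<open>f = \<sigma>\<^sup>-\<^sup>1 b(\<psi>)\<close> is needed; it exists because admissible
  paths are then absolutely continuous with \<open>|\<psi>'(s)|\<close> dominated by \<open>s\<^sup>a\<close> times an Abel integral of order
  \<open>a\<close>, a bound that the chain rule passes on to \<open>f\<close>.
\<close>

subsection \<open>Abel integrals\<close>

text \<open>The two signs of a = H - 1/2 put the difficulty in different places. For a < 0 the
  kernel (t - s)^a is unbounded, so the continuity of \<open>Y\<close> needs a truncation with a
  uniform error, while the Abel equation is solved by an integral of the positive order -a. For a >
  0 the kernel is bounded, but solving costs derivatives of order a, and the drift along every
  admissible path has to be shown to possess them.

  The passage between \<open>Y\<close> and its weighted primitives is integration by parts against a
  power, proved by Fubini in \<open>weighted_primitive\<close>; hence it holds for merely integrable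
  functions and for negative exponents. Uniqueness uses an Abel integral of order 1 - a, positive
  for either sign, which turns \<open>Y\<close> into a double primitive of the weighted control.

  The Young integral enters in two forms. Since sigma is C^1, integration by parts gives
  \<open>K_sigma\<close> u = sigma K_H u - int sigma' K_H u for every control, a Volterra equation
  in K_H u that Gronwall resolves. When K_H u has an integrable density p, the integral is the
  primitive of sigma p; in this form equations for \<open>K_sigma\<close> are solved.\<close>

text \<open>
  \<open>pker b\<close> is \<open>x\<^sub>+\<^sup>b\<^sup>-\<^sup>1\<close>, so the weight \<open>s\<^sup>a\<close> is \<open>pker (1 + a)\<close>; \<open>abel b\<close> is \<open>\<Gamma>(b)\<close> times the Riemann-Liouville
  integral of order \<open>b\<close>, for functions that vanish on the negative half-line.
\<close>

definition pker :: "real \<Rightarrow> real \<Rightarrow> real" where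
  "pker b x = (if 0 < x then x powr (b - 1) else 0)"

definition abel :: "real \<Rightarrow> (real \<Rightarrow> 'a::{banach,second_countable_topology}) \<Rightarrow> real \<Rightarrow> 'a" where
  "abel b w t = (LINT s|lborel. pker b (t - s) *\<^sub>R w s)"

lemma pker_measurable [measurable]: "pker b \<in> borel_measurable borel"
  unfolding pker_def by measurable

lemma pker_nonneg [simp]: "0 \<le> pker b x"
  by (simp add: pker_def)

lemma pker_nonpos [simp]: "x \<le> 0 \<Longrightarrow> pker b x = 0"
  by (simp add: pker_def)

lemma pker_pos: "0 < x \<Longrightarrow> 0 < pker b x"
  by (simp add: pker_def)

lemma pker_one: "0 < x \<Longrightarrow> pker 1 x = 1"
  by (simp add: pker_def)

lemma pker_two: "0 < x \<Longrightarrow> pker 2 x = x"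
  by (simp add: pker_def)

lemma pker_mult: "pker p x * pker q x = pker (p + q - 1) x"
  by (simp add: pker_def powr_add [symmetric])

lemma pker_scale: "0 < c \<Longrightarrow> pker p (c * x) = c powr (p - 1) * pker p x"
  by (simp add: pker_def powr_mult zero_less_mult_iff)

lemma pker_mono: "1 \<le> p \<Longrightarrow> x \<le> y \<Longrightarrow> pker p x \<le> pker p y"
  by (auto simp: pker_def powr_mono2)

text \<open>The substitution s = r + D x with D = t - r reduces this to the Beta integral over the
  unit interval: homogeneity of the two kernels contributes D^(p + q - 2) and the Jacobian the
  remaining factor D. It is the semigroup law of fractional integration at the level of
  kernels.\<close>

lemma pker_beta:
  assumes "0 < p" "0 < q"
  shows "has_bochner_integral lborel (\<lambda>s. pker p (t - s) * pker q (s - r)) (Beta p q * pker (p + q) (t - r))"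
proof (cases "r < t")
  case False
  then have "(\<lambda>s. pker p (t - s) * pker q (s - r)) = (\<lambda>s. 0)"
    by (auto simp: pker_def fun_eq_iff)
  with False show ?thesis by (simp add: has_bochner_integral_zero)
next
  case True
  define D where "D = t - r"
  have D: "0 < D" using True by (simp add: D_def)
  have "((\<lambda>x. x powr (q - 1) * (1 - x) powr (p - 1)) has_integral Beta q p) {0..1}"
    using has_integral_Beta_real[of q p] assms by simp
  then have "((\<lambda>x. pker q x * pker p (1 - x)) has_integral Beta q p) {0..1}"
    by (rule has_integral_eq[rotated]) (auto simp: pker_def)
  then have "((\<lambda>x. if x \<in> {0..1} then pker q x * pker p (1 - x) else 0) has_integral Beta q p) UNIV"
    by (simp only: has_integral_restrict_UNIV)
  also have "(\<lambda>x. if x \<in> {0..1} then pker q x * pker p (1 - x) else 0) = (\<lambda>x. pker q x * pker p (1 - x))"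
    by (auto simp: pker_def fun_eq_iff)
  finally have h: "((\<lambda>x. pker q x * pker p (1 - x)) has_integral Beta q p) UNIV" .
  \<comment> \<open>Nonnegativity of the integrand turns the gauge integral into an absolutely
    convergent Lebesgue integral.\<close>
  have "(\<integral>\<^sup>+x. ennreal (pker q x * pker p (1 - x)) \<partial>lborel) = ennreal (Beta q p)"
    by (rule nn_integral_has_integral_lborel[OF _ _ h]) auto
  moreover have "0 \<le> Beta q p"
    using h by (rule has_integral_nonneg) auto
  ultimately have "has_bochner_integral lborel (\<lambda>x. pker q x * pker p (1 - x)) (Beta q p)"
    by (intro has_bochner_integral_nn_integral) auto
  then have b: "has_bochner_integral lborel (\<lambda>x. D powr (p + q - 2) * (pker q x * pker p (1 - x)))
      (D powr (p + q - 2) * Beta q p)"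
    by (rule has_bochner_integral_mult_right)
  have eq: "pker p (t - (r + D * x)) * pker q (r + D * x - r) = D powr (p + q - 2) * (pker q x * pker p (1 - x))" for x
  proof -
    have "t - (r + D * x) = D * (1 - x)" by (simp add: D_def algebra_simps)
    then show ?thesis using D
      by (simp add: pker_scale powr_add [symmetric] mult_ac)
  qed
  have val: "D powr (p + q - 2) * Beta q p = (Beta p q * pker (p + q) (t - r)) /\<^sub>R \<bar>D\<bar>"
  proof -
    have "D powr (p + q - 1) = D powr (p + q - 2) * D"
      using powr_add[of D "p + q - 2" 1] D by (simp add: algebra_simps)
    with D show ?thesis
      by (simp add: pker_def D_def [symmetric] Beta_commute field_simps)
  qed
  show ?thesis
    using D b by (subst lborel_has_bochner_integral_real_affine_iff[where c = D and t = r]) (simp_all only: eq val [symmetric] less_imp_neq [THEN not_sym] not_False_eq_True)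
qed

lemma pker_beta_integrable:
  assumes "0 < p" "0 < q"
  shows "integrable lborel (\<lambda>s. pker p (t - s) * pker q (s - r))"
    and "(LINT s|lborel. pker p (t - s) * pker q (s - r)) = Beta p q * pker (p + q) (t - r)"
  using pker_beta[OF assms, of t r] by (simp_all add: has_bochner_integral_iff)

lemma pker_beta0:
  assumes "0 < p" "0 < q"
  shows "integrable lborel (\<lambda>s. pker p (t - s) * pker q s)"
    and "abel p (pker q) t = Beta p q * pker (p + q) t"
  using pker_beta_integrable[OF assms, of t 0] by (simp_all add: abel_def)

lemma Beta_real_pos: "0 < p \<Longrightarrow> 0 < q \<Longrightarrow> 0 < Beta p (q::real)"
  by (simp add: Beta_def)

lemma Beta_one_one: "Beta 1 (1::real) = 1"
  using Gamma_fact[of 1, where 'a = real] by (simp add: Beta_def)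

lemma abel_cong:
  assumes "\<And>s. s < t \<Longrightarrow> w s = w' s"
  shows "abel b w t = abel b w' t"
  unfolding abel_def by (intro Bochner_Integration.integral_cong) (auto simp: pker_def assms)

lemma abel_measurable [measurable]:
  assumes [measurable]: "w \<in> borel_measurable borel"
  shows "abel b w \<in> borel_measurable borel"
  unfolding abel_def by measurable

lemma abel_scaleR: "abel b (\<lambda>s. c *\<^sub>R w s) t = c *\<^sub>R abel b w t"
  unfolding abel_def by (subst integral_scaleR_right [symmetric]) (simp add: mult_ac)

lemma abel_add:
  assumes "integrable lborel (\<lambda>s. pker b (t - s) *\<^sub>R w s)" "integrable lborel (\<lambda>s. pker b (t - s) *\<^sub>R w' s)"
  shows "abel b (\<lambda>s. w s + w' s) t = abel b w t + abel b w' t"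
  unfolding abel_def using assms by (simp add: scaleR_add_right)

lemma abel_diff:
  assumes "integrable lborel (\<lambda>s. pker b (t - s) *\<^sub>R w s)" "integrable lborel (\<lambda>s. pker b (t - s) *\<^sub>R w' s)"
  shows "abel b (\<lambda>s. w s - w' s) t = abel b w t - abel b w' t"
  unfolding abel_def using assms by (simp add: scaleR_diff_right)

lemma abel_norm_le: "norm (abel b w t) \<le> abel b (\<lambda>s. norm (w s)) t"
  unfolding abel_def by (rule order_trans[OF integral_norm_bound]) simp

lemma abel_nonneg: "(\<And>s. 0 \<le> w s) \<Longrightarrow> 0 \<le> abel b w (t::real)" for w :: "real \<Rightarrow> real"
  unfolding abel_def by (intro integral_nonneg_AE) auto

lemma abel_mono:
  fixes w w' :: "real \<Rightarrow> real"
  assumes "w \<in> borel_measurable borel" "integrable lborel (\<lambda>s. pker b (t - s) *\<^sub>R w' s)"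
    and "\<And>s. s < t \<Longrightarrow> 0 \<le> w s \<and> w s \<le> w' s"
  shows "abel b w t \<le> abel b w' t"
    and "integrable lborel (\<lambda>s. pker b (t - s) *\<^sub>R w s)"
proof -
  have le: "norm (pker b (t - s) *\<^sub>R w s) \<le> norm (pker b (t - s) *\<^sub>R w' s)" for s
    using assms(3)[of s] by (cases "s < t") (auto simp: abs_mult mult_left_mono)
  show i: "integrable lborel (\<lambda>s. pker b (t - s) *\<^sub>R w s)"
    by (rule Bochner_Integration.integrable_bound[OF assms(2)]) (use assms(1) le in auto)
  show "abel b w t \<le> abel b w' t"
    unfolding abel_def
  proof (rule integral_mono[OF i assms(2)])
    show "pker b (t - s) *\<^sub>R w s \<le> pker b (t - s) *\<^sub>R w' s" for s
      using assms(3)[of s] by (cases "s < t") (auto intro: mult_left_mono)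
  qed
qed

text \<open>Integrability of \<open>h s r\<close> in \<open>s\<close> is asked only where
  \<open>w r\<close> is nonzero: the power kernels of the applications diverge at the origin, where
  the weighted functions vanish.\<close>

lemma fubini_kernel:
  fixes w :: "real \<Rightarrow> 'a::{banach,second_countable_topology}"
  assumes [measurable]: "w \<in> borel_measurable borel" "case_prod h \<in> borel_measurable (borel \<Otimes>\<^sub>M borel)"
    and h: "\<And>r. w r \<noteq> 0 \<Longrightarrow> integrable lborel (\<lambda>s. h s r)"
    and i: "integrable lborel (\<lambda>r. (LINT s|lborel. \<bar>h s r\<bar>) *\<^sub>R w r)"
  shows "integrable lborel (\<lambda>s. LINT r|lborel. h s r *\<^sub>R w r)"
    and "(LINT s|lborel. LINT r|lborel. h s r *\<^sub>R w r) = (LINT r|lborel. (LINT s|lborel. h s r) *\<^sub>R w r)"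
    and "AE s in lborel. integrable lborel (\<lambda>r. h s r *\<^sub>R w r)"
proof -
  let ?f = "\<lambda>(r, s). h s r *\<^sub>R w r"
  have hr: "integrable lborel (\<lambda>s. h s r *\<^sub>R w r)" for r
    using h[of r] by (cases "w r = 0") (auto intro: integrable_scaleR_left)
  have m: "?f \<in> borel_measurable (lborel \<Otimes>\<^sub>M lborel)" by measurable
  have f: "integrable (lborel \<Otimes>\<^sub>M lborel) ?f"
  proof (rule lborel_pair.Fubini_integrable[OF m])
    have "(LINT s|lborel. norm (?f (r, s))) = norm ((LINT s|lborel. \<bar>h s r\<bar>) *\<^sub>R w r)" for r
      by (simp add: abs_of_nonneg)
    then show "integrable lborel (\<lambda>r. LINT s|lborel. norm (?f (r, s)))"
      using integrable_norm[OF i] by simp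
  qed (simp add: hr)
  have f2: "integrable (lborel \<Otimes>\<^sub>M lborel) (case_prod (\<lambda>r s. h s r *\<^sub>R w r))"
    using f .
  show "integrable lborel (\<lambda>s. LINT r|lborel. h s r *\<^sub>R w r)"
    using lborel_pair.integrable_snd[OF f2] by simp
  show "AE s in lborel. integrable lborel (\<lambda>r. h s r *\<^sub>R w r)"
    using lborel_pair.AE_integrable_snd[OF f2] by simp
  have "(LINT s|lborel. LINT r|lborel. h s r *\<^sub>R w r) = (LINT r|lborel. LINT s|lborel. h s r *\<^sub>R w r)"
    using lborel_pair.Fubini_integral[OF f2] by simp
  also have "\<dots> = (LINT r|lborel. (LINT s|lborel. h s r) *\<^sub>R w r)"
  proof (rule Bochner_Integration.integral_cong[OF refl])
    show "(LINT s|lborel. h s r *\<^sub>R w r) = (LINT s|lborel. h s r) *\<^sub>R w r" for r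
      using h[of r] by (cases "w r = 0") auto
  qed
  finally show "(LINT s|lborel. LINT r|lborel. h s r *\<^sub>R w r) = (LINT r|lborel. (LINT s|lborel. h s r) *\<^sub>R w r)" .
qed

text \<open>The semigroup law: Fubini moves the inner integration onto the two kernels, where
  \<open>pker_beta\<close> evaluates it. Because the kernels are nonnegative, integrability against
  the composed kernel already justifies the exchange.\<close>

lemma abel_abel:
  fixes w :: "real \<Rightarrow> 'a::{banach,second_countable_topology}"
  assumes [measurable]: "w \<in> borel_measurable borel" and pq: "0 < p" "0 < q"
    and i: "integrable lborel (\<lambda>r. pker (p + q) (t - r) *\<^sub>R w r)"
  shows "integrable lborel (\<lambda>s. pker p (t - s) *\<^sub>R abel q w s)"
    and "abel p (abel q w) t = Beta p q *\<^sub>R abel (p + q) w t"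
proof -
  let ?h = "\<lambda>s r. pker p (t - s) * pker q (s - r)"
  have I: "integrable lborel (\<lambda>s. ?h s r)" "(LINT s|lborel. ?h s r) = Beta p q * pker (p + q) (t - r)" for r
    using pker_beta_integrable[OF pq, of t r] by auto
  have i': "integrable lborel (\<lambda>r. (LINT s|lborel. \<bar>?h s r\<bar>) *\<^sub>R w r)"
    using integrable_scaleR_right[OF i, of "Beta p q"] by (simp add: I mult_ac)
  have eq: "(LINT r|lborel. ?h s r *\<^sub>R w r) = pker p (t - s) *\<^sub>R abel q w s" for s
    unfolding abel_def by (subst integral_scaleR_right [symmetric]) (simp add: mult_ac)
  note F = fubini_kernel[of w ?h, OF _ _ _ i']
  show "integrable lborel (\<lambda>s. pker p (t - s) *\<^sub>R abel q w s)"
    using F(1) I(1) by (simp add: eq)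
  have "abel p (abel q w) t = (LINT r|lborel. (LINT s|lborel. ?h s r) *\<^sub>R w r)"
    using F(2) I(1) by (simp add: eq) (simp add: abel_def)
  also have "\<dots> = Beta p q *\<^sub>R abel (p + q) w t"
    unfolding I abel_def by (subst integral_scaleR_right [symmetric]) (simp add: mult_ac)
  finally show "abel p (abel q w) t = Beta p q *\<^sub>R abel (p + q) w t" .
qed

text \<open>This is the integral of s^(e - 1) over [r, t], with the interval encoded by two factors
  of order 1. The antiderivative is s^e / e; since r > 0 keeps away from the singularity at the
  origin, e may be negative.\<close>

lemma pker_bochner_interval:
  assumes "0 < r" "e \<noteq> 0"
  shows "has_bochner_integral lborel (\<lambda>s. pker 1 (t - s) * pker e s * pker 1 (s - r))
    (pker 1 (t - r) * ((pker (1 + e) t - pker (1 + e) r) / e))"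
proof (cases "r < t")
  case False
  then have "(\<lambda>s. pker 1 (t - s) * pker e s * pker 1 (s - r)) = (\<lambda>s. 0)"
    by (auto simp: pker_def fun_eq_iff)
  with False show ?thesis by (simp add: has_bochner_integral_zero)
next
  case True
  have "has_bochner_integral lborel (\<lambda>x. pker e x * indicator {r..t} x) (t powr e / e - r powr e / e)"
  proof (rule has_bochner_integral_FTC_Icc_nonneg[where F = "\<lambda>x. x powr e / e" and f = "pker e"])
    fix x assume "x \<in> {r..t}"
    with assms show "DERIV (\<lambda>x. x powr e / e) x :> pker e x"
      by (auto simp: pker_def intro!: derivative_eq_intros)
  qed (use True in auto)
  also have "t powr e / e - r powr e / e = pker 1 (t - r) * ((pker (1 + e) t - pker (1 + e) r) / e)"
    using True assms by (simp add: pker_def diff_divide_distrib)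
  finally show ?thesis
  proof (rule has_bochner_integral_cong_AE[THEN iffD1, rotated 3])
    show "AE x in lborel. pker e x * indicator {r..t} x = pker 1 (t - x) * pker e x * pker 1 (x - r)"
      using AE_lborel_singleton[of r] AE_lborel_singleton[of t]
      by eventually_elim (auto simp: pker_def split: split_indicator)
  qed measurable
qed

text \<open>Integration by parts of the power r^e against the primitive of \<open>y\<close>.
  Exchanging the order of integration in the double integral of e s^(e - 1) y(r) over r < s < t
  produces (t^e - r^e) y(r). The second integrability hypothesis controls the weight r^e near the
  origin when e < 0.\<close>

lemma weighted_primitive:
  fixes y :: "real \<Rightarrow> 'a::{banach,second_countable_topology}"
  assumes [measurable]: "y \<in> borel_measurable borel" and y0: "\<And>r. r \<le> 0 \<Longrightarrow> y r = 0"
    and i1: "integrable lborel (\<lambda>r. pker 1 (t - r) *\<^sub>R y r)"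
    and i2: "integrable lborel (\<lambda>r. pker 1 (t - r) *\<^sub>R (pker (1 + e) r *\<^sub>R y r))"
  shows "pker (1 + e) t *\<^sub>R abel 1 y t - e *\<^sub>R abel 1 (\<lambda>s. pker e s *\<^sub>R abel 1 y s) t
    = abel 1 (\<lambda>r. pker (1 + e) r *\<^sub>R y r) t"
proof (cases "e = 0")
  case True
  have eq: "pker 1 r *\<^sub>R y r = y r" for r
    using y0[of r] by (cases "0 < r") (auto simp: pker_one)
  show ?thesis
  proof (cases "0 < t")
    case True
    then show ?thesis using \<open>e = 0\<close> by (simp add: eq pker_one)
  next
    case False
    then have "abel 1 y t = abel 1 (\<lambda>_. 0) t" by (intro abel_cong) (auto simp: y0)
    with \<open>e = 0\<close> show ?thesis by (simp add: eq abel_def)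
  qed
next
  case False
  let ?h = "\<lambda>s r. pker 1 (t - s) * pker e s * pker 1 (s - r)"
  let ?J = "\<lambda>r. pker 1 (t - r) * ((pker (1 + e) t - pker (1 + e) r) / e)"
  have I: "integrable lborel (\<lambda>s. ?h s r)" "(LINT s|lborel. ?h s r) = ?J r" if "0 < r" for r
    using pker_bochner_interval[OF that False, of t] by (simp_all add: has_bochner_integral_iff)
  have J: "?J r *\<^sub>R y r = (pker (1 + e) t / e) *\<^sub>R (pker 1 (t - r) *\<^sub>R y r)
      - (1 / e) *\<^sub>R (pker 1 (t - r) *\<^sub>R (pker (1 + e) r *\<^sub>R y r))" for r
    by (simp add: scaleR_diff_left right_diff_distrib diff_divide_distrib mult_ac)
  have LI: "(LINT s|lborel. ?h s r) *\<^sub>R y r = ?J r *\<^sub>R y r" for r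
    using I(2)[of r] y0[of r] by (cases "0 < r") auto
  have "integrable lborel (\<lambda>r. (LINT s|lborel. \<bar>?h s r\<bar>) *\<^sub>R y r)"
    by (simp only: abs_of_nonneg pker_nonneg mult_nonneg_nonneg LI J)
      (intro Bochner_Integration.integrable_diff integrable_scaleR_right i1 i2)
  note F = fubini_kernel[of y ?h, OF _ _ _ this]
  have h: "integrable lborel (\<lambda>s. ?h s r)" if "y r \<noteq> 0" for r
    using I(1)[of r] y0[of r] that by force
  have eq: "(LINT r|lborel. ?h s r *\<^sub>R y r) = pker 1 (t - s) *\<^sub>R (pker e s *\<^sub>R abel 1 y s)" for s
    unfolding abel_def by (subst integral_scaleR_right [symmetric])+ (simp add: mult_ac)
  have "abel 1 (\<lambda>s. pker e s *\<^sub>R abel 1 y s) t = (LINT r|lborel. (LINT s|lborel. ?h s r) *\<^sub>R y r)"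
    using F(2)[OF _ _ h] by (simp only: eq) (simp add: abel_def)
  also have "\<dots> = (pker (1 + e) t / e) *\<^sub>R abel 1 y t - (1 / e) *\<^sub>R abel 1 (\<lambda>r. pker (1 + e) r *\<^sub>R y r) t"
    unfolding LI J abel_def
    by (subst Bochner_Integration.integral_diff) (use integrable_scaleR_right[OF i1] integrable_scaleR_right[OF i2] in \<open>simp_all only: integral_scaleR_right\<close>)
  finally show ?thesis using False by (simp add: scaleR_diff_right)
qed

lemma mult_le_weighted_squares:
  fixes \<theta> x y :: real
  assumes "0 < \<theta>"
  shows "x * y \<le> (\<theta> * x\<^sup>2 + y\<^sup>2 / \<theta>) / 2"
proof -
  have "0 \<le> (\<theta> * x - y)\<^sup>2 / \<theta>" using assms by simp
  also have "(\<theta> * x - y)\<^sup>2 / \<theta> = \<theta> * x\<^sup>2 - 2 * (x * y) + y\<^sup>2 / \<theta>"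
    using assms by (simp add: power2_eq_square field_simps)
  finally show ?thesis by simp
qed

lemma le_norm_real: "x \<le> y \<Longrightarrow> x \<le> norm (y::real)"
  by simp

lemma pker_square: "(pker (1 + a) x)\<^sup>2 = pker (1 + 2 * a) x"
  by (simp add: power2_eq_square pker_mult)

subsection \<open>The operator in terms of an Abel integral\<close>

text \<open>The condition on a makes (t - s)^(2 a) s^(-2 a) integrable over [0, t], so that the
  kernel is square integrable in its second argument. Controls are normalised to Borel functions
  that vanish off the half-open interval, which frees all integrals from domain
  restrictions.\<close>

locale l2_control =
  fixes a T :: real and w :: "real \<Rightarrow> 'a::{banach,second_countable_topology}"
  assumes a: "\<bar>a\<bar> < 1/2" and T: "0 < T"
    and w_meas [measurable]: "w \<in> borel_measurable borel"
    and w_supp: "\<And>s. s \<notin> {0<..T} \<Longrightarrow> w s = 0"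
    and w_sq: "integrable lborel (\<lambda>s. (norm (w s))\<^sup>2)"
begin

definition W where "W = (\<lambda>s. pker (1 - a) s *\<^sub>R w s)"

definition Y where "Y = abel (1 + a) W"

definition N where "N = (LINT s|lborel. (norm (w s))\<^sup>2)"

lemma N_nonneg: "0 \<le> N"
  by (simp add: N_def)

lemma W_meas [measurable]: "W \<in> borel_measurable borel"
  unfolding W_def by measurable

lemma Y_meas [measurable]: "Y \<in> borel_measurable borel"
  unfolding Y_def by measurable

lemma W_supp: "s \<notin> {0<..T} \<Longrightarrow> W s = 0"
  by (simp add: W_def w_supp)

lemma W_integrable: "integrable lborel W"
proof (rule Bochner_Integration.integrable_bound)
  show "integrable lborel (\<lambda>s. (pker 1 (T + 1 - s) * pker (1 - 2 * a) s + (norm (w s))\<^sup>2) / 2)"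
    using a by (intro integrable_divide Bochner_Integration.integrable_add w_sq pker_beta0(1)) auto
  have bnd: "norm (W s) \<le> (pker 1 (T + 1 - s) * pker (1 - 2 * a) s + (norm (w s))\<^sup>2) / 2" for s
  proof (cases "s \<in> {0<..T}")
    case True
    have "norm (W s) = pker (1 + - a) s * norm (w s)" by (simp add: W_def)
    also have "\<dots> \<le> (1 * (pker (1 + - a) s)\<^sup>2 + (norm (w s))\<^sup>2 / 1) / 2"
      by (rule mult_le_weighted_squares) simp
    also have "\<dots> = (pker 1 (T + 1 - s) * pker (1 - 2 * a) s + (norm (w s))\<^sup>2) / 2"
      unfolding pker_square using True by (simp add: pker_one)
    finally show ?thesis .
  next
    case False
    then show ?thesis by (simp add: W_supp)
  qed
  show "AE s in lborel. norm (W s) \<le> norm ((pker 1 (T + 1 - s) * pker (1 - 2 * a) s + (norm (w s))\<^sup>2) / 2)"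
    by (intro always_eventually allI le_norm_real bnd)
qed measurable

text \<open>Young's inequality with a free weight; the choice \<open>\<theta> = t\<^sup>-\<^sup>1\<^sup>/\<^sup>2\<close> recovers the Cauchy-Schwarz order of magnitude.\<close>

lemma kernel_product_bound:
  assumes "0 < \<theta>"
  shows "pker (1 + a) (t - s) * norm (W s)
    \<le> (\<theta> * (pker (1 + 2 * a) (t - s) * pker (1 - 2 * a) s) + (norm (w s))\<^sup>2 / \<theta>) / 2"
proof -
  have "pker (1 + a) (t - s) * norm (W s) = (pker (1 + a) (t - s) * pker (1 + - a) s) * norm (w s)"
    by (simp add: W_def)
  also have "\<dots> \<le> (\<theta> * (pker (1 + a) (t - s) * pker (1 + - a) s)\<^sup>2 + (norm (w s))\<^sup>2 / \<theta>) / 2"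
    by (rule mult_le_weighted_squares) fact
  finally show ?thesis
    unfolding power_mult_distrib pker_square by simp
qed

lemma kernel_product_integrable: "integrable lborel (\<lambda>s. pker (1 + a) (t - s) *\<^sub>R W s)"
proof (rule Bochner_Integration.integrable_bound)
  show "integrable lborel (\<lambda>s. (1 * (pker (1 + 2 * a) (t - s) * pker (1 - 2 * a) s) + (norm (w s))\<^sup>2 / 1) / 2)"
    using a by (intro integrable_divide Bochner_Integration.integrable_add w_sq pker_beta0(1) integrable_mult_right) auto
  show "AE s in lborel. norm (pker (1 + a) (t - s) *\<^sub>R W s)
    \<le> norm ((1 * (pker (1 + 2 * a) (t - s) * pker (1 - 2 * a) s) + (norm (w s))\<^sup>2 / 1) / 2)"
    using kernel_product_bound[of 1 t]
    by (intro always_eventually allI le_norm_real) simp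
qed measurable

text \<open>Half the sum of the two quantities produced by \<open>kernel_product_bound\<close>: the
  Beta factor of the squared kernel and the squared norm of the control.\<close>

definition CY where "CY = (Beta (1 + 2 * a) (1 - 2 * a) + N) / 2"

lemma CY_nonneg: "0 \<le> CY"
proof -
  have "0 < Beta (1 + 2 * a) (1 - 2 * a)"
    using a by (intro Beta_real_pos) auto
  with N_nonneg show ?thesis by (simp add: CY_def)
qed

lemma abel_norm_W_bound:
  assumes "0 \<le> t"
  shows "abel (1 + a) (\<lambda>s. norm (W s)) t \<le> CY * sqrt t"
proof (cases "t = 0")
  case True
  have "abel (1 + a) (\<lambda>s. norm (W s)) 0 = abel (1 + a) (\<lambda>s. 0) 0"
    by (rule abel_cong) (auto simp: W_supp)
  with True show ?thesis by (simp add: abel_def)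
next
  case False
  define \<theta> where "\<theta> = 1 / sqrt t"
  have th: "0 < \<theta>" using False assms by (simp add: \<theta>_def)
  have p: "0 < 1 + 2 * a" "0 < 1 - 2 * a" using a by auto
  let ?g = "\<lambda>s. (\<theta> * (pker (1 + 2 * a) (t - s) * pker (1 - 2 * a) s) + (norm (w s))\<^sup>2 / \<theta>) / 2"
  have ig: "integrable lborel ?g"
    using p by (intro integrable_divide Bochner_Integration.integrable_add w_sq pker_beta0(1) integrable_mult_right) auto
  have "abel (1 + a) (\<lambda>s. norm (W s)) t \<le> (LINT s|lborel. ?g s)"
    unfolding abel_def
  proof (rule integral_mono[OF _ ig])
    show "integrable lborel (\<lambda>s. pker (1 + a) (t - s) *\<^sub>R norm (W s))"
      using integrable_norm[OF kernel_product_integrable[of t]] by simp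
  qed (use kernel_product_bound[OF th, of t] in simp)
  \<comment> \<open>The orders 1 + 2 a and 1 - 2 a add up to 2, so the squared kernel integrates to
    a multiple of t itself, whatever a is.\<close>
  also have "\<dots> = (\<theta> * (Beta (1 + 2 * a) (1 - 2 * a) * t) + N / \<theta>) / 2"
    using p False assms w_sq pker_beta0[OF p, of t]
    by (simp add: N_def abel_def pker_two integrable_mult_right)
  also have "\<dots> = CY * sqrt t"
  proof -
    have "(1 / r * (x * (r * r)) + N / (1 / r)) / 2 = (x + N) / 2 * r" if "0 < r" for r x :: real
      using that by (simp add: field_simps)
    from this[of "sqrt t"] show ?thesis using False assms by (simp add: \<theta>_def CY_def)
  qed
  finally show ?thesis .
qed

lemma Y_bound: "0 \<le> t \<Longrightarrow> norm (Y t) \<le> CY * sqrt t"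
  unfolding Y_def by (rule order_trans[OF abel_norm_le abel_norm_W_bound])

lemma Y_nonpos: "t \<le> 0 \<Longrightarrow> Y t = 0"
proof -
  assume "t \<le> 0"
  then have "abel (1 + a) W t = abel (1 + a) (\<lambda>_. 0) t"
    by (intro abel_cong) (simp add: W_supp)
  then show ?thesis by (simp add: Y_def abel_def)
qed

text \<open>The factor sqrt t gained by \<open>Y\<close> raises the order of a power weight by 1/2.
  Weights of order down to -1/2 thus become integrable against \<open>Y\<close>, in particular those
  of order a and of order 0.\<close>

lemma pker_Y_bound: "norm (pker e t *\<^sub>R Y t) \<le> CY * pker (e + 1/2) t"
proof (cases "0 < t")
  case True
  then have "norm (pker e t *\<^sub>R Y t) \<le> t powr (e - 1) * (CY * sqrt t)"
    using Y_bound[of t] by (simp add: pker_def mult_left_mono)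
  also have "\<dots> = CY * (t powr (e - 1) * t powr (1/2))"
    using True by (simp add: powr_half_sqrt)
  also have "\<dots> = CY * pker (e + 1/2) t"
    using True by (simp add: pker_def powr_add [symmetric])
  finally show ?thesis .
qed (simp add: CY_nonneg)

lemma abel_pker_Y_integrable:
  assumes "-1/2 < e" "0 < p"
  shows "integrable lborel (\<lambda>s. pker p (t - s) *\<^sub>R (pker e s *\<^sub>R Y s))"
proof (rule Bochner_Integration.integrable_bound)
  show "integrable lborel (\<lambda>s. CY * (pker p (t - s) * pker (e + 1/2) s))"
    using assms by (intro integrable_mult_right pker_beta0(1)) auto
  have bnd: "norm (pker p (t - s) *\<^sub>R (pker e s *\<^sub>R Y s)) \<le> CY * (pker p (t - s) * pker (e + 1/2) s)" for s
    using mult_left_mono[OF pker_Y_bound[of e s] pker_nonneg[of p "t - s"]] by (simp add: mult_ac)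
  show "AE s in lborel. norm (pker p (t - s) *\<^sub>R (pker e s *\<^sub>R Y s))
    \<le> norm (CY * (pker p (t - s) * pker (e + 1/2) s))"
    by (intro always_eventually allI le_norm_real bnd)
qed measurable

text \<open>Formally the integral of q^a Y'(q) over [0, t], written after integration by parts so
  that it makes sense for a \<open>Y\<close> that is not differentiable.\<close>

definition G where "G t = pker (1 + a) t *\<^sub>R Y t - a *\<^sub>R abel 1 (\<lambda>s. pker a s *\<^sub>R Y s) t"

text \<open>The weighted primitive of \<open>s\<^sup>a\<^sup>-\<^sup>1 Y\<close> with exponent \<open>-a\<close> cancels against \<open>G = 0\<close>; no derivatives are taken.\<close>

lemma G_zero_imp_Y_zero:
  assumes "\<And>t. t \<in> {0..T} \<Longrightarrow> G t = 0" "t \<in> {0..T}"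
  shows "Y t = 0"
proof (cases "t = 0")
  case False
  define Z where "Z = (\<lambda>s. pker a s *\<^sub>R Y s)"
  have [measurable]: "Z \<in> borel_measurable borel" unfolding Z_def by measurable
  have t: "0 < t" "t \<le> T" using assms False by auto
  have PZ: "pker (1 + a) s *\<^sub>R Y s = a *\<^sub>R abel 1 Z s" if "s \<in> {0..T}" for s
    using assms(1)[OF that] by (simp add: G_def Z_def)
  have Z1: "pker (1 + - a) s *\<^sub>R Z s = pker 0 s *\<^sub>R Y s" for s
    by (simp add: Z_def pker_mult)
  have "pker (1 + - a) t *\<^sub>R abel 1 Z t - (- a) *\<^sub>R abel 1 (\<lambda>s. pker (- a) s *\<^sub>R abel 1 Z s) t
      = abel 1 (\<lambda>r. pker (1 + - a) r *\<^sub>R Z r) t"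
  proof (rule weighted_primitive)
    show "integrable lborel (\<lambda>r. pker 1 (t - r) *\<^sub>R Z r)"
      unfolding Z_def using a by (intro abel_pker_Y_integrable) auto
    show "integrable lborel (\<lambda>r. pker 1 (t - r) *\<^sub>R (pker (1 + - a) r *\<^sub>R Z r))"
      unfolding Z1 by (intro abel_pker_Y_integrable) auto
  qed (auto simp: Z_def)
  \<comment> \<open>Both integrands are Y(s) / s: on the left by the definition of \<open>Z\<close>,
    on the right because G(s) = 0 identifies a times the primitive of \<open>Z\<close> with s^a
    Y(s).\<close>
  also have "abel 1 (\<lambda>r. pker (1 + - a) r *\<^sub>R Z r) t = abel 1 (\<lambda>s. a *\<^sub>R (pker (- a) s *\<^sub>R abel 1 Z s)) t"
  proof (rule abel_cong)
    fix s assume s: "s < t"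
    show "pker (1 + - a) s *\<^sub>R Z s = a *\<^sub>R (pker (- a) s *\<^sub>R abel 1 Z s)"
    proof (cases "0 < s")
      case True
      have "a *\<^sub>R (pker (- a) s *\<^sub>R abel 1 Z s) = pker (- a) s *\<^sub>R (pker (1 + a) s *\<^sub>R Y s)"
        using PZ[of s] True s t by simp
      also have "\<dots> = pker (1 + - a) s *\<^sub>R Z s"
        unfolding Z1 by (simp add: pker_mult)
      finally show ?thesis by simp
    qed simp
  qed
  also have "\<dots> = a *\<^sub>R abel 1 (\<lambda>s. pker (- a) s *\<^sub>R abel 1 Z s) t"
    by (rule abel_scaleR)
  finally have "abel 1 Z t = 0" using t pker_pos[of t "1 - a"] by simp
  with PZ[of t] t pker_pos[of t "1 + a"] show ?thesis by simp
qed (simp add: Y_nonpos)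

end

section \<open>Continuity of Abel integrals\<close>

lemma pker_isCont: "x \<noteq> 0 \<Longrightarrow> isCont (pker b) x"
proof (cases "0 < x")
  case True
  then have "isCont (\<lambda>x. x powr (b - 1)) x"
    by (intro continuous_intros) auto
  moreover have "eventually (\<lambda>y. pker b y = y powr (b - 1)) (nhds x)"
    using eventually_nhds_in_open[of "{0<..}" x] True by (auto simp: pker_def elim!: eventually_mono)
  ultimately show ?thesis by (simp add: isCont_cong)
next
  case False
  moreover assume "x \<noteq> 0"
  ultimately have "eventually (\<lambda>y. y \<in> {..<0}) (nhds x)"
    using eventually_nhds_in_open[of "{..<0}" x] by auto
  then have "eventually (\<lambda>y. pker b y = 0) (nhds x)"
    by eventually_elim simp
  then show ?thesis by (simp add: isCont_cong)
qed

text \<open>Dominated convergence: for fixed t the exceptional points d and d' of the kernel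
  correspond to two values of s, a null set. Two such points are allowed because a truncated power
  kernel may be discontinuous at the origin and at the truncation.\<close>

lemma convolution_continuous:
  fixes W :: "real \<Rightarrow> 'a::{banach,second_countable_topology}"
  assumes [measurable]: "k \<in> borel_measurable borel" and B: "\<And>x. x \<le> T \<Longrightarrow> \<bar>k x\<bar> \<le> B"
    and k: "\<And>x. x \<noteq> d \<Longrightarrow> x \<noteq> d' \<Longrightarrow> isCont k x"
    and W: "integrable lborel W" "\<And>s. s \<le> 0 \<Longrightarrow> W s = 0"
  shows "continuous_on {..T} (\<lambda>t. LINT s|lborel. k (t - s) *\<^sub>R W s)"
proof (rule continuous_on_sequentiallyI)
  fix u t assume u: "\<forall>n. u n \<in> {..T}" and t: "t \<in> {..T}" and lim: "u \<longlonglongrightarrow> t"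
  have [measurable]: "W \<in> borel_measurable borel" using W(1) by (simp add: integrable_iff_bounded)
  show "(\<lambda>n. LINT s|lborel. k (u n - s) *\<^sub>R W s) \<longlonglongrightarrow> (LINT s|lborel. k (t - s) *\<^sub>R W s)"
  proof (rule integral_dominated_convergence[where w = "\<lambda>s. B * norm (W s)"])
    show "integrable lborel (\<lambda>s. B * norm (W s))"
      using W(1) by (intro integrable_mult_right integrable_norm)
    show "AE s in lborel. (\<lambda>n. k (u n - s) *\<^sub>R W s) \<longlonglongrightarrow> k (t - s) *\<^sub>R W s"
      using AE_lborel_singleton[of "t - d"] AE_lborel_singleton[of "t - d'"]
    proof eventually_elim
      case (elim s)
      then have "isCont k (t - s)" by (intro k) auto
      then have "(\<lambda>n. k (u n - s)) \<longlonglongrightarrow> k (t - s)"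
        by (rule isCont_tendsto_compose) (intro tendsto_intros lim)
      then show ?case by (intro tendsto_intros)
    qed
    show "AE s in lborel. norm (k (u n - s) *\<^sub>R W s) \<le> B * norm (W s)" for n
    proof (intro always_eventually allI)
      fix s
      show "norm (k (u n - s) *\<^sub>R W s) \<le> B * norm (W s)"
      proof (cases "s \<le> 0")
        case False
        then have "u n - s \<le> T" using u[rule_format, of n] by simp
        from B[OF this] show ?thesis by (simp add: mult_right_mono)
      qed (simp add: W(2))
    qed
  qed measurable
qed

lemma abel_continuous:
  fixes W :: "real \<Rightarrow> 'a::{banach,second_countable_topology}"
  assumes "1 \<le> b" "integrable lborel W" "\<And>s. s \<le> 0 \<Longrightarrow> W s = 0"
  shows "continuous_on {..T} (abel b W)"
proof -
  have "\<bar>pker b x\<bar> \<le> pker b T" if "x \<le> T" for x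
    using pker_mono[OF assms(1) that] by simp
  then have "continuous_on {..T} (\<lambda>t. LINT s|lborel. pker b (t - s) *\<^sub>R W s)"
    using assms by (intro convolution_continuous[where d = 0 and d' = 0]) (auto simp: pker_isCont)
  then show ?thesis by (simp add: abel_def [abs_def])
qed

context l2_control
begin

text \<open>Removing the part t - s < d of the singular kernel leaves a kernel bounded by d^a, hence
  a continuous convolution. The removed part is small uniformly in t, by Young's inequality on a
  window of length d.\<close>

lemma Y_continuous_rough:
  assumes "a < 0"
  shows "continuous_on {..T} Y"
proof (rule uniform_limit_theorem)
  define k where "k d x = pker (1 + a) x * (1 - pker 1 (d - x))" for d x
  have [measurable]: "k d \<in> borel_measurable borel" for d unfolding k_def by measurable
  have kb: "\<bar>k d x\<bar> \<le> d powr a" if "0 < d" for d x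
    using that assms powr_mono2'[of a d x] by (auto simp: k_def pker_def not_less)
  have kc: "isCont (k d) x" if "0 < d" "x \<noteq> 0" "x \<noteq> d" for d x
  proof -
    have "isCont (\<lambda>x. pker 1 (d - x)) x"
      using that by (intro continuous_within_compose2[OF _ pker_isCont[THEN continuous_at_imp_continuous_at_within], where f = "\<lambda>x. d - x"]) (auto intro!: continuous_intros)
    then show ?thesis unfolding k_def
      using pker_isCont[OF \<open>x \<noteq> 0\<close>] by (intro continuous_intros)
  qed
  define Yd where "Yd d t = (LINT s|lborel. k d (t - s) *\<^sub>R W s)" for d t
  show "\<forall>\<^sub>F d in at_right 0. continuous_on {..T} (Yd d)"
    unfolding Yd_def [abs_def]
  proof (intro eventually_mono[OF eventually_at_right_less] convolution_continuous W_integrable)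
    show "\<And>d x. 0 < d \<Longrightarrow> \<bar>k d x\<bar> \<le> d powr a" by (rule kb)
    show "\<And>d x. 0 < d \<Longrightarrow> x \<noteq> 0 \<Longrightarrow> x \<noteq> d \<Longrightarrow> isCont (k d) x" by (rule kc)
  qed (simp_all add: W_supp)
  \<comment> \<open>Up to a Beta factor, d^(2 p) is the integral of (t - s)^(2 a) over the window.
    The weight d^(-p) chosen below balances the two terms of Young's inequality, so that d^p becomes
    the rate of convergence.\<close>
  define p where "p = (1 + 2 * a) / 2"
  have p: "0 < p" "1 + 2 * a = 2 * p" using a by (auto simp: p_def)
  define B where "B = pker (1 - 2 * a) T * Beta (1 + 2 * a) 1"
  have err: "norm (Yd d t - Y t) \<le> d powr p * (B + N) / 2" if d: "0 < d" and t: "t \<le> T" for d t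
  proof -
    define \<theta> where "\<theta> = d powr (- p)"
    have th: "0 < \<theta>" using d by (simp add: \<theta>_def)
    let ?m = "\<lambda>s. pker (1 + 2 * a) (t - s) * pker 1 (s - (t - d))"
    let ?g = "\<lambda>s. (\<theta> * (pker (1 - 2 * a) T * ?m s) + (norm (w s))\<^sup>2 / \<theta>) / 2"
    have m: "integrable lborel ?m" "(LINT s|lborel. ?m s) = Beta (1 + 2 * a) 1 * d powr (2 * p)"
      using pker_beta_integrable[of "1 + 2 * a" 1 t "t - d"] a d p by (auto simp: pker_def)
    have ig: "integrable lborel ?g"
      by (intro integrable_divide Bochner_Integration.integrable_add w_sq integrable_mult_right m)
    have int: "integrable lborel (\<lambda>s. k d (t - s) *\<^sub>R W s)"
    proof (rule Bochner_Integration.integrable_bound[OF integrable_norm[OF kernel_product_integrable[of t]]])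
      show "AE s in lborel. norm (k d (t - s) *\<^sub>R W s) \<le> norm (norm (pker (1 + a) (t - s) *\<^sub>R W s))"
        by (intro always_eventually allI) (auto simp: k_def pker_def)
    qed measurable
    have "norm (Yd d t - Y t) = norm (LINT s|lborel. k d (t - s) *\<^sub>R W s - pker (1 + a) (t - s) *\<^sub>R W s)"
      unfolding Yd_def Y_def abel_def
      by (subst Bochner_Integration.integral_diff[OF int kernel_product_integrable]) simp
    also have "\<dots> \<le> (LINT s|lborel. ?g s)"
    proof (rule order_trans[OF integral_norm_bound integral_mono[OF _ ig]])
      show "integrable lborel (\<lambda>s. norm (k d (t - s) *\<^sub>R W s - pker (1 + a) (t - s) *\<^sub>R W s))"
        by (intro integrable_norm Bochner_Integration.integrable_diff int kernel_product_integrable)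
      fix s
      show "norm (k d (t - s) *\<^sub>R W s - pker (1 + a) (t - s) *\<^sub>R W s) \<le> ?g s"
      proof (cases "s \<in> {0<..T}")
        case True
        have "k d (t - s) *\<^sub>R W s - pker (1 + a) (t - s) *\<^sub>R W s
            = - (pker 1 (s - (t - d)) *\<^sub>R (pker (1 + a) (t - s) *\<^sub>R W s))"
          by (simp add: k_def scaleR_diff_left algebra_simps)
        then have "norm (k d (t - s) *\<^sub>R W s - pker (1 + a) (t - s) *\<^sub>R W s)
            = pker 1 (s - (t - d)) * (pker (1 + a) (t - s) * norm (W s))"
          by simp
        also have "\<dots> \<le> pker 1 (s - (t - d)) *
            ((\<theta> * (pker (1 + 2 * a) (t - s) * pker (1 - 2 * a) s) + (norm (w s))\<^sup>2 / \<theta>) / 2)"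
          by (intro mult_left_mono kernel_product_bound th pker_nonneg)
        also have "\<dots> = (\<theta> * (?m s * pker (1 - 2 * a) s) + pker 1 (s - (t - d)) * ((norm (w s))\<^sup>2 / \<theta>)) / 2"
          by (simp add: algebra_simps)
        \<comment> \<open>For a < 0 the weight s^(-2 a) is increasing and is replaced by its value
          at T.\<close>
        also have "\<dots> \<le> (\<theta> * (?m s * pker (1 - 2 * a) T) + 1 * ((norm (w s))\<^sup>2 / \<theta>)) / 2"
          using assms True th
          by (intro divide_right_mono add_mono mult_left_mono mult_right_mono mult_nonneg_nonneg pker_mono)
            (auto simp: pker_def)
        finally show ?thesis by (simp add: mult_ac)
      next
        case False
        then show ?thesis using th by (simp add: W_supp w_supp)
      qed
    qed
    also have "\<dots> = (\<theta> * (pker (1 - 2 * a) T * (Beta (1 + 2 * a) 1 * d powr (2 * p))) + N / \<theta>) / 2"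
      using m w_sq by (simp add: N_def)
    also have "\<dots> = d powr p * (B + N) / 2"
    proof -
      have "\<theta> * d powr (2 * p) = d powr p"
        using d by (simp add: \<theta>_def powr_add [symmetric])
      moreover have "N / \<theta> = d powr p * N"
        using d by (simp add: \<theta>_def powr_minus field_simps)
      ultimately show ?thesis by (simp add: B_def algebra_simps)
    qed
    finally show ?thesis .
  qed
  have lim: "((\<lambda>d. d powr p * (B + N) / 2) \<longlongrightarrow> 0) (at_right 0)"
    using p by (auto intro!: tendsto_eq_intros tendsto_zero_powrI eventually_at_right_less simp: eventually_at_filter)
  show "uniform_limit {..T} Yd Y (at_right 0)"
  proof (rule uniform_limitI)
    fix e :: real assume "0 < e"
    from order_tendstoD(2)[OF lim this] eventually_at_right_less[of 0]
    show "\<forall>\<^sub>F d in at_right 0. \<forall>t\<in>{..T}. dist (Yd d t) (Y t) < e"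
    proof eventually_elim
      case (elim d)
      then show ?case using err[of d] by (force simp: dist_norm intro: le_less_trans)
    qed
  qed
qed simp

lemma Y_continuous: "continuous_on {..T} Y"
proof (cases "a < 0")
  case False
  then show ?thesis
    unfolding Y_def by (intro abel_continuous W_integrable) (simp_all add: W_supp)
qed (rule Y_continuous_rough)

end

section \<open>Injectivity: a vanishing Abel integral has a vanishing integrand\<close>

lemma abel_one_eq_integral:
  fixes V :: "real \<Rightarrow> 'a::euclidean_space"
  assumes V: "integrable lborel (\<lambda>s. pker 1 (t - s) *\<^sub>R V s)" and V0: "\<And>s. s \<le> 0 \<Longrightarrow> V s = 0"
    and [measurable]: "V \<in> borel_measurable borel"
  shows "abel 1 V t = integral {0..t} V" "V integrable_on {0..t}"
proof -
  have ae: "AE s in lborel. pker 1 (t - s) *\<^sub>R V s = indicator {0..t} s *\<^sub>R V s"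
    using AE_lborel_singleton[of t]
  proof eventually_elim
    case (elim s)
    then show ?case using V0[of s] by (auto simp: pker_def split: split_indicator)
  qed
  have i: "set_integrable lborel {0..t} V"
    unfolding set_integrable_def by (rule integrable_cong_AE[THEN iffD1, OF _ _ ae V]) measurable
  have "abel 1 V t = (LINT s:{0..t}|lborel. V s)"
    unfolding abel_def set_lebesgue_integral_def by (rule integral_cong_AE[OF _ _ ae]) measurable
  then show "abel 1 V t = integral {0..t} V"
    using set_borel_integral_eq_integral(2)[OF i] by simp
  show "V integrable_on {0..t}"
    using set_borel_integral_eq_integral(1)[OF i] .
qed

text \<open>All interval integrals of \<open>W\<close> vanish, hence so do its right-hand averages.
  These converge to \<open>W\<close> off a negligible set, by Lebesgue differentiation.\<close>

lemma abel_one_zero_imp_AE_zero: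
  fixes W :: "real \<Rightarrow> 'a::euclidean_space"
  assumes W: "integrable lborel W" "\<And>s. s \<notin> {0<..T} \<Longrightarrow> W s = 0"
    and z: "\<And>t. t \<in> {0..T} \<Longrightarrow> abel 1 W t = 0" and T: "0 < T"
  shows "AE s in lborel. W s = 0"
proof -
  have [measurable]: "W \<in> borel_measurable borel" using W(1) by (simp add: integrable_iff_bounded)
  have ip: "integrable lborel (\<lambda>s. pker 1 (t - s) *\<^sub>R W s)" for t
    by (rule Bochner_Integration.integrable_bound[OF W(1)]) (auto simp: pker_def)
  have z': "abel 1 W t = 0" for t
  proof -
    consider "t < 0" | "t \<in> {0..T}" | "T < t" by force
    then show ?thesis
    proof cases
      case 1
      then have "abel 1 W t = abel 1 (\<lambda>_. 0) t" by (intro abel_cong W(2)) auto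
      then show ?thesis by (simp add: abel_def)
    next
      case 3
      have "abel 1 W t = abel 1 W T"
        unfolding abel_def
      proof (rule integral_cong_AE)
        show "AE s in lborel. pker 1 (t - s) *\<^sub>R W s = pker 1 (T - s) *\<^sub>R W s"
          using AE_lborel_singleton[of T]
        proof eventually_elim
          case (elim s)
          then show ?case using W(2)[of s] 3 by (auto simp: pker_def)
        qed
      qed measurable
      with z[of T] T show ?thesis by simp
    qed (rule z)
  qed
  have iv: "W integrable_on cbox x y" for x y
    using integrable_on_lborel[OF W(1)] by (rule integrable_on_subcbox) simp
  have i0: "integral {x..y} W = 0" if "x \<le> y" for x y
  proof -
    have j: "integral {- \<bar>x\<bar>..u} W = 0" for u
    proof (cases "- \<bar>x\<bar> \<le> u \<and> 0 \<le> u")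
      case True
      have "integral {- \<bar>x\<bar>..0} W = integral {- \<bar>x\<bar>..0} (\<lambda>_. 0)"
        by (rule integral_cong) (simp add: W(2))
      moreover have "integral {- \<bar>x\<bar>..0} W + integral {0..u} W = integral {- \<bar>x\<bar>..u} W"
        using Henstock_Kurzweil_Integration.integral_combine[of "- \<bar>x\<bar>" 0 u W] iv True by simp
      moreover have "integral {0..u} W = 0"
        using abel_one_eq_integral(1)[OF ip[of u]] z'[of u] W(2) by auto
      ultimately show ?thesis by simp
    next
      case False
      have "integral {- \<bar>x\<bar>..u} W = integral {- \<bar>x\<bar>..u} (\<lambda>_. 0)"
        by (rule integral_cong) (use False in \<open>auto simp: W(2)\<close>)
      then show ?thesis by simp
    qed
    show ?thesis
      using Henstock_Kurzweil_Integration.integral_combine[of "- \<bar>x\<bar>" x y W] iv that by (simp add: j)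
  qed
  obtain N where N: "negligible N" and d: "\<And>x e. x \<notin> N \<Longrightarrow> 0 < e \<Longrightarrow>
      \<exists>d>0. \<forall>h. 0 < h \<and> h < d \<longrightarrow> norm (integral (cbox x (x + h *\<^sub>R One)) W /\<^sub>R h ^ DIM(real) - W x) < e"
    using integrable_ccontinuous_explicit[of W] iv by metis
  have "W x = 0" if xN: "x \<notin> N" for x
  proof (rule ccontr)
    assume "W x \<noteq> 0"
    then obtain d where "0 < d" and
      *: "\<And>h. 0 < h \<Longrightarrow> h < d \<Longrightarrow> norm (integral (cbox x (x + h *\<^sub>R One)) W /\<^sub>R h ^ DIM(real) - W x) < norm (W x)"
      using d[OF xN, of "norm (W x)"] by auto
    with *[of "d / 2"] i0[of x "x + d / 2"] show False by simp
  qed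
  then have "{x \<in> space lborel. \<not> W x = 0} \<subseteq> N" by auto
  then have "negligible {x. W x \<noteq> 0}" using N negligible_subset by auto
  then have "emeasure lebesgue {x. W x \<noteq> 0} = 0" by (simp add: negligible_iff_emeasure0)
  then have "emeasure lborel {x. W x \<noteq> 0} = 0"
    by (subst (asm) emeasure_completion) auto
  then show ?thesis
    by (subst AE_iff_measurable[OF _ refl]) auto
qed

lemma zero_integrals_imp_zero:
  fixes V :: "real \<Rightarrow> 'a::euclidean_space"
  assumes "continuous_on {0..T} V" "\<And>t. t \<in> {0..T} \<Longrightarrow> integral {0..t} V = 0" "0 < T" "t \<in> {0..T}"
  shows "V t = 0"
proof -
  have "((\<lambda>u. integral {0..u} V) has_vector_derivative V t) (at t within {0..T})"
    by (rule integral_has_vector_derivative) fact+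
  moreover have "((\<lambda>u. integral {0..u} V) has_vector_derivative 0) (at t within {0..T})"
    by (rule has_vector_derivative_transform[OF assms(4), where f = "\<lambda>_. 0"]) (auto simp: assms(2))
  ultimately show ?thesis
    using vector_derivative_unique_within_closed_interval[of 0 T t] assms(3,4) by auto
qed

lemma (in l2_control) pker_W: "pker (1 + a) s *\<^sub>R W s = w s"
  by (cases "s \<in> {0<..T}") (auto simp: W_def pker_mult pker_one w_supp)

text \<open>The Abel integral of order 1 - a maps \<open>Y\<close> to a multiple of
  \<open>abel 2 W\<close>, the double primitive of \<open>W\<close>. The inner primitive
  \<open>abel 1 W\<close> is continuous and its integrals vanish, so it vanishes itself, and then
  \<open>W\<close> is zero almost everywhere. Order -a would lead to a single primitive, but is
  available for a < 0 only.\<close>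

lemma Y_zero_imp_control_zero:
  fixes w :: "real \<Rightarrow> 'a::euclidean_space"
  assumes "l2_control a T w" and Y: "\<And>t. t \<in> {0..T} \<Longrightarrow> l2_control.Y a w t = 0"
  shows "AE s in lborel. w s = 0"
proof -
  interpret l2_control a T w by fact
  have i: "integrable lborel (\<lambda>s. pker b (t - s) *\<^sub>R W s)" if "1 \<le> b" for b t
  proof (rule Bochner_Integration.integrable_bound)
    show "integrable lborel (\<lambda>s. pker b t *\<^sub>R W s)"
      by (intro integrable_scaleR_right W_integrable)
    show "AE s in lborel. norm (pker b (t - s) *\<^sub>R W s) \<le> norm (pker b t *\<^sub>R W s)"
    proof (intro always_eventually allI)
      fix s
      show "norm (pker b (t - s) *\<^sub>R W s) \<le> norm (pker b t *\<^sub>R W s)"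
        using pker_mono[OF that, of "t - s" t] W_supp[of s]
        by (cases "0 < s") (auto intro!: mult_right_mono)
    qed
  qed measurable
  have a2: "0 < 1 - a" "0 < 1 + a" using a by auto
  have "abel 2 W t = 0" if t: "t \<in> {0..T}" for t
  proof -
    have "abel (1 - a) (abel (1 + a) W) t = Beta (1 - a) (1 + a) *\<^sub>R abel ((1 - a) + (1 + a)) W t"
      by (rule abel_abel) (use a2 i[of 2] in auto)
    moreover have "abel (1 - a) (abel (1 + a) W) t = abel (1 - a) (\<lambda>_. 0) t"
    proof (rule abel_cong)
      fix s assume "s < t"
      then show "abel (1 + a) W s = 0"
        using Y[of s] Y_nonpos[of s] t by (cases "0 \<le> s") (auto simp: Y_def)
    qed
    ultimately show ?thesis
      using Beta_real_pos[OF a2] by (simp add: abel_def)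
  qed
  moreover have "abel 1 (abel 1 W) t = Beta 1 1 *\<^sub>R abel (1 + 1) W t"
    "integrable lborel (\<lambda>s. pker 1 (t - s) *\<^sub>R abel 1 W s)" for t
    using abel_abel[of W 1 1 t] i[of 2 t] by auto
  ultimately have z2: "abel 1 (abel 1 W) t = 0" "integrable lborel (\<lambda>s. pker 1 (t - s) *\<^sub>R abel 1 W s)"
    if "t \<in> {0..T}" for t using that by auto
  have W0: "abel 1 W s = 0" if "s \<le> 0" for s
  proof -
    have "abel 1 W s = abel 1 (\<lambda>_. 0) s"
      using that by (intro abel_cong W_supp) auto
    then show ?thesis by (simp add: abel_def)
  qed
  have "abel 1 W t = 0" if "t \<in> {0..T}" for t
  proof (rule zero_integrals_imp_zero[OF _ _ T that])
    show "continuous_on {0..T} (abel 1 W)"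
      by (rule continuous_on_subset[OF abel_continuous[OF _ W_integrable]]) (auto simp: W_supp)
    show "integral {0..t} (abel 1 W) = 0" if "t \<in> {0..T}" for t
      using abel_one_eq_integral(1)[OF z2(2)[OF that] W0] z2(1)[OF that] by simp
  qed
  then have "AE s in lborel. W s = 0"
    by (intro abel_one_zero_imp_AE_zero[OF W_integrable W_supp _ T])
  then show ?thesis
    by eventually_elim (use pker_W in \<open>metis scaleR_zero_right\<close>)
qed

section \<open>Solving the Abel equation\<close>

lemma pker_le_pker:
  assumes "b' \<le> b" "x \<le> t"
  shows "pker b x \<le> t powr (b - b') * pker b' x"
proof (cases "0 < x")
  case True
  have "pker b x = x powr (b - b') * pker b' x"
    using True by (simp add: pker_def powr_add [symmetric])
  also have "\<dots> \<le> t powr (b - b') * pker b' x"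
    using assms True by (intro mult_right_mono powr_mono2) auto
  finally show ?thesis .
qed simp

text \<open>The power s^(-|a|) is square integrable near the origin because 2 |a| < 1. This single
  bound serves both signs of a.\<close>

lemma l2_control_intro:
  fixes w :: "real \<Rightarrow> 'a::{banach,second_countable_topology}"
  assumes "\<bar>a\<bar> < 1/2" "0 < T" and [measurable]: "w \<in> borel_measurable borel"
    and "\<And>s. s \<notin> {0<..T} \<Longrightarrow> w s = 0" and b: "\<And>s. s \<in> {0<..T} \<Longrightarrow> norm (w s) \<le> C * pker (1 - \<bar>a\<bar>) s"
  shows "l2_control a T w"
proof
  have p: "0 < 1 - 2 * \<bar>a\<bar>" using assms(1) by simp
  show "integrable lborel (\<lambda>s. (norm (w s))\<^sup>2)"
  proof (rule Bochner_Integration.integrable_bound)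
    show "integrable lborel (\<lambda>s. C\<^sup>2 * (pker 1 (T + 1 - s) * pker (1 - 2 * \<bar>a\<bar>) s))"
      using p by (intro integrable_mult_right pker_beta0(1)) auto
    have "(norm (w s))\<^sup>2 \<le> C\<^sup>2 * (pker 1 (T + 1 - s) * pker (1 - 2 * \<bar>a\<bar>) s)" for s
    proof (cases "s \<in> {0<..T}")
      case True
      have "(norm (w s))\<^sup>2 \<le> (C * pker (1 + - \<bar>a\<bar>) s)\<^sup>2"
        using b[OF True] by (intro power_mono) auto
      also have "\<dots> = C\<^sup>2 * pker (1 - 2 * \<bar>a\<bar>) s"
        unfolding power_mult_distrib pker_square by simp
      finally show ?thesis using True by (simp add: pker_one)
    next
      case False
      then show ?thesis by (simp add: assms)
    qed
    then show "AE s in lborel. norm ((norm (w s))\<^sup>2) \<le> norm (C\<^sup>2 * (pker 1 (T + 1 - s) * pker (1 - 2 * \<bar>a\<bar>) s))"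
      by (intro always_eventually allI) simp
  qed measurable
qed (use assms in auto)

text \<open>Up to the factor \<open>c\<^sub>H\<close>, a control \<open>w\<close> as below is mapped by the operator to the primitive of \<open>f\<close>.\<close>

definition represented :: "real \<Rightarrow> real \<Rightarrow> (real \<Rightarrow> 'a::{banach,second_countable_topology}) \<Rightarrow> bool" where
  "represented a T f \<longleftrightarrow> (\<exists>w. l2_control a T w \<and>
     (\<forall>t\<in>{0..T}. abel (1 + a) (\<lambda>s. pker (1 - a) s *\<^sub>R w s) t = abel 1 (\<lambda>s. pker (1 - a) s *\<^sub>R f s) t))"

text \<open>The solution is sought for \<open>W\<close> and the control recovered as s^a W(s). The
  permitted growth of \<open>W\<close> is boundedness for a <= 0 and s^(-2 a) for a > 0; in both
  cases the control is of order s^(-|a|).\<close>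

lemma representedI:
  fixes W :: "real \<Rightarrow> 'a::{banach,second_countable_topology}"
  assumes "\<bar>a\<bar> < 1/2" "0 < T" and [measurable]: "W \<in> borel_measurable borel"
    and W0: "\<And>s. s \<le> 0 \<Longrightarrow> W s = 0"
    and b: "\<And>s. s \<in> {0<..T} \<Longrightarrow> norm (W s) \<le> C * pker (1 - a - \<bar>a\<bar>) s"
    and eq: "\<And>t. t \<in> {0..T} \<Longrightarrow> abel (1 + a) W t = abel 1 (\<lambda>s. pker (1 - a) s *\<^sub>R f s) t"
  shows "represented a T f"
proof -
  define w where "w s = (if s \<in> {0<..T} then pker (1 + a) s *\<^sub>R W s else 0)" for s
  have "l2_control a T w"
  proof (rule l2_control_intro)
    show "w \<in> borel_measurable borel" unfolding w_def by measurable
    show "norm (w s) \<le> C * pker (1 - \<bar>a\<bar>) s" if "s \<in> {0<..T}" for s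
    proof -
      have "norm (w s) = pker (1 + a) s * norm (W s)" using that by (simp add: w_def)
      also have "\<dots> \<le> pker (1 + a) s * (C * pker (1 - a - \<bar>a\<bar>) s)"
        using b[OF that] by (intro mult_left_mono) auto
      also have "\<dots> = C * (pker (1 + a) s * pker (1 - a - \<bar>a\<bar>) s)" by simp
      also have "\<dots> = C * pker (1 - \<bar>a\<bar>) s" by (simp add: pker_mult)
      finally show ?thesis .
    qed
  qed (use assms in \<open>auto simp: w_def\<close>)
  moreover have "abel (1 + a) (\<lambda>s. pker (1 - a) s *\<^sub>R w s) t = abel 1 (\<lambda>s. pker (1 - a) s *\<^sub>R f s) t"
    if "t \<in> {0..T}" for t
  proof -
    have "abel (1 + a) (\<lambda>s. pker (1 - a) s *\<^sub>R w s) t = abel (1 + a) W t"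
      by (rule abel_cong) (use that W0 in \<open>auto simp: w_def pker_mult pker_one\<close>)
    with eq[OF that] show ?thesis by simp
  qed
  ultimately show ?thesis unfolding represented_def by blast
qed

lemma pker_bounded_integrable:
  fixes f :: "real \<Rightarrow> 'a::{banach,second_countable_topology}"
  assumes [measurable]: "f \<in> borel_measurable borel" and b: "\<And>s. norm (f s) \<le> F" and pq: "0 < p" "0 < q"
  shows "integrable lborel (\<lambda>s. pker p (t - s) *\<^sub>R (pker q s *\<^sub>R f s))"
    and "norm (abel p (\<lambda>s. pker q s *\<^sub>R f s) t) \<le> F * (Beta p q * pker (p + q) t)"
proof -
  have i: "integrable lborel (\<lambda>s. F * (pker p (t - s) * pker q s))"
    using pq by (intro integrable_mult_right pker_beta0(1))
  have bnd: "norm (pker p (t - s) *\<^sub>R (pker q s *\<^sub>R f s)) \<le> F * (pker p (t - s) * pker q s)" for s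
    using mult_left_mono[OF b[of s], of "pker p (t - s) * pker q s"] by (simp add: mult_ac)
  show I: "integrable lborel (\<lambda>s. pker p (t - s) *\<^sub>R (pker q s *\<^sub>R f s))"
    by (rule Bochner_Integration.integrable_bound[OF i], measurable)
      (intro always_eventually allI le_norm_real bnd)
  have "norm (abel p (\<lambda>s. pker q s *\<^sub>R f s) t) \<le> (LINT s|lborel. F * (pker p (t - s) * pker q s))"
    unfolding abel_def
    by (rule order_trans[OF integral_norm_bound integral_mono[OF integrable_norm[OF I] i bnd]])
  also have "\<dots> = F * (Beta p q * pker (p + q) t)"
    using pker_beta0(2)[OF pq, of t] by (simp add: abel_def)
  finally show "norm (abel p (\<lambda>s. pker q s *\<^sub>R f s) t) \<le> F * (Beta p q * pker (p + q) t)" .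
qed

text \<open>For a < 0 the Abel integral of order -a complements the order 1 + a to a plain
  primitive, so it inverts the equation up to the factor Beta(1 + a, -a). The solution is of size
  s^(-2 a), a positive power and therefore bounded on [0, T]. For a = 0 both sides of the equation
  are plain primitives.\<close>

lemma represented_rough:
  fixes f :: "real \<Rightarrow> 'a::{banach,second_countable_topology}"
  assumes a: "-1/2 < a" "a \<le> 0" and T: "0 < T" and f [measurable]: "f \<in> borel_measurable borel"
    and b: "\<And>s. norm (f s) \<le> F"
  shows "represented a T f"
proof (cases "a = 0")
  case True
  show ?thesis
  proof (rule representedI[where W = "\<lambda>s. pker 1 s *\<^sub>R f s" and C = F])
    show "norm (pker 1 s *\<^sub>R f s) \<le> F * pker (1 - a - \<bar>a\<bar>) s" for s
      using mult_right_mono[OF b[of s] pker_nonneg[of 1 s]] True by (simp add: mult.commute)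
  qed (use True T in auto)
next
  case False
  then have a': "0 < 1 + a" "0 < - a" "0 < 1 - a" using a by auto
  define B where "B = Beta (1 + a) (- a)"
  have B: "0 < B" unfolding B_def using a' by (intro Beta_real_pos)
  let ?g = "\<lambda>s. pker (1 - a) s *\<^sub>R f s"
  have W: "norm (abel (- a) ?g t) \<le> F * (Beta (- a) (1 - a) * pker (1 - 2 * a) t)" for t
    using pker_bounded_integrable(2)[OF f b, of "- a" "1 - a" t] a' by simp
  show ?thesis
  proof (rule representedI[where W = "\<lambda>t. (1 / B) *\<^sub>R abel (- a) ?g t" and C = "1 / B * (F * Beta (- a) (1 - a)) * T powr (- 2 * a)"])
    fix s assume s: "s \<in> {0<..T}"
    have "norm ((1 / B) *\<^sub>R abel (- a) ?g s) \<le> 1 / B * (F * (Beta (- a) (1 - a) * pker (1 - 2 * a) s))"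
      using W[of s] B by (simp add: divide_right_mono)
    also have "\<dots> = (1 / B * (F * Beta (- a) (1 - a))) * pker (1 - 2 * a) s" by simp
    also have "\<dots> \<le> (1 / B * (F * Beta (- a) (1 - a))) * (T powr (1 - 2 * a - 1) * pker 1 s)"
      using s a False B b[of 0] a' Beta_real_pos[of "- a" "1 - a"]
      by (intro mult_left_mono pker_le_pker mult_nonneg_nonneg order_trans[OF norm_ge_zero b[of 0]]) auto
    also have "\<dots> = 1 / B * (F * Beta (- a) (1 - a)) * T powr (- 2 * a) * pker (1 - a - \<bar>a\<bar>) s"
      using a by simp
    finally show "norm ((1 / B) *\<^sub>R abel (- a) ?g s)
        \<le> 1 / B * (F * Beta (- a) (1 - a)) * T powr (- 2 * a) * pker (1 - a - \<bar>a\<bar>) s" .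
  next
    fix t
    have "abel (1 + a) (abel (- a) ?g) t = Beta (1 + a) (- a) *\<^sub>R abel (1 + a + - a) ?g t"
      by (rule abel_abel) (use a' pker_bounded_integrable(1)[OF f b, of 1 "1 - a" t] in auto)
    then show "abel (1 + a) (\<lambda>t. (1 / B) *\<^sub>R abel (- a) ?g t) t = abel 1 ?g t"
      using B by (simp add: abel_scaleR B_def)
  next
    fix s :: real assume "s \<le> 0"
    then have "abel (- a) ?g s = abel (- a) (\<lambda>_. 0) s" by (intro abel_cong) simp
    then show "(1 / B) *\<^sub>R abel (- a) ?g s = 0" by (simp add: abel_def)
  qed (use a T in auto)
qed

text \<open>
  The fractional derivative of \<open>s\<^sup>-\<^sup>a (f0 + P(s))\<close>, \<open>P = \<integral> p\<close>, is a multiple of \<open>s\<^sup>-\<^sup>2\<^sup>a f0\<close> plus the Abel integral of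
  order \<open>1 - a\<close> of \<open>F = (s\<^sup>-\<^sup>a P)'\<close>. The hypothesis on \<open>p\<close> forces \<open>|P(s)| \<le> C s\<^sup>2\<^sup>a\<close>, which bounds the latter.
\<close>

lemma represented_smooth:
  fixes f p :: "real \<Rightarrow> 'a::{banach,second_countable_topology}"
  assumes a: "0 < a" "a < 1/2" and T: "0 < T" and [measurable]: "p \<in> borel_measurable borel"
    and p0: "\<And>s. s \<le> 0 \<Longrightarrow> p s = 0"
    and int: "\<And>t. t \<in> {0..T} \<Longrightarrow> integrable lborel (\<lambda>s. pker (1 - a) (t - s) *\<^sub>R (pker (1 - a) s *\<^sub>R p s))"
    and bnd: "\<And>t. t \<in> {0..T} \<Longrightarrow> abel (1 - a) (\<lambda>s. pker (1 - a) s * norm (p s)) t \<le> C"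
    and f: "\<And>s. s \<in> {0<..T} \<Longrightarrow> f s = f0 + abel 1 p s"
  shows "represented a T f"
proof -
  \<comment> \<open>On [0, t] a kernel factor of higher order is at most a power of t times the
    factor of order 1 - a, so \<open>int\<close> dominates all these products.\<close>
  have ip: "integrable lborel (\<lambda>s. pker b (t - s) *\<^sub>R (pker c s *\<^sub>R p s))"
    if "1 - a \<le> b" "1 - a \<le> c" "t \<in> {0..T}" for b c t
  proof (rule Bochner_Integration.integrable_bound)
    let ?r = "\<lambda>s. (t powr (b - (1 - a)) * t powr (c - (1 - a))) *\<^sub>R (pker (1 - a) (t - s) *\<^sub>R (pker (1 - a) s *\<^sub>R p s))"
    show "integrable lborel ?r"
      by (intro integrable_scaleR_right int that)
    show "AE s in lborel. norm (pker b (t - s) *\<^sub>R (pker c s *\<^sub>R p s))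
        \<le> norm (?r s)"
    proof (intro always_eventually allI)
      fix s
      show "norm (pker b (t - s) *\<^sub>R (pker c s *\<^sub>R p s))
        \<le> norm (?r s)"
      proof (cases "0 < s \<and> s < t")
        case True
        then have "pker b (t - s) * pker c s
            \<le> (t powr (b - (1 - a)) * pker (1 - a) (t - s)) * (t powr (c - (1 - a)) * pker (1 - a) s)"
          using that by (intro mult_mono pker_le_pker) auto
        then have "pker b (t - s) * pker c s * norm (p s)
            \<le> (t powr (b - (1 - a)) * pker (1 - a) (t - s)) * (t powr (c - (1 - a)) * pker (1 - a) s) * norm (p s)"
          by (rule mult_right_mono) simp
        then show ?thesis by (simp add: mult_ac)
      qed (auto simp: not_less p0)
    qed
  qed measurable
  have ip1: "integrable lborel (\<lambda>s. pker 1 (t - s) *\<^sub>R p s)" if "t \<in> {0..T}" for t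
  proof -
    have "pker 1 s *\<^sub>R p s = p s" for s
      using p0[of s] by (cases "0 < s") (auto simp: pker_one)
    with ip[of 1 1 t] a that show ?thesis by simp
  qed
  have C: "0 \<le> C" using bnd[of 0] T abel_nonneg[of "\<lambda>s. pker (1 - a) s * norm (p s)" "1 - a" 0] by auto
  \<comment> \<open>For 0 < s < t the number 1 is at most t^a (t - s)^(-a) times t^a s^(-a);
    inserting this under the integral lets \<open>bnd\<close> apply and leaves the factor t^(2
    a).\<close>
  have P1: "norm (abel 1 p t) \<le> C * pker (1 + 2 * a) t" if "t \<in> {0..T}" for t
  proof (cases "t = 0")
    case True
    have "abel 1 p 0 = abel 1 (\<lambda>_. 0) 0" by (rule abel_cong) (simp add: p0)
    with True show ?thesis by (simp add: abel_def)
  next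
    case False
    let ?r = "\<lambda>s. (t powr a * t powr a) * (pker (1 - a) (t - s) *\<^sub>R (pker (1 - a) s * norm (p s)))"
    have "norm (abel 1 p t) \<le> abel 1 (\<lambda>s. norm (p s)) t" by (rule abel_norm_le)
    also have "\<dots> \<le> (LINT s|lborel. ?r s)"
      unfolding abel_def
    proof (rule integral_mono)
      show "integrable lborel (\<lambda>s. pker 1 (t - s) *\<^sub>R norm (p s))"
        using integrable_norm[OF ip1[OF that]] by simp
      show "integrable lborel ?r"
        using integrable_norm[OF int[OF that]] by (intro integrable_mult_right) (simp add: mult_ac)
      fix s
      show "pker 1 (t - s) *\<^sub>R norm (p s) \<le> ?r s"
      proof (cases "0 < s \<and> s < t")
        case True
        then have "pker 1 (t - s) * pker 1 s
            \<le> (t powr (1 - (1 - a)) * pker (1 - a) (t - s)) * (t powr (1 - (1 - a)) * pker (1 - a) s)"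
          using a by (intro mult_mono pker_le_pker) auto
        then have "pker 1 (t - s) * pker 1 s * norm (p s)
            \<le> (t powr a * pker (1 - a) (t - s)) * (t powr a * pker (1 - a) s) * norm (p s)"
          by (intro mult_right_mono) simp_all
        then show ?thesis using True by (simp add: mult_ac pker_one)
      qed (auto simp: not_less p0)
    qed
    also have "\<dots> = t powr (2 * a) * abel (1 - a) (\<lambda>s. pker (1 - a) s * norm (p s)) t"
      by (simp add: abel_def powr_add [symmetric])
    also have "\<dots> \<le> t powr (2 * a) * C"
      by (intro mult_left_mono bnd that) simp
    also have "\<dots> = C * pker (1 + 2 * a) t" using False that by (simp add: pker_def)
    finally show ?thesis .
  qed
  have aP1: "norm (pker (- a) s *\<^sub>R abel 1 p s) \<le> C * pker a s" if "s \<in> {0..T}" for s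
  proof -
    have "norm (pker (- a) s *\<^sub>R abel 1 p s) \<le> pker (- a) s * (C * pker (1 + 2 * a) s)"
      using P1[OF that] by (simp add: mult_left_mono)
    also have "\<dots> = C * (pker (- a) s * pker (1 + 2 * a) s)" by simp
    finally show ?thesis by (simp add: pker_mult)
  qed
  have iq: "integrable lborel (\<lambda>s. pker b (t - s) *\<^sub>R (pker (- a) s *\<^sub>R abel 1 p s))"
    and iqn: "abel b (\<lambda>s. norm (pker (- a) s *\<^sub>R abel 1 p s)) t \<le> C * (Beta b a * pker (b + a) t)"
    if "0 < b" "t \<in> {0..T}" for b t
  proof -
    have i: "integrable lborel (\<lambda>s. pker b (t - s) *\<^sub>R (C * pker a s))"
      using integrable_mult_right[OF pker_beta0(1)[OF that(1) a(1)], of C t] by (simp add: mult_ac)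
    have le: "s < t \<Longrightarrow> 0 \<le> norm (pker (- a) s *\<^sub>R abel 1 p s) \<and> norm (pker (- a) s *\<^sub>R abel 1 p s) \<le> C * pker a s" for s
      using aP1[of s] that by (cases "0 \<le> s") auto
    have [measurable]: "(\<lambda>s. norm (pker (- a) s *\<^sub>R abel 1 p s)) \<in> borel_measurable borel" by measurable
    have "integrable lborel (\<lambda>s. norm (pker b (t - s) *\<^sub>R (pker (- a) s *\<^sub>R abel 1 p s)))"
      using abel_mono(2)[OF _ i le] by (simp add: mult_ac)
    then show "integrable lborel (\<lambda>s. pker b (t - s) *\<^sub>R (pker (- a) s *\<^sub>R abel 1 p s))"
      by (subst (asm) integrable_norm_iff) measurable
    have "abel b (\<lambda>s. norm (pker (- a) s *\<^sub>R abel 1 p s)) t \<le> abel b (\<lambda>s. C *\<^sub>R pker a s) t"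
      using abel_mono(1)[OF _ i le] by simp
    also have "\<dots> = C * (Beta b a * pker (b + a) t)"
      by (subst abel_scaleR) (simp add: pker_beta0(2)[OF that(1) a(1)])
    finally show "abel b (\<lambda>s. norm (pker (- a) s *\<^sub>R abel 1 p s)) t \<le> C * (Beta b a * pker (b + a) t)" .
  qed
  \<comment> \<open>The product rule for s^(-a) times the primitive of \<open>p\<close>. By
    \<open>P1\<close> the second summand is only of size s^(a - 1), which is integrable.\<close>
  define F where "F = (\<lambda>s. pker (1 - a) s *\<^sub>R p s + a *\<^sub>R (- (pker (- a) s *\<^sub>R abel 1 p s)))"
  have [measurable]: "F \<in> borel_measurable borel" unfolding F_def by measurable
  have iF: "integrable lborel (\<lambda>s. pker b (t - s) *\<^sub>R F s)" if "1 - a \<le> b" "t \<in> {0..T}" for b t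
  proof -
    have "integrable lborel (\<lambda>s. pker b (t - s) *\<^sub>R (pker (1 - a) s *\<^sub>R p s)
        - a *\<^sub>R (pker b (t - s) *\<^sub>R (pker (- a) s *\<^sub>R abel 1 p s)))"
      by (intro Bochner_Integration.integrable_diff integrable_scaleR_right ip iq) (use that a in auto)
    then show ?thesis by (simp add: F_def scaleR_diff_right mult_ac)
  qed
  have F1: "abel 1 F t = pker (1 - a) t *\<^sub>R abel 1 p t" if "t \<in> {0..T}" for t
  proof -
    have "pker (1 + - a) t *\<^sub>R abel 1 p t - (- a) *\<^sub>R abel 1 (\<lambda>s. pker (- a) s *\<^sub>R abel 1 p s) t
        = abel 1 (\<lambda>r. pker (1 + - a) r *\<^sub>R p r) t"
      by (rule weighted_primitive) (use p0 ip1 ip[of 1 "1 - a" t] that a in auto)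
    moreover have "abel 1 F t = abel 1 (\<lambda>r. pker (1 - a) r *\<^sub>R p r) t - a *\<^sub>R abel 1 (\<lambda>s. pker (- a) s *\<^sub>R abel 1 p s) t"
    proof -
      have ia: "integrable lborel (\<lambda>s. pker 1 (t - s) *\<^sub>R (pker (1 - a) s *\<^sub>R p s))"
        using a that by (intro ip) auto
      have ib: "integrable lborel (\<lambda>s. pker 1 (t - s) *\<^sub>R (a *\<^sub>R (pker (- a) s *\<^sub>R abel 1 p s)))"
        using integrable_scaleR_right[OF iq[of 1 t], of a] that by (simp add: mult_ac)
      show ?thesis
        using abel_diff[OF ia ib] by (simp only: abel_scaleR F_def scaleR_minus_right add_uminus_conv_diff)
    qed
    ultimately show ?thesis by (simp add: algebra_simps) (metis add_right_cancel)
  qed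
  define B where "B = Beta (1 + a) (1 - a)"
  have B: "0 < B" unfolding B_def using a by (intro Beta_real_pos) auto
  \<comment> \<open>The orders 1 + a and 1 - a add up to 2, and a double primitive of
    \<open>F\<close> is by \<open>F1\<close> a single primitive of s^(-a) times the primitive of
    \<open>p\<close>.\<close>
  have W1: "abel (1 + a) (abel (1 - a) F) t = B *\<^sub>R abel 1 (\<lambda>s. pker (1 - a) s *\<^sub>R abel 1 p s) t"
    if t: "t \<in> {0..T}" for t
  proof -
    have "abel (1 + a) (abel (1 - a) F) t = B *\<^sub>R abel ((1 + a) + (1 - a)) F t"
      unfolding B_def by (rule abel_abel) (use a iF[of 2 t] t in auto)
    also have "abel ((1 + a) + (1 - a)) F t = abel 1 (abel 1 F) t"
      using abel_abel(2)[of F 1 1 t] iF[of 2 t] a t by (simp add: Beta_one_one)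
    also have "abel 1 (abel 1 F) t = abel 1 (\<lambda>s. pker (1 - a) s *\<^sub>R abel 1 p s) t"
    proof (rule abel_cong)
      fix s assume "s < t"
      show "abel 1 F s = pker (1 - a) s *\<^sub>R abel 1 p s"
      proof (cases "0 \<le> s")
        case True
        then show ?thesis using F1[of s] \<open>s < t\<close> t by simp
      next
        case False
        have "abel 1 F s = abel 1 (\<lambda>_. 0) s"
          by (rule abel_cong) (use False p0 in \<open>auto simp: F_def\<close>)
        then show ?thesis using False by (simp add: abel_def)
      qed
    qed
    finally show ?thesis .
  qed
  \<comment> \<open>The summand C comes from \<open>bnd\<close>; the other is a times the Abel
    integral of C s^(a - 1), whose orders 1 - a and a add up to 1, so that no power of t
    remains.\<close>
  define D where "D = C + a * (C * Beta (1 - a) a)"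
  have D0: "0 \<le> D" using C a Beta_real_pos[of "1 - a" a] by (simp add: D_def)
  have Fb: "norm (abel (1 - a) F t) \<le> D" if t: "t \<in> {0<..T}" for t
  proof -
    have t': "t \<in> {0..T}" using t by simp
    let ?p = "\<lambda>s. pker (1 - a) s * norm (p s)" and ?q = "\<lambda>s. norm (pker (- a) s *\<^sub>R abel 1 p s)"
    have i1: "integrable lborel (\<lambda>s. pker (1 - a) (t - s) *\<^sub>R ?p s)"
      using integrable_norm[OF int[OF t']] by (simp add: mult_ac)
    have i2: "integrable lborel (\<lambda>s. pker (1 - a) (t - s) *\<^sub>R (a *\<^sub>R ?q s))"
      using integrable_scaleR_right[OF integrable_norm[OF iq[of "1 - a" t]], of a] a t' by (simp add: mult_ac)
    have "norm (abel (1 - a) F t) \<le> abel (1 - a) (\<lambda>s. norm (F s)) t" by (rule abel_norm_le)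
    also have "\<dots> \<le> abel (1 - a) (\<lambda>s. ?p s + a *\<^sub>R ?q s) t"
    proof (rule abel_mono(1))
      show "integrable lborel (\<lambda>s. pker (1 - a) (t - s) *\<^sub>R (?p s + a *\<^sub>R ?q s))"
        using Bochner_Integration.integrable_add[OF i1 i2] by (simp add: algebra_simps)
      show "0 \<le> norm (F s) \<and> norm (F s) \<le> ?p s + a *\<^sub>R ?q s" for s
        using a norm_triangle_ineq[of "pker (1 - a) s *\<^sub>R p s" "a *\<^sub>R (- (pker (- a) s *\<^sub>R abel 1 p s))"]
        by (simp add: F_def)
    qed measurable
    also have "\<dots> = abel (1 - a) ?p t + a *\<^sub>R abel (1 - a) ?q t"
      by (subst abel_add[OF i1 i2]) (simp only: abel_scaleR)
    also have "\<dots> \<le> C + a *\<^sub>R (C * (Beta (1 - a) a * pker (1 - a + a) t))"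
      using a by (intro add_mono bnd t' scaleR_left_mono iqn) auto
    also have "\<dots> = D" using t by (simp add: D_def pker_one)
    finally show ?thesis .
  qed
  \<comment> \<open>The ratio that makes the order 1 + a integral of k s^(-2 a) equal to the
    primitive of s^(-a); both are multiples of t^(1 - a). It handles the constant part
    \<open>f0\<close>.\<close>
  define k where "k = Beta 1 (1 - a) / Beta (1 + a) (1 - 2 * a)"
  have B2: "0 < Beta (1 + a) (1 - 2 * a)" using a by (intro Beta_real_pos) auto
  define W where "W = (\<lambda>s. pker (1 - 2 * a) s *\<^sub>R (k *\<^sub>R f0) + (1 / B) *\<^sub>R abel (1 - a) F s)"
  have i0: "integrable lborel (\<lambda>s. pker b (t - s) *\<^sub>R (pker c s *\<^sub>R v))" "abel b (\<lambda>s. pker c s *\<^sub>R v) t = (Beta b c * pker (b + c) t) *\<^sub>R v"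
    if "0 < b" "0 < c" for b c t and v :: 'a
  proof -
    show "integrable lborel (\<lambda>s. pker b (t - s) *\<^sub>R (pker c s *\<^sub>R v))"
      using integrable_scaleR_left[OF pker_beta0(1)[OF that, of t], of v] by simp
    show "abel b (\<lambda>s. pker c s *\<^sub>R v) t = (Beta b c * pker (b + c) t) *\<^sub>R v"
      using pker_beta0[OF that, of t] by (simp add: abel_def)
  qed
  have a': "0 < 1 + a" "0 < 1 - 2 * a" "0 < 1 - a" using a by auto
  show ?thesis
  proof (rule representedI[where W = W and C = "norm (k *\<^sub>R f0) + 1 / B * D * T powr (2 * a)"])
    show "W \<in> borel_measurable borel" unfolding W_def by measurable
    show "W s = 0" if "s \<le> 0" for s
    proof -
      have "abel (1 - a) F s = abel (1 - a) (\<lambda>_. 0) s"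
        by (rule abel_cong) (use that p0 in \<open>auto simp: F_def\<close>)
      then show ?thesis using that by (simp add: W_def abel_def)
    qed
    show "norm (W s) \<le> (norm (k *\<^sub>R f0) + 1 / B * D * T powr (2 * a)) * pker (1 - a - \<bar>a\<bar>) s"
      if s: "s \<in> {0<..T}" for s
    proof -
      have "norm (W s) \<le> pker (1 - 2 * a) s * norm (k *\<^sub>R f0) + (1 / B) * norm (abel (1 - a) F s)"
        using B norm_triangle_ineq[of "pker (1 - 2 * a) s *\<^sub>R (k *\<^sub>R f0)" "(1 / B) *\<^sub>R abel (1 - a) F s"]
        by (simp add: W_def abs_mult mult.assoc)
      also have "\<dots> \<le> pker (1 - 2 * a) s * norm (k *\<^sub>R f0) + (1 / B) * (D * pker 1 s)"
        using Fb[OF s] B s by (intro add_left_mono mult_left_mono) (auto simp: pker_one)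
      also have "\<dots> \<le> pker (1 - 2 * a) s * norm (k *\<^sub>R f0) + (1 / B) * (D * (T powr (1 - (1 - 2 * a)) * pker (1 - 2 * a) s))"
        using B D0 a s by (intro add_left_mono mult_left_mono pker_le_pker) auto
      also have "\<dots> = (norm (k *\<^sub>R f0) + 1 / B * D * T powr (2 * a)) * pker (1 - a - \<bar>a\<bar>) s"
        using a by (simp add: algebra_simps)
      finally show ?thesis .
    qed
    fix t assume t: "t \<in> {0..T}"
    have ia: "integrable lborel (\<lambda>s. pker (1 + a) (t - s) *\<^sub>R abel (1 - a) F s)"
      by (rule abel_abel(1)) (use a iF[of 2 t] t in auto)
    have "abel (1 + a) W t = abel (1 + a) (\<lambda>s. pker (1 - 2 * a) s *\<^sub>R (k *\<^sub>R f0)) t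
        + (1 / B) *\<^sub>R abel (1 + a) (abel (1 - a) F) t"
      unfolding W_def
      by (subst abel_add) (use i0(1)[of "1 + a" "1 - 2 * a" t "k *\<^sub>R f0"] integrable_scaleR_right[OF ia, of "1 / B"] a'
          in \<open>simp_all add: abel_scaleR mult.commute\<close>)
    also have "\<dots> = (Beta (1 + a) (1 - 2 * a) * pker (2 - a) t * k) *\<^sub>R f0 + abel 1 (\<lambda>s. pker (1 - a) s *\<^sub>R abel 1 p s) t"
      unfolding i0(2)[OF a'(1,2)] W1[OF t] using B by simp
    also have "(Beta (1 + a) (1 - 2 * a) * pker (2 - a) t * k) *\<^sub>R f0 = abel 1 (\<lambda>s. pker (1 - a) s *\<^sub>R f0) t"
      unfolding i0(2)[OF zero_less_one a'(3)] using B2 by (simp add: k_def)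
    also have "abel 1 (\<lambda>s. pker (1 - a) s *\<^sub>R f0) t + abel 1 (\<lambda>s. pker (1 - a) s *\<^sub>R abel 1 p s) t
        = abel 1 (\<lambda>s. pker (1 - a) s *\<^sub>R f0 + pker (1 - a) s *\<^sub>R abel 1 p s) t"
    proof (rule abel_add [symmetric])
      show "integrable lborel (\<lambda>s. pker 1 (t - s) *\<^sub>R (pker (1 - a) s *\<^sub>R f0))"
        using a' by (intro i0(1)) auto
      have "integrable lborel (\<lambda>s. pker 1 (t - s) *\<^sub>R abel 1 F s)"
        by (rule abel_abel(1)) (use a iF[of 2 t] t in auto)
      moreover have "pker 1 (t - s) *\<^sub>R abel 1 F s = pker 1 (t - s) *\<^sub>R (pker (1 - a) s *\<^sub>R abel 1 p s)" for s
      proof -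
        consider "s \<in> {0..T}" | "t \<le> s" | "s < 0" using t by force
        then show ?thesis
        proof cases
          case 3
          have "abel 1 F s = abel 1 (\<lambda>_. 0) s"
            by (rule abel_cong) (use 3 p0 in \<open>auto simp: F_def\<close>)
          then show ?thesis using 3 by (simp add: abel_def)
        qed (simp_all add: F1)
      qed
      ultimately show "integrable lborel (\<lambda>s. pker 1 (t - s) *\<^sub>R (pker (1 - a) s *\<^sub>R abel 1 p s))" by simp
    qed
    also have "\<dots> = abel 1 (\<lambda>s. pker (1 - a) s *\<^sub>R f s) t"
    proof (rule abel_cong)
      fix s assume "s < t"
      then show "pker (1 - a) s *\<^sub>R f0 + pker (1 - a) s *\<^sub>R abel 1 p s = pker (1 - a) s *\<^sub>R f s"
        using f[of s] t by (cases "0 < s") (auto simp: scaleR_add_right)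
    qed
    finally show "abel (1 + a) W t = abel 1 (\<lambda>s. pker (1 - a) s *\<^sub>R f s) t" .
  qed (use a T in auto)
qed

text \<open>\<open>weighted_primitive\<close> with exponent a, applied to s^(-a) f(s): the weight
  s^a that it produces cancels s^(-a) and leaves the primitive of \<open>f\<close>.\<close>

lemma (in l2_control) G_eq_primitive:
  assumes f [measurable]: "f \<in> borel_measurable borel" and b: "\<And>s. norm (f s) \<le> F" and f0: "\<And>s. s \<le> 0 \<Longrightarrow> f s = 0"
    and eq: "\<And>t. t \<in> {0..T} \<Longrightarrow> Y t = abel 1 (\<lambda>s. pker (1 - a) s *\<^sub>R f s) t" and t: "t \<in> {0..T}"
  shows "G t = abel 1 f t"
proof -
  let ?y = "\<lambda>s. pker (1 - a) s *\<^sub>R f s"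
  have ab: "0 < 1 - a" "0 < 1 + a" using a by auto
  have e: "pker (1 + a) s *\<^sub>R ?y s = f s" "pker 1 s *\<^sub>R f s = f s" for s
    using f0[of s] by (cases "0 < s"; simp add: pker_mult pker_one)+
  have i: "integrable lborel (\<lambda>s. pker 1 (t - s) *\<^sub>R f s)"
    using pker_bounded_integrable(1)[OF f b, of 1 1 t] by (simp only: e zero_less_one)
  have "G t = pker (1 + a) t *\<^sub>R abel 1 ?y t - a *\<^sub>R abel 1 (\<lambda>s. pker a s *\<^sub>R abel 1 ?y s) t"
  proof -
    have "abel 1 (\<lambda>s. pker a s *\<^sub>R Y s) t = abel 1 (\<lambda>s. pker a s *\<^sub>R abel 1 ?y s) t"
    proof (rule abel_cong)
      fix s assume "s < t"
      then show "pker a s *\<^sub>R Y s = pker a s *\<^sub>R abel 1 ?y s"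
        using eq[of s] t by (cases "0 < s") auto
    qed
    then show ?thesis unfolding G_def eq[OF t] by simp
  qed
  also have "\<dots> = abel 1 (\<lambda>s. pker (1 + a) s *\<^sub>R ?y s) t"
  proof (rule weighted_primitive)
    show "integrable lborel (\<lambda>r. pker 1 (t - r) *\<^sub>R ?y r)"
      using ab by (intro pker_bounded_integrable(1)[OF f b]) auto
    show "integrable lborel (\<lambda>r. pker 1 (t - r) *\<^sub>R (pker (1 + a) r *\<^sub>R ?y r))"
      unfolding e by (rule i)
  qed auto
  finally show ?thesis unfolding e .
qed

section \<open>The Volterra kernel of the operator\<close>

context l2_control
begin

text \<open>The inner integral of \<open>K_kernel\<close>, with u renamed to q, H - 3/2 = a - 1 and
  H - 1/2 = a. The factors of order 1 and 1 + a vanish outside s < q < t and so replace the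
  domain.\<close>

definition J where "J t s = (LINT q|lborel. pker 1 (t - q) * pker a q * pker (1 + a) (q - s))"

lemma J_meas [measurable]: "(\<lambda>s. J t s) \<in> borel_measurable borel"
  unfolding J_def by measurable

text \<open>Fubini; absolute convergence rests on \<open>abel_norm_W_bound\<close>, since q^(a - 1)
  sqrt q is integrable at the origin for a > -1/2.\<close>

lemma J_W:
  shows "integrable lborel (\<lambda>s. J t s *\<^sub>R W s)"
    and "(LINT s|lborel. J t s *\<^sub>R W s) = abel 1 (\<lambda>q. pker a q *\<^sub>R Y q) t"
proof -
  let ?h = "\<lambda>q s. pker 1 (t - q) * pker a q * pker (1 + a) (q - s)"
  let ?f = "\<lambda>(q, s). ?h q s *\<^sub>R W s"
  have ab: "0 < 1 + a" "0 < a + 1/2" using a by auto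
  have iW: "integrable lborel (\<lambda>s. ?h q s *\<^sub>R W s)" for q
    using integrable_scaleR_right[OF kernel_product_integrable[of q], of "pker 1 (t - q) * pker a q"]
    by (simp add: mult_ac)
  have m: "?f \<in> borel_measurable (lborel \<Otimes>\<^sub>M lborel)" by measurable
  have f: "integrable (lborel \<Otimes>\<^sub>M lborel) (case_prod (\<lambda>q s. ?h q s *\<^sub>R W s))"
  proof (rule lborel_pair.Fubini_integrable[OF m])
    show "integrable lborel (\<lambda>q. LINT s|lborel. norm (?f (q, s)))"
    proof (rule Bochner_Integration.integrable_bound)
      show "integrable lborel (\<lambda>q. CY * (pker 1 (t - q) * pker (a + 1/2) q))"
        using ab by (intro integrable_mult_right pker_beta0(1)) auto
      have "(LINT s|lborel. norm (?f (q, s))) \<le> CY * (pker 1 (t - q) * pker (a + 1/2) q)" for q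
      proof (cases "0 < q")
        case True
        have "(LINT s|lborel. norm (?f (q, s))) = pker 1 (t - q) * pker a q * abel (1 + a) (\<lambda>s. norm (W s)) q"
          unfolding abel_def by (subst integral_mult_right_zero [symmetric]) (simp add: mult_ac)
        also have "\<dots> \<le> pker 1 (t - q) * pker a q * (CY * sqrt q)"
          using True by (intro mult_left_mono abel_norm_W_bound) auto
        also have "\<dots> = CY * (pker 1 (t - q) * pker (a + 1/2) q)"
          using True by (simp add: pker_def powr_half_sqrt [symmetric] powr_add [symmetric] algebra_simps)
        finally show ?thesis .
      qed simp
      moreover have "0 \<le> (LINT s|lborel. norm (?f (q, s)))" for q by simp
      ultimately show "AE q in lborel. norm (LINT s|lborel. norm (?f (q, s))) \<le> norm (CY * (pker 1 (t - q) * pker (a + 1/2) q))"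
        by (intro always_eventually allI le_norm_real) (simp only: real_norm_def abs_of_nonneg)
    qed measurable
    show "AE q in lborel. integrable lborel (\<lambda>s. ?f (q, s))"
      using iW by simp
  qed
  have hs: "integrable lborel (\<lambda>q. ?h q s)" if "0 < s" for s
  proof (rule Bochner_Integration.integrable_bound)
    show "integrable lborel (\<lambda>q. pker a s * (pker 1 (t - q) * pker (1 + a) (q - s)))"
      using ab by (intro integrable_mult_right pker_beta_integrable(1)) auto
    have "?h q s \<le> pker a s * (pker 1 (t - q) * pker (1 + a) (q - s))" for q
    proof (cases "s < q")
      case True
      then have "pker a q \<le> pker a s"
        using a that by (auto simp: pker_def intro!: powr_mono2')
      then have "pker a q * (pker 1 (t - q) * pker (1 + a) (q - s)) \<le> pker a s * (pker 1 (t - q) * pker (1 + a) (q - s))"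
        by (intro mult_right_mono) auto
      then show ?thesis by (simp add: mult_ac)
    qed simp
    then show "AE q in lborel. norm (?h q s) \<le> norm (pker a s * (pker 1 (t - q) * pker (1 + a) (q - s)))"
      by (intro always_eventually allI) simp
  qed measurable
  have inner: "(LINT q|lborel. ?h q s *\<^sub>R W s) = J t s *\<^sub>R W s" for s
  proof (cases "0 < s")
    case True
    then show ?thesis unfolding J_def by (intro integral_scaleR_left hs)
  qed (simp add: W_supp)
  show "integrable lborel (\<lambda>s. J t s *\<^sub>R W s)"
    using lborel_pair.integrable_snd[OF f] by (simp add: inner)
  have "(LINT s|lborel. J t s *\<^sub>R W s) = (LINT q|lborel. LINT s|lborel. ?h q s *\<^sub>R W s)"
    using lborel_pair.Fubini_integral[OF f] by (simp add: inner)
  also have "\<dots> = abel 1 (\<lambda>q. pker a q *\<^sub>R Y q) t"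
    unfolding abel_def Y_def by (subst integral_scaleR_right [symmetric])+ (simp add: mult_ac)
  finally show "(LINT s|lborel. J t s *\<^sub>R W s) = abel 1 (\<lambda>q. pker a q *\<^sub>R Y q) t" .
qed

text \<open>Both (t / s)^a and s^(1/2 - H) contain the weight s^(-a). Factoring it out is what makes
  \<open>W\<close> rather than the control the natural unknown.\<close>

lemma kernel_formula:
  assumes H: "a = H - 1/2" and s: "0 < s" "s < t"
  shows "K_kernel H t s = c_const H * (pker (1 + a) t * pker (1 + a) (t - s) - a * J t s) * pker (1 - a) s"
proof -
  have "(LINT u:{s..t}|lebesgue. u powr (H - 3/2) * (u - s) powr (H - 1/2))
      = (LINT u|lebesgue. pker 1 (t - u) * pker a u * pker (1 + a) (u - s))"
    unfolding set_lebesgue_integral_def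
    by (rule integral_discrete_difference[where X = "{s, t}"])
      (use s in \<open>auto simp: pker_def H split: split_indicator\<close>)
  also have "\<dots> = J t s"
    unfolding J_def by (rule integral_completion) measurable
  finally have "(LINT u:{s..t}|lebesgue. u powr (H - 3/2) * (u - s) powr (H - 1/2)) = J t s" .
  moreover have "(t / s) powr (H - 1/2) = pker (1 + a) t * pker (1 - a) s"
    using s powr_minus_divide[of s "H - 1/2"] by (simp add: pker_def H powr_divide)
  ultimately show ?thesis
    using s by (simp add: K_kernel_def H pker_def algebra_simps)
qed

lemma K_op_eq:
  assumes H: "a = H - 1/2" and t: "t \<in> {0..T}"
    and u: "(\<lambda>s. indicator {0..T} s *\<^sub>R u s) \<in> borel_measurable lebesgue"
      "AE s in lborel. s \<in> {0..T} \<longrightarrow> u s = w s"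
  shows "(LINT s:{0..t}|lebesgue. K_kernel H t s *\<^sub>R u s) = c_const H *\<^sub>R G t"
    and "set_integrable lebesgue {0..t} (\<lambda>s. K_kernel H t s *\<^sub>R u s)"
proof -
  define k where "k s = c_const H * (pker (1 + a) t * pker (1 + a) (t - s) - a * J t s)" for s
  have [measurable]: "k \<in> borel_measurable borel" unfolding k_def by measurable
  have km: "(\<lambda>s. k s * pker (1 - a) s) \<in> borel_measurable lebesgue"
    by (rule measurable_completion) measurable
  have k0: "k s = 0" if "t \<le> s" for s
  proof -
    have "pker 1 (t - q) * pker a q * pker (1 + a) (q - s) = 0" for q
      using that by (cases "q < t") auto
    then have "J t s = 0" unfolding J_def by (simp only: integral_zero)
    then show ?thesis using that by (simp add: k_def)
  qed
  let ?g = "\<lambda>s. (k s * pker (1 - a) s) *\<^sub>R (indicator {0..T} s *\<^sub>R u s)"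
  have gm: "?g \<in> borel_measurable lebesgue" using km u(1) by measurable
  have eq: "indicator {0..t} s *\<^sub>R (K_kernel H t s *\<^sub>R u s) = ?g s" if "s \<notin> {0, t}" for s
  proof (cases "s \<in> {0<..<t}")
    case True
    then show ?thesis using t by (simp add: kernel_formula[OF H] k_def)
  next
    case False
    then show ?thesis using that t k0[of s] by (auto split: split_indicator)
  qed
  have ae: "AE s in lebesgue. ?g s = k s *\<^sub>R W s"
    using AE_completion[OF u(2)] by eventually_elim (auto simp: W_def w_supp split: split_indicator)
  have kWm: "(\<lambda>s. k s *\<^sub>R W s) \<in> borel_measurable lborel" by measurable
  have kW: "(\<lambda>s. k s *\<^sub>R W s) = (\<lambda>s. c_const H *\<^sub>R (pker (1 + a) t *\<^sub>R (pker (1 + a) (t - s) *\<^sub>R W s) - a *\<^sub>R (J t s *\<^sub>R W s)))"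
    by (simp add: k_def fun_eq_iff algebra_simps)
  have ikW: "integrable lborel (\<lambda>s. k s *\<^sub>R W s)"
    unfolding kW by (intro integrable_scaleR_right Bochner_Integration.integrable_diff kernel_product_integrable J_W)
  have "integrable lebesgue ?g"
    using integrable_cong_AE[OF gm measurable_completion[OF kWm] ae] ikW integrable_completion[OF kWm] by simp
  moreover have "integrable lebesgue (\<lambda>s. indicator {0..t} s *\<^sub>R (K_kernel H t s *\<^sub>R u s)) \<longleftrightarrow> integrable lebesgue ?g"
    by (rule integrable_discrete_difference[where X = "{0, t}"]) (use eq in auto)
  ultimately show "set_integrable lebesgue {0..t} (\<lambda>s. K_kernel H t s *\<^sub>R u s)"
    by (simp add: set_integrable_def)
  have "(LINT s:{0..t}|lebesgue. K_kernel H t s *\<^sub>R u s) = (LINT s|lebesgue. ?g s)"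
    unfolding set_lebesgue_integral_def
    by (rule integral_discrete_difference[where X = "{0, t}"]) (use eq in auto)
  also have "\<dots> = (LINT s|lebesgue. k s *\<^sub>R W s)"
    by (rule integral_cong_AE[OF gm measurable_completion[OF kWm] ae])
  also have "\<dots> = (LINT s|lborel. k s *\<^sub>R W s)"
    by (rule integral_completion[OF kWm])
  also have "\<dots> = c_const H *\<^sub>R (LINT s|lborel. pker (1 + a) t *\<^sub>R (pker (1 + a) (t - s) *\<^sub>R W s) - a *\<^sub>R (J t s *\<^sub>R W s))"
    unfolding kW by (rule integral_scaleR_right)
  also have "(LINT s|lborel. pker (1 + a) t *\<^sub>R (pker (1 + a) (t - s) *\<^sub>R W s) - a *\<^sub>R (J t s *\<^sub>R W s)) = G t"
    unfolding G_def J_W(2)[symmetric]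
    unfolding Y_def abel_def
    by (subst Bochner_Integration.integral_diff[OF integrable_scaleR_right[OF kernel_product_integrable] integrable_scaleR_right[OF J_W(1)]])
      (simp only: integral_scaleR_right)
  finally show "(LINT s:{0..t}|lebesgue. K_kernel H t s *\<^sub>R u s) = c_const H *\<^sub>R G t" .
qed

text \<open>For a < 0 the factor t^a is unbounded at the origin, but \<open>pker_Y_bound\<close>
  gives t^a Y(t) the size t^(a + 1/2), which tends to 0.\<close>

lemma G_continuous: "continuous_on {0..T} G"
proof -
  have c1: "continuous_on {0..T} (\<lambda>t. pker (1 + a) t *\<^sub>R Y t)"
    unfolding continuous_on_eq_continuous_within
  proof (intro ballI)
    fix t assume t: "t \<in> {0..T}"
    show "continuous (at t within {0..T}) (\<lambda>t. pker (1 + a) t *\<^sub>R Y t)"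
    proof (cases "t = 0")
      case False
      have "continuous (at t within {0..T}) Y"
        using Y_continuous t continuous_on_subset[of "{..T}" Y "{0..T}"] by (auto simp: continuous_on_eq_continuous_within)
      moreover have "continuous (at t within {0..T}) (pker (1 + a))"
        using pker_isCont[OF False] by (rule continuous_at_imp_continuous_at_within)
      ultimately show ?thesis by (intro continuous_intros)
    next
      case True
      have "((\<lambda>t. CY * pker (1 + a + 1/2) t) \<longlongrightarrow> 0) (at 0 within {0..T})"
      proof -
        have "((\<lambda>t. t powr (a + 1/2)) \<longlongrightarrow> 0) (at 0 within {0..T})"
        proof (rule tendsto_zero_powrI)
          show "\<forall>\<^sub>F t in at 0 within {0..T}. 0 \<le> t"
            by (auto simp: eventually_at_filter)
        qed (use a in \<open>auto intro!: tendsto_eq_intros\<close>)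
        moreover have "\<forall>\<^sub>F t in at 0 within {0..T}. t powr (a + 1/2) = pker (1 + a + 1/2) t"
          by (auto simp: eventually_at_filter pker_def add.commute)
        ultimately have "((\<lambda>t. pker (1 + a + 1/2) t) \<longlongrightarrow> 0) (at 0 within {0..T})"
          by (rule Lim_transform_eventually)
        from tendsto_mult_right_zero[OF this, of CY] show ?thesis .
      qed
      then have "((\<lambda>t. pker (1 + a) t *\<^sub>R Y t) \<longlongrightarrow> 0) (at 0 within {0..T})"
        by (rule Lim_null_comparison[OF always_eventually, rotated]) (intro allI pker_Y_bound)
      then show ?thesis using True by (simp add: continuous_within)
    qed
  qed
  \<comment> \<open>The cut beyond T makes the integrand integrable on the line without changing it
    on [0, T].\<close>
  let ?V = "\<lambda>s. pker 1 (T + 1 - s) *\<^sub>R (pker a s *\<^sub>R Y s)"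
  have "continuous_on {..T} (abel 1 ?V)"
    using a by (intro abel_continuous abel_pker_Y_integrable) auto
  then have c2: "continuous_on {0..T} (abel 1 ?V)"
    by (rule continuous_on_subset) auto
  have "G t = pker (1 + a) t *\<^sub>R Y t - a *\<^sub>R abel 1 ?V t" if "t \<in> {0..T}" for t
  proof -
    have "abel 1 (\<lambda>s. pker a s *\<^sub>R Y s) t = abel 1 ?V t"
      by (rule abel_cong) (use that in \<open>auto simp: pker_one\<close>)
    then show ?thesis by (simp add: G_def)
  qed
  moreover have "continuous_on {0..T} (\<lambda>t. pker (1 + a) t *\<^sub>R Y t - a *\<^sub>R abel 1 ?V t)"
    by (intro continuous_intros c1 c2)
  ultimately show ?thesis by (subst continuous_on_cong[OF refl]) auto
qed

text \<open>For a > 0 the order 1 + a splits into 1 and a, so \<open>Y\<close> is the primitive of a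
  multiple of \<open>abel a W\<close>, and \<open>weighted_primitive\<close> turns this into a
  density of \<open>G\<close> with the additional factor s^a. The dominating \<open>V\<close> is the
  same multiple of the norm of \<open>W\<close>.\<close>

lemma G_density:
  assumes "0 < a"
  obtains p V where "p \<in> borel_measurable borel" "\<And>s. s \<le> 0 \<Longrightarrow> p s = 0"
    "\<And>t. t \<in> {0..T} \<Longrightarrow> G t = abel 1 p t"
    "\<And>t. t \<in> {0..T} \<Longrightarrow> integrable lborel (\<lambda>s. pker 1 (t - s) *\<^sub>R p s)"
    "integrable lborel V" "\<And>s. 0 \<le> (V s :: real)" "\<And>s. s \<le> 0 \<Longrightarrow> V s = 0"
    "\<And>s. norm (p s) \<le> pker (1 + a) s * abel a V s"
proof
  define y where "y = (\<lambda>s. (1 / Beta 1 a) *\<^sub>R abel a W s)"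
  define p where "p = (\<lambda>s. pker (1 + a) s *\<^sub>R y s)"
  define V where "V = (\<lambda>s. (1 / Beta 1 a) *\<^sub>R norm (W s))"
  have B: "0 < Beta 1 a" using assms by (intro Beta_real_pos) auto
  have [measurable]: "y \<in> borel_measurable borel" unfolding y_def by measurable
  show "p \<in> borel_measurable borel" unfolding p_def by measurable
  show "p s = 0" if "s \<le> 0" for s using that by (simp add: p_def)
  have aa: "integrable lborel (\<lambda>s. pker 1 (t - s) *\<^sub>R abel a W s)" "abel 1 (abel a W) t = Beta 1 a *\<^sub>R Y t" for t
    unfolding Y_def by (rule abel_abel; use kernel_product_integrable assms in simp)+
  have yi: "integrable lborel (\<lambda>s. pker 1 (t - s) *\<^sub>R y s)" for t
    using integrable_scaleR_right[OF aa(1)[of t], of "1 / Beta 1 a"] by (simp add: y_def)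
  have y0: "y s = 0" if "s \<le> 0" for s
  proof -
    have "abel a W s = abel a (\<lambda>_. 0) s" by (rule abel_cong) (use that W_supp in auto)
    then show ?thesis by (simp add: y_def abel_def)
  qed
  have Yy: "Y t = abel 1 y t" for t
    using B by (simp add: y_def abel_scaleR aa(2))
  show pint: "integrable lborel (\<lambda>s. pker 1 (t - s) *\<^sub>R p s)" if "t \<in> {0..T}" for t
  proof (rule Bochner_Integration.integrable_bound)
    show "integrable lborel (\<lambda>s. t powr a *\<^sub>R (pker 1 (t - s) *\<^sub>R y s))"
      by (intro integrable_scaleR_right yi)
    show "AE s in lborel. norm (pker 1 (t - s) *\<^sub>R p s) \<le> norm (t powr a *\<^sub>R (pker 1 (t - s) *\<^sub>R y s))"
    proof (intro always_eventually allI)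
      fix s
      show "norm (pker 1 (t - s) *\<^sub>R p s) \<le> norm (t powr a *\<^sub>R (pker 1 (t - s) *\<^sub>R y s))"
      proof (cases "0 < s \<and> s < t")
        case True
        then have "pker (1 + a) s \<le> t powr a"
          using assms by (auto simp: pker_def intro!: powr_mono2)
        then have "pker (1 + a) s * (pker 1 (t - s) * norm (y s)) \<le> t powr a * (pker 1 (t - s) * norm (y s))"
          by (intro mult_right_mono) auto
        then show ?thesis by (simp add: p_def mult_ac)
      qed (auto simp: p_def not_less)
    qed
  qed (simp add: p_def)
  show "G t = abel 1 p t" if t: "t \<in> {0..T}" for t
  proof -
    have "pker (1 + a) t *\<^sub>R abel 1 y t - a *\<^sub>R abel 1 (\<lambda>s. pker a s *\<^sub>R abel 1 y s) t
        = abel 1 (\<lambda>s. pker (1 + a) s *\<^sub>R y s) t"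
      by (rule weighted_primitive) (use y0 yi pint[OF t] in \<open>simp_all add: p_def\<close>)
    moreover have "Y = abel 1 y" using Yy by auto
    ultimately show ?thesis unfolding G_def p_def by simp
  qed
  show "integrable lborel V" unfolding V_def by (intro integrable_scaleR_right integrable_norm W_integrable)
  show "0 \<le> V s" for s using B by (simp add: V_def)
  show "V s = 0" if "s \<le> 0" for s using that by (simp add: V_def W_supp)
  show "norm (p s) \<le> pker (1 + a) s * abel a V s" for s
  proof -
    have "norm (p s) = pker (1 + a) s * ((1 / Beta 1 a) * norm (abel a W s))"
      using B by (simp add: p_def y_def)
    also have "\<dots> \<le> pker (1 + a) s * ((1 / Beta 1 a) * abel a (\<lambda>s. norm (W s)) s)"
      using B by (intro mult_left_mono abel_norm_le) auto
    also have "\<dots> = pker (1 + a) s * abel a V s"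
      unfolding V_def abel_scaleR by simp
    finally show ?thesis .
  qed
qed

end

section \<open>From Lebesgue measurable controls to Borel representatives\<close>

lemma L2_fun_measurable:
  "u \<in> L2_fun T \<Longrightarrow> (\<lambda>s. indicator {0..T} s *\<^sub>R u s) \<in> borel_measurable lebesgue"
  by (simp add: L2_fun_def set_borel_measurable_def)

lemma lebesgue_ex_borel:
  fixes v :: "real \<Rightarrow> 'a::euclidean_space"
  assumes "v \<in> borel_measurable lebesgue"
  obtains g where "g \<in> borel_measurable borel" "AE s in lborel. v s = g s"
proof -
  have "\<forall>b. \<exists>g. g \<in> borel_measurable lborel \<and> (AE s in lborel. v s \<bullet> b = g s)"
  proof
    fix b :: 'a
    have "(\<lambda>s. v s \<bullet> b) \<in> borel_measurable lebesgue"
      by (intro borel_measurable_inner assms borel_measurable_const)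
    from completion_ex_borel_measurable_real[OF this]
    show "\<exists>g. g \<in> borel_measurable lborel \<and> (AE s in lborel. v s \<bullet> b = g s)" by blast
  qed
  then obtain g where g: "\<And>b. g b \<in> borel_measurable lborel" "\<And>b. AE s in lborel. v s \<bullet> b = g b s"
    by metis
  show ?thesis
  proof
    show "(\<lambda>s. \<Sum>b\<in>Basis. g b s *\<^sub>R b) \<in> borel_measurable borel"
      using g(1) by (intro borel_measurable_sum borel_measurable_scaleR) auto
    have "AE s in lborel. \<forall>b\<in>Basis. v s \<bullet> b = g b s"
      by (intro AE_finite_allI g) auto
    then show "AE s in lborel. v s = (\<Sum>b\<in>Basis. g b s *\<^sub>R b)"
      by eventually_elim (metis (no_types, lifting) euclidean_representation sum.cong)
  qed
qed

lemma L2_fun_control: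
  assumes u: "u \<in> L2_fun T" and T: "0 < T" and a: "\<bar>a\<bar> < 1/2"
  obtains w where "l2_control a T w" "AE s in lborel. s \<in> {0..T} \<longrightarrow> u s = w s"
proof -
  let ?v = "\<lambda>s. indicator {0..T} s *\<^sub>R u s"
  obtain g where [measurable]: "g \<in> borel_measurable borel" and ae: "AE s in lborel. ?v s = g s"
    using lebesgue_ex_borel[OF L2_fun_measurable[OF u]] by metis
  define w where "w = (\<lambda>s. indicator {0<..T} s *\<^sub>R g s)"
  have [measurable]: "w \<in> borel_measurable borel" unfolding w_def by measurable
  have aew: "AE s in lborel. ?v s = w s"
    using ae AE_lborel_singleton[of 0]
    by eventually_elim (auto simp: w_def split: split_indicator)
  have "integrable lebesgue (\<lambda>s. indicator {0..T} s *\<^sub>R (norm (u s))\<^sup>2)"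
    using u by (simp add: L2_fun_def set_integrable_def)
  also have "(\<lambda>s. indicator {0..T} s *\<^sub>R (norm (u s))\<^sup>2) = (\<lambda>s. (norm (?v s))\<^sup>2)"
    by (auto simp: fun_eq_iff split: split_indicator)
  finally have "integrable lebesgue (\<lambda>s. (norm (w s))\<^sup>2)"
  proof (rule integrable_cong_AE_imp)
    show "AE s in lebesgue. (norm (?v s))\<^sup>2 = (norm (w s))\<^sup>2"
      using AE_completion[OF aew] by eventually_elim simp
  qed (rule measurable_completion, measurable)
  then have i: "integrable lborel (\<lambda>s. (norm (w s))\<^sup>2)"
    by (subst (asm) integrable_completion) measurable
  show ?thesis
  proof
    show "l2_control a T w"
      by standard (use T a i in \<open>auto simp: w_def\<close>)
    show "AE s in lborel. s \<in> {0..T} \<longrightarrow> u s = w s"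
      using aew by eventually_elim auto
  qed
qed

lemma control_L2_fun:
  assumes "l2_control a T w"
  shows "w \<in> L2_fun T"
proof -
  interpret l2_control a T w by fact
  have "set_borel_measurable lebesgue {0..T} w"
    unfolding set_borel_measurable_def by (rule measurable_completion) measurable
  moreover have "integrable lebesgue (\<lambda>s. (norm (w s))\<^sup>2)"
    using w_sq by (subst integrable_completion) measurable
  then have "set_integrable lebesgue {0..T} (\<lambda>s. (norm (w s))\<^sup>2)"
    unfolding set_integrable_def by (intro integrable_mult_indicator[unfolded real_scaleR_def] | simp)+
  ultimately show ?thesis by (simp add: L2_fun_def)
qed

lemma c_const_pos:
  assumes "0 < H" "H < 1"
  shows "0 < c_const H"
  unfolding c_const_def using assms by (intro real_sqrt_gt_zero divide_pos_pos mult_pos_pos Gamma_real_pos) auto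

context
  fixes H T :: real
  assumes H: "0 < H" "H < 1" and T: "0 < T"
begin

lemma K_op_control:
  assumes "l2_control (H - 1/2) T w" "u \<in> L2_fun T" "AE s in lborel. s \<in> {0..T} \<longrightarrow> u s = w s" "t \<in> {0..T}"
  shows "K_op H u t = c_const H *\<^sub>R l2_control.G (H - 1/2) w t"
    and "set_integrable lebesgue {0..t} (\<lambda>s. K_kernel H t s *\<^sub>R u s)"
  using l2_control.K_op_eq[OF assms(1) refl assms(4) L2_fun_measurable[OF assms(2)] assms(3)]
  by (simp_all add: K_op_def)

lemma L2_fun_controlE:
  assumes "u \<in> L2_fun T"
  obtains w where "l2_control (H - 1/2) T w" "AE s in lborel. s \<in> {0..T} \<longrightarrow> u s = w s"
    "\<And>t. t \<in> {0..T} \<Longrightarrow> K_op H u t = c_const H *\<^sub>R l2_control.G (H - 1/2) w t"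
    "\<And>t. t \<in> {0..T} \<Longrightarrow> set_integrable lebesgue {0..t} (\<lambda>s. K_kernel H t s *\<^sub>R u s)"
proof -
  have "\<bar>H - 1/2\<bar> < 1/2" unfolding abs_less_iff using H by auto
  from L2_fun_control[OF assms T this] obtain w
    where w: "l2_control (H - 1/2) T w" "AE s in lborel. s \<in> {0..T} \<longrightarrow> u s = w s" by metis
  show ?thesis
    by (rule that[OF w]) (use K_op_control[OF w(1) assms w(2)] in auto)
qed

lemma K_op_continuous: "u \<in> L2_fun T \<Longrightarrow> continuous_on {0..T} (K_op H u)"
proof -
  assume "u \<in> L2_fun T"
  then obtain w where w: "l2_control (H - 1/2) T w" "AE s in lborel. s \<in> {0..T} \<longrightarrow> u s = w s"
    "\<And>t. t \<in> {0..T} \<Longrightarrow> K_op H u t = c_const H *\<^sub>R l2_control.G (H - 1/2) w t"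
    "\<And>t. t \<in> {0..T} \<Longrightarrow> set_integrable lebesgue {0..t} (\<lambda>s. K_kernel H t s *\<^sub>R u s)"
    by (rule L2_fun_controlE) (rule that)
  have "continuous_on {0..T} (\<lambda>t. c_const H *\<^sub>R l2_control.G (H - 1/2) w t)"
    by (intro continuous_intros l2_control.G_continuous w)
  then show ?thesis using w(3) by (subst continuous_on_cong[OF refl]) auto
qed

lemma K_op_zero: "K_op H u 0 = 0" for u :: "real \<Rightarrow> real ^ 'n"
proof -
  have "K_op H u 0 = (LINT s|(lebesgue :: real measure). 0 :: real ^ 'n)"
    unfolding K_op_def set_lebesgue_integral_def
    by (rule integral_discrete_difference[where X = "{0}"]) (auto split: split_indicator)
  then show ?thesis by simp
qed

lemma K_op_diff:
  assumes "u \<in> L2_fun T" "v \<in> L2_fun T" "t \<in> {0..T}"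
  shows "K_op H (\<lambda>s. u s - v s) t = K_op H u t - K_op H v t"
proof -
  have "set_integrable lebesgue {0..t} (\<lambda>s. K_kernel H t s *\<^sub>R u s)"
    "set_integrable lebesgue {0..t} (\<lambda>s. K_kernel H t s *\<^sub>R v s)"
    by (rule L2_fun_controlE[OF assms(1)], use assms(3) in blast) (rule L2_fun_controlE[OF assms(2)], use assms(3) in blast)
  then show ?thesis
    unfolding K_op_def by (simp add: scaleR_diff_right set_integral_diff)
qed

lemma K_op_inj:
  fixes u :: "real \<Rightarrow> real ^ 'n"
  assumes "u \<in> L2_fun T" "\<And>t. t \<in> {0..T} \<Longrightarrow> K_op H u t = 0"
  shows "AE s in lebesgue. s \<in> {0..T} \<longrightarrow> u s = 0"
proof -
  obtain w where w: "l2_control (H - 1/2) T w" "AE s in lborel. s \<in> {0..T} \<longrightarrow> u s = w s"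
    "\<And>t. t \<in> {0..T} \<Longrightarrow> K_op H u t = c_const H *\<^sub>R l2_control.G (H - 1/2) w t"
    "\<And>t. t \<in> {0..T} \<Longrightarrow> set_integrable lebesgue {0..t} (\<lambda>s. K_kernel H t s *\<^sub>R u s)"
    by (rule L2_fun_controlE[OF assms(1)]) (rule that)
  have "l2_control.G (H - 1/2) w t = 0" if "t \<in> {0..T}" for t
    using w(3)[OF that] assms(2)[OF that] c_const_pos[OF H] by simp
  then have "l2_control.Y (H - 1/2) w t = 0" if "t \<in> {0..T}" for t
    by (rule l2_control.G_zero_imp_Y_zero[OF w(1) _ that])
  then have "AE s in lborel. w s = 0"
    by (rule Y_zero_imp_control_zero[OF w(1)])
  with w(2) have "AE s in lborel. s \<in> {0..T} \<longrightarrow> u s = 0"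
    by eventually_elim auto
  then show ?thesis by (rule AE_completion)
qed

lemma K_op_surj:
  fixes f :: "real \<Rightarrow> real ^ 'n"
  assumes "represented (H - 1/2) T f" and f: "f \<in> borel_measurable borel" "\<And>s. norm (f s) \<le> F" "\<And>s. s \<le> 0 \<Longrightarrow> f s = 0"
  obtains u where "u \<in> L2_fun T" "\<And>t. t \<in> {0..T} \<Longrightarrow> K_op H u t = abel 1 f t"
proof -
  obtain w where w: "l2_control (H - 1/2) T w" and
    eq: "\<And>t. t \<in> {0..T} \<Longrightarrow> abel (1 + (H - 1/2)) (\<lambda>s. pker (1 - (H - 1/2)) s *\<^sub>R w s) t = abel 1 (\<lambda>s. pker (1 - (H - 1/2)) s *\<^sub>R f s) t"
    using assms(1) unfolding represented_def by blast
  interpret l2_control "H - 1/2" T w by fact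
  have G: "G t = abel 1 f t" if "t \<in> {0..T}" for t
  proof (rule G_eq_primitive[OF f(1,2) _ _ that])
    show "Y t = abel 1 (\<lambda>s. pker (1 - (H - 1/2)) s *\<^sub>R f s) t" if "t \<in> {0..T}" for t
      unfolding Y_def W_def by (rule eq[OF that])
  qed (rule f(3))
  \<comment> \<open>The division compensates the factor in front of \<open>G\<close> in
    \<open>K_op_control\<close>.\<close>
  define u where "u = (\<lambda>s. (1 / c_const H) *\<^sub>R w s)"
  have "l2_control (H - 1/2) T u"
  proof
    have "(\<lambda>s. (norm (u s))\<^sup>2) = (\<lambda>s. (1 / c_const H)\<^sup>2 * (norm (w s))\<^sup>2)"
      by (simp add: u_def power_divide fun_eq_iff)
    then show "integrable lborel (\<lambda>s. (norm (u s))\<^sup>2)" using w_sq by simp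
  qed (use a T w_supp in \<open>auto simp: u_def\<close>)
  then have u: "u \<in> L2_fun T" by (rule control_L2_fun)
  have "K_op H u t = abel 1 f t" if "t \<in> {0..T}" for t
  proof -
    have "K_op H u t = (1 / c_const H) *\<^sub>R K_op H w t"
      unfolding K_op_def u_def by (subst set_integral_scaleR_right [symmetric]) (simp add: mult.commute)
    also have "K_op H w t = c_const H *\<^sub>R G t"
      by (rule K_op_control(1)[OF w control_L2_fun[OF w] _ that]) simp
    finally show ?thesis using c_const_pos[OF H] G[OF that] by simp
  qed
  with u show ?thesis by (rule that)
qed

lemma K_op_density:
  fixes u :: "real \<Rightarrow> real ^ 'n"
  assumes u: "u \<in> L2_fun T" and "1/2 < H"
  obtains p V where "p \<in> borel_measurable borel" "\<And>s. s \<le> 0 \<Longrightarrow> p s = 0"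
    "\<And>t. t \<in> {0..T} \<Longrightarrow> K_op H u t = abel 1 p t"
    "\<And>t. t \<in> {0..T} \<Longrightarrow> integrable lborel (\<lambda>s. pker 1 (t - s) *\<^sub>R p s)"
    "integrable lborel V" "\<And>s. 0 \<le> (V s :: real)" "\<And>s. s \<le> 0 \<Longrightarrow> V s = 0"
    "\<And>s. norm (p s) \<le> pker (1 + (H - 1/2)) s * abel (H - 1/2) V s"
proof -
  obtain w where w: "l2_control (H - 1/2) T w" "AE s in lborel. s \<in> {0..T} \<longrightarrow> u s = w s"
    "\<And>t. t \<in> {0..T} \<Longrightarrow> K_op H u t = c_const H *\<^sub>R l2_control.G (H - 1/2) w t"
    "\<And>t. t \<in> {0..T} \<Longrightarrow> set_integrable lebesgue {0..t} (\<lambda>s. K_kernel H t s *\<^sub>R u s)"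
    by (rule L2_fun_controlE[OF u]) (rule that)
  have "0 < H - 1/2" using assms by simp
  from l2_control.G_density[OF w(1) this]
  obtain p V where p: "p \<in> borel_measurable borel" "\<And>s. s \<le> 0 \<Longrightarrow> p s = 0"
    "\<And>t. t \<in> {0..T} \<Longrightarrow> l2_control.G (H - 1/2) w t = abel 1 p t"
    "\<And>t. t \<in> {0..T} \<Longrightarrow> integrable lborel (\<lambda>s. pker 1 (t - s) *\<^sub>R p s)"
    "integrable lborel V" "\<And>s. 0 \<le> (V s :: real)" "\<And>s. s \<le> 0 \<Longrightarrow> V s = 0"
    "\<And>s. norm (p s) \<le> pker (1 + (H - 1/2)) s * abel (H - 1/2) V s"
    by blast
  note c = c_const_pos[OF H]
  show ?thesis
  proof (rule that[of "\<lambda>s. c_const H *\<^sub>R p s" "\<lambda>s. c_const H *\<^sub>R V s"])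
    show "integrable lborel (\<lambda>s. pker 1 (t - s) *\<^sub>R (c_const H *\<^sub>R p s))" if "t \<in> {0..T}" for t
      using integrable_scaleR_right[OF p(4)[OF that], of "c_const H"] by (simp add: mult.commute)
    show "norm (c_const H *\<^sub>R p s) \<le> pker (1 + (H - 1/2)) s * abel (H - 1/2) (\<lambda>s. c_const H *\<^sub>R V s) s" for s
      using mult_left_mono[OF p(8)[of s], of "c_const H"] c unfolding abel_scaleR by (simp add: mult_ac)
    show "integrable lborel (\<lambda>s. c_const H *\<^sub>R V s)" by (intro integrable_scaleR_right p)
    show "K_op H u t = abel 1 (\<lambda>s. c_const H *\<^sub>R p s) t" if "t \<in> {0..T}" for t
      using w(3)[OF that] p(3)[OF that] by (simp only: abel_scaleR)
    show "0 \<le> c_const H *\<^sub>R V s" for s using c p(6)[of s] by simp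
  qed (use p in auto)
qed

end

subsection \<open>Young integrals\<close>

text \<open>Cousin's lemma supplies a division that is fine for both meshes. This makes the
  description in \<open>young_integral\<close> well defined.\<close>

lemma has_young_integral_unique:
  assumes "has_young_integral A g a b I" "has_young_integral A g a b I'"
  shows "I = I'"
proof (rule ccontr)
  assume ne: "I \<noteq> I'"
  define e where "e = norm (I - I') / 2"
  have "0 < e" using ne by (simp add: e_def)
  obtain d where "0 < d" and d: "\<And>p. p tagged_division_of {a..b} \<Longrightarrow> (\<lambda>x. ball x d) fine p \<Longrightarrow>
        norm ((\<Sum>(x, k)\<in>p. A x *v (g (Sup k) - g (Inf k))) - I) < e"
    using assms(1)[unfolded has_young_integral_def, rule_format, OF \<open>0 < e\<close>] by blast
  obtain d' where "0 < d'" and d': "\<And>p. p tagged_division_of {a..b} \<Longrightarrow> (\<lambda>x. ball x d') fine p \<Longrightarrow>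
        norm ((\<Sum>(x, k)\<in>p. A x *v (g (Sup k) - g (Inf k))) - I') < e"
    using assms(2)[unfolded has_young_integral_def, rule_format, OF \<open>0 < e\<close>] by blast
  have "gauge (\<lambda>x. ball x (min d d'))" using \<open>0 < d\<close> \<open>0 < d'\<close> by (simp add: gauge_def)
  then obtain p where p: "p tagged_division_of {a..b}" "(\<lambda>x. ball x (min d d')) fine p"
    by (rule fine_division_exists_real)
  from p(2) have "(\<lambda>x. ball x d) fine p" "(\<lambda>x. ball x d') fine p"
    by (auto simp: fine_def subset_iff)
  from d[OF p(1) this(1)] d'[OF p(1) this(2)]
  have "norm (I - I') < e + e"
    using norm_triangle_ineq4[of "(\<Sum>(x, k)\<in>p. A x *v (g (Sup k) - g (Inf k))) - I'" "(\<Sum>(x, k)\<in>p. A x *v (g (Sup k) - g (Inf k))) - I"]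
    by simp
  then show False by (simp add: e_def)
qed

lemma young_integral_eqI: "has_young_integral A g a b I \<Longrightarrow> young_integral A g a b = I"
  unfolding young_integral_def by (rule the_equality) (auto dest: has_young_integral_unique)

text \<open>A sewing criterion: \<open>\<Phi>\<close> is the candidate for the indefinite integral
  and \<open>m\<close> measures the local error. Both telescope over a division, so the total error
  is at most \<eta> times the increment of \<open>m\<close>.\<close>

lemma has_young_integralI:
  fixes \<Phi> :: "real \<Rightarrow> real ^ 'n" and m :: "real \<Rightarrow> real"
  assumes t: "0 \<le> t"
    and loc: "\<And>\<eta>. 0 < \<eta> \<Longrightarrow> \<exists>\<delta>>0. \<forall>l x u. 0 \<le> l \<and> l \<le> x \<and> x \<le> u \<and> u \<le> t \<and> u - l < \<delta> \<longrightarrow>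
        norm (A x *v (g u - g l) - (\<Phi> u - \<Phi> l)) \<le> \<eta> * (m u - m l)"
  shows "has_young_integral A g 0 t (\<Phi> t - \<Phi> 0)"
  unfolding has_young_integral_def
proof (intro allI impI)
  fix e :: real assume e: "0 < e"
  define \<eta> where "\<eta> = e / (\<bar>m t - m 0\<bar> + 1)"
  have eta: "0 < \<eta>" using e by (simp add: \<eta>_def)
  from loc[OF this] obtain \<delta> where \<delta>: "0 < \<delta>" and
    L: "\<And>l x u. 0 \<le> l \<Longrightarrow> l \<le> x \<Longrightarrow> x \<le> u \<Longrightarrow> u \<le> t \<Longrightarrow> u - l < \<delta> \<Longrightarrow>
        norm (A x *v (g u - g l) - (\<Phi> u - \<Phi> l)) \<le> \<eta> * (m u - m l)"
    by blast
  show "\<exists>\<delta>>0. \<forall>p. p tagged_division_of {0..t} \<and> (\<lambda>x. ball x \<delta>) fine p \<longrightarrow>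
      norm ((\<Sum>(x, k)\<in>p. A x *v (g (Sup k) - g (Inf k))) - (\<Phi> t - \<Phi> 0)) < e"
  \<comment> \<open>An interval inside a ball of radius \<delta> / 2 is shorter than \<delta>,
    wherever its tag lies.\<close>
  proof (intro exI[of _ "\<delta> / 2"] conjI allI impI)
    fix p assume p: "p tagged_division_of {0..t} \<and> (\<lambda>x. ball x (\<delta> / 2)) fine p"
    then have td: "p tagged_division_of {0..t}" by simp
    have "(\<Sum>(x, k)\<in>p. A x *v (g (Sup k) - g (Inf k))) - (\<Phi> t - \<Phi> 0)
        = (\<Sum>(x, k)\<in>p. A x *v (g (Sup k) - g (Inf k)) - (\<Phi> (Sup k) - \<Phi> (Inf k)))"
      by (subst additive_tagged_division_1[OF t td, symmetric]) (simp add: sum_subtractf case_prod_beta)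
    also have "norm \<dots> \<le> (\<Sum>(x, k)\<in>p. \<eta> * (m (Sup k) - m (Inf k)))"
    proof (rule sum_norm_le, clarify)
      fix x k assume xk: "(x, k) \<in> p"
      obtain l u where k: "k = cbox l u" using tagged_division_ofD(4)[OF td xk] by blast
      have x: "x \<in> k" "k \<subseteq> {0..t}" using tagged_division_ofD(2,3)[OF td xk] by auto
      then have lu: "l \<le> x" "x \<le> u" "l \<in> k" "u \<in> k" by (auto simp: k)
      have "k \<subseteq> ball x (\<delta> / 2)" using p xk by (auto simp: fine_def)
      then have "l \<in> ball x (\<delta> / 2)" "u \<in> ball x (\<delta> / 2)" using lu(3,4) by blast+
      then have "u - l < \<delta>" unfolding mem_ball dist_real_def by linarith
      moreover have "0 \<le> l" "u \<le> t" using x(2) lu(3,4) by auto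
      ultimately show "norm (A x *v (g (Sup k) - g (Inf k)) - (\<Phi> (Sup k) - \<Phi> (Inf k))) \<le> \<eta> * (m (Sup k) - m (Inf k))"
        using L[of l x u] lu by (simp add: k)
    qed
    also have "\<dots> = \<eta> * (m t - m 0)"
      by (subst additive_tagged_division_1[OF t td, symmetric]) (simp add: sum_distrib_left case_prod_beta)
    also have "\<dots> \<le> \<eta> * \<bar>m t - m 0\<bar>" using eta by (intro mult_left_mono) auto
    also have "\<dots> < \<eta> * (\<bar>m t - m 0\<bar> + 1)" using eta by simp
    also have "\<dots> = e" by (simp add: \<eta>_def add_nonneg_eq_0_iff)
    finally show "norm ((\<Sum>(x, k)\<in>p. A x *v (g (Sup k) - g (Inf k))) - (\<Phi> t - \<Phi> 0)) < e" .
  qed (use \<delta> in simp)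
qed

lemma blinfun_bounded_on_interval:
  fixes S :: "real \<Rightarrow> 'a::real_normed_vector \<Rightarrow>\<^sub>L 'b::real_normed_vector"
  assumes "continuous_on {0..T} S"
  obtains M where "0 < M" "\<And>t v. t \<in> {0..T} \<Longrightarrow> norm (S t v) \<le> M * norm v"
proof -
  have "bounded (S ` {0..T})"
    using assms by (intro compact_imp_bounded compact_continuous_image) auto
  then obtain M where M: "0 < M" "\<And>x. x \<in> S ` {0..T} \<Longrightarrow> norm x \<le> M"
    by (auto simp: bounded_pos)
  show ?thesis
  proof (rule that[OF M(1)])
    fix t and v :: 'a assume "t \<in> {0..T}"
    then have "norm (S t) * norm v \<le> M * norm v" using M(2) by (intro mult_right_mono) auto
    with norm_blinfun[of "S t" v] show "norm (S t v) \<le> M * norm v" by linarith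
  qed
qed

text \<open>Integration by parts for a continuous integrator. The local error is the integral of
  S'(r) applied to g(r) - g(u) to the right of the tag and to g(r) - g(l) to its left, so uniform
  continuity of \<open>g\<close> makes it at most \<eta> times the length.\<close>

lemma has_young_integral_C1:
  fixes S S' :: "real \<Rightarrow> (real ^ 'n) \<Rightarrow>\<^sub>L (real ^ 'n)"
  assumes S: "\<And>t. t \<in> {0..T} \<Longrightarrow> (S has_vector_derivative S' t) (at t within {0..T})" "continuous_on {0..T} S'"
    and A: "\<And>t v. t \<in> {0..T} \<Longrightarrow> A t *v v = S t v"
    and g: "continuous_on {0..T} g" "g 0 = 0" and t: "t \<in> {0..T}"
  shows "has_young_integral A g 0 t (S t (g t) - integral {0..t} (\<lambda>r. S' r (g r)))"
proof -
  define \<Phi> where "\<Phi> u = S u (g u) - integral {0..u} (\<lambda>r. S' r (g r))" for u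
  obtain M where M: "0 < M" "\<And>t v. t \<in> {0..T} \<Longrightarrow> norm (S' t v) \<le> M * norm v"
    using blinfun_bounded_on_interval[OF S(2)] by blast
  have cS': "continuous_on {0..T} (\<lambda>r. S' r (h r))" if "continuous_on {0..T} h" for h
    using S(2) that by (intro continuous_intros)
  have int: "(\<lambda>r. S' r (h r)) integrable_on {l..u}" if "continuous_on {0..T} h" "0 \<le> l" "u \<le> T" for h l u
    by (rule integrable_continuous_real, rule continuous_on_subset[OF cS'[OF that(1)]]) (use that in auto)
  have ftc: "S u v - S l v = integral {l..u} (\<lambda>r. S' r v)" if "0 \<le> l" "l \<le> u" "u \<le> T" for l u v
  proof -
    have "((\<lambda>r. S' r v) has_integral (S u v - S l v)) {l..u}"
    proof (rule fundamental_theorem_of_calculus)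
      fix r assume r: "r \<in> {l..u}"
      then have "(S has_vector_derivative S' r) (at r within {l..u})"
        using that by (intro has_vector_derivative_within_subset[OF S(1)]) auto
      then show "((\<lambda>r. S r v) has_vector_derivative S' r v) (at r within {l..u})"
        by (rule bounded_linear.has_vector_derivative[OF blinfun.bounded_linear_left])
    qed fact
    then show ?thesis by (rule integral_unique [symmetric])
  qed
  have "has_young_integral A g 0 t (\<Phi> t - \<Phi> 0)"
  proof (rule has_young_integralI)
    fix \<eta> :: real assume "0 < \<eta>"
    then have e: "0 < \<eta> / M" using M by simp
    have "uniformly_continuous_on {0..T} g"
      using g(1) by (intro compact_uniformly_continuous) auto
    then obtain d where d: "0 < d" "\<And>x y. x \<in> {0..T} \<Longrightarrow> y \<in> {0..T} \<Longrightarrow> dist y x < d \<Longrightarrow> dist (g y) (g x) < \<eta> / M"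
      unfolding uniformly_continuous_on_def using e by metis
    show "\<exists>\<delta>>0. \<forall>l x u. 0 \<le> l \<and> l \<le> x \<and> x \<le> u \<and> u \<le> t \<and> u - l < \<delta> \<longrightarrow>
        norm (A x *v (g u - g l) - (\<Phi> u - \<Phi> l)) \<le> \<eta> * (u - l)"
    proof (intro exI[of _ d] conjI allI impI d(1))
      fix l x u assume "0 \<le> l \<and> l \<le> x \<and> x \<le> u \<and> u \<le> t \<and> u - l < d"
      then have o: "0 \<le> l" "l \<le> x" "x \<le> u" "u \<le> T" "u - l < d" using t by auto
      have combine: "integral {0..u} (\<lambda>r. S' r (g r)) = integral {0..l} (\<lambda>r. S' r (g r)) + integral {l..x} (\<lambda>r. S' r (g r)) + integral {x..u} (\<lambda>r. S' r (g r))"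
        using o Henstock_Kurzweil_Integration.integral_combine[of 0 l u "\<lambda>r. S' r (g r)", symmetric]
          Henstock_Kurzweil_Integration.integral_combine[of l x u "\<lambda>r. S' r (g r)", symmetric] int[OF g(1)]
        by (simp add: add.assoc)
      have "A x *v (g u - g l) - (\<Phi> u - \<Phi> l)
          = (integral {x..u} (\<lambda>r. S' r (g r)) - (S u (g u) - S x (g u))) + (integral {l..x} (\<lambda>r. S' r (g r)) - (S x (g l) - S l (g l)))"
        using o by (simp add: A \<Phi>_def combine blinfun.diff_right)
      also have "\<dots> = integral {x..u} (\<lambda>r. S' r (g r - g u)) + integral {l..x} (\<lambda>r. S' r (g r - g l))"
        using o by (simp add: ftc integral_diff[OF int[OF g(1)] int[OF continuous_on_const], symmetric] blinfun.diff_right)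
      finally have eq: "A x *v (g u - g l) - (\<Phi> u - \<Phi> l) = integral {x..u} (\<lambda>r. S' r (g r - g u)) + integral {l..x} (\<lambda>r. S' r (g r - g l))" .
      have b: "norm (integral {p..q} (\<lambda>r. S' r (g r - g z))) \<le> \<eta> * (q - p)" if "l \<le> p" "p \<le> q" "q \<le> u" "z \<in> {l..u}" for p q z
      proof (rule integral_bound[OF that(2)])
        show "continuous_on {p..q} (\<lambda>r. S' r (g r - g z))"
          by (rule continuous_on_subset[OF cS']) (use that o g in \<open>auto intro!: continuous_intros\<close>)
        fix r assume r: "r \<in> {p..q}"
        have "norm (S' r (g r - g z)) \<le> M * norm (g r - g z)" using r that o by (intro M) auto
        also have "\<dots> \<le> M * (\<eta> / M)"
        proof (rule mult_left_mono)
          have "dist r z < d" unfolding dist_real_def using r that o by (auto simp: abs_less_iff)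
          then show "norm (g r - g z) \<le> \<eta> / M" using d(2)[of z r] r that o by (auto simp: dist_norm)
        qed (use M(1) in simp)
        finally show "norm (S' r (g r - g z)) \<le> \<eta>" using M(1) by simp
      qed
      show "norm (A x *v (g u - g l) - (\<Phi> u - \<Phi> l)) \<le> \<eta> * (u - l)"
      proof -
        have "norm (A x *v (g u - g l) - (\<Phi> u - \<Phi> l)) \<le> \<eta> * (u - x) + \<eta> * (x - l)"
          unfolding eq using o by (intro order_trans[OF norm_triangle_ineq] add_mono b) auto
        also have "\<dots> = \<eta> * (u - l)" by (simp add: algebra_simps)
        finally show ?thesis .
      qed
    qed
  qed (use t in simp)
  moreover have "\<Phi> 0 = 0" by (simp add: \<Phi>_def g blinfun.zero_right)
  ultimately show ?thesis by (simp add: \<Phi>_def)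
qed

lemma blinfun_apply_borel:
  fixes A :: "real \<Rightarrow> 'a::euclidean_space \<Rightarrow>\<^sub>L 'b::euclidean_space"
  assumes "continuous_on {0..T} A" and [measurable]: "q \<in> borel_measurable borel" and q0: "\<And>s. s \<notin> {0..T} \<Longrightarrow> q s = 0"
  shows "(\<lambda>s. A s (q s)) \<in> borel_measurable borel"
proof -
  have "(\<lambda>s. A s (q s)) = (\<lambda>s. \<Sum>b\<in>Basis. (q s \<bullet> b) *\<^sub>R (indicator {0..T} s *\<^sub>R A s b))"
  proof
    fix s
    show "A s (q s) = (\<Sum>b\<in>Basis. (q s \<bullet> b) *\<^sub>R (indicator {0..T} s *\<^sub>R A s b))"
    proof (cases "s \<in> {0..T}")
      case True
      have "A s (q s) = A s (\<Sum>b\<in>Basis. (q s \<bullet> b) *\<^sub>R b)" by (simp add: euclidean_representation)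
      with True show ?thesis by (simp add: blinfun.sum_right blinfun.scaleR_right)
    qed (simp add: q0 blinfun.zero_right)
  qed
  moreover have m: "(\<lambda>s. indicator {0..T} s *\<^sub>R A s b) \<in> borel_measurable borel" for b
    using assms(1) by (intro borel_measurable_continuous_on_indicator continuous_intros) auto
  moreover have "(\<lambda>s. (q s \<bullet> b) *\<^sub>R (indicator {0..T} s *\<^sub>R A s b)) \<in> borel_measurable borel" for b
    by (rule borel_measurable_scaleR[OF _ m]) measurable
  ultimately show ?thesis by (simp only: borel_measurable_sum)
qed

text \<open>Here the local error is measured by the primitive of the norm of \<open>p\<close>, and
  the smallness comes from uniform continuity of \<open>S\<close> instead of
  \<open>g\<close>.\<close>

lemma has_young_integral_density:
  fixes S :: "real \<Rightarrow> (real ^ 'n) \<Rightarrow>\<^sub>L (real ^ 'n)"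
  assumes S: "continuous_on {0..T} S" and A: "\<And>t v. t \<in> {0..T} \<Longrightarrow> A t *v v = S t v"
    and p: "integrable lborel p" "\<And>s. s \<notin> {0..T} \<Longrightarrow> p s = 0"
    and g: "\<And>t. t \<in> {0..T} \<Longrightarrow> g t = abel 1 p t" and t: "t \<in> {0..T}"
  shows "has_young_integral A g 0 t (abel 1 (\<lambda>s. S s (p s)) t)" "integrable lborel (\<lambda>s. S s (p s))"
proof -
  have pm [measurable]: "p \<in> borel_measurable borel" using p(1) by (simp add: integrable_iff_bounded)
  have Sp [measurable]: "(\<lambda>s. S s (p s)) \<in> borel_measurable borel"
    using p(2) by (intro blinfun_apply_borel[OF S]) auto
  obtain M where M: "0 < M" "\<And>t v. t \<in> {0..T} \<Longrightarrow> norm (S t v) \<le> M * norm v"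
    using blinfun_bounded_on_interval[OF S] by blast
  show iSp: "integrable lborel (\<lambda>s. S s (p s))"
  proof (rule Bochner_Integration.integrable_bound)
    show "integrable lborel (\<lambda>s. M * norm (p s))" using p by (intro integrable_mult_right integrable_norm)
    have "norm (S s (p s)) \<le> norm (M * norm (p s))" for s
      using M(2)[of s "p s"] M(1) p(2)[of s] by (cases "s \<in> {0..T}") (auto simp: blinfun.zero_right)
    then show "AE s in lborel. norm (S s (p s)) \<le> norm (M * norm (p s))" by simp
  qed measurable
  have ab1: "integrable lborel (\<lambda>s. pker 1 (r - s) *\<^sub>R h s)" if "integrable lborel h" for h :: "real \<Rightarrow> 'c::{banach,second_countable_topology}" and r
    by (rule Bochner_Integration.integrable_bound[OF that]) (use that in \<open>auto simp: pker_def integrable_iff_bounded\<close>)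
  \<comment> \<open>For l <= u this is the indicator of l <= s < u.\<close>
  define D where "D l u s = pker 1 (u - s) - pker 1 (l - s)" for l u s :: real
  have D: "0 \<le> D l u s" "D l u s \<noteq> 0 \<Longrightarrow> l \<le> s \<and> s < u" if "l \<le> u" for l u s
    using that by (auto simp: D_def pker_def split: if_splits)
  have diff: "abel 1 h u - abel 1 h l = (LINT s|lborel. D l u s *\<^sub>R h s)" "integrable lborel (\<lambda>s. D l u s *\<^sub>R h s)"
    if "integrable lborel h" for h :: "real \<Rightarrow> 'c::{banach,second_countable_topology}" and l u
    using ab1[OF that, of u] ab1[OF that, of l] by (simp_all add: abel_def D_def scaleR_diff_left)
  have np: "integrable lborel (\<lambda>s. norm (p s))" using p by (intro integrable_norm)
  have "has_young_integral A g 0 t (abel 1 (\<lambda>s. S s (p s)) t - abel 1 (\<lambda>s. S s (p s)) 0)"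
  proof (rule has_young_integralI)
    fix \<eta> :: real assume eta: "0 < \<eta>"
    have "uniformly_continuous_on {0..T} S"
      using S by (intro compact_uniformly_continuous) auto
    then obtain d where d: "0 < d" "\<And>x y. x \<in> {0..T} \<Longrightarrow> y \<in> {0..T} \<Longrightarrow> dist y x < d \<Longrightarrow> dist (S y) (S x) < \<eta>"
      unfolding uniformly_continuous_on_def using eta by metis
    show "\<exists>\<delta>>0. \<forall>l x u. 0 \<le> l \<and> l \<le> x \<and> x \<le> u \<and> u \<le> t \<and> u - l < \<delta> \<longrightarrow>
        norm (A x *v (g u - g l) - (abel 1 (\<lambda>s. S s (p s)) u - abel 1 (\<lambda>s. S s (p s)) l))
        \<le> \<eta> * (abel 1 (\<lambda>s. norm (p s)) u - abel 1 (\<lambda>s. norm (p s)) l)"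
    proof (intro exI[of _ d] conjI allI impI d(1))
      fix l x u assume "0 \<le> l \<and> l \<le> x \<and> x \<le> u \<and> u \<le> t \<and> u - l < d"
      then have o: "0 \<le> l" "l \<le> x" "x \<le> u" "u \<le> T" "u - l < d" using t by auto
      have iSx: "integrable lborel (\<lambda>s. D l u s *\<^sub>R S x (p s))"
        using integrable_bounded_linear[OF blinfun.bounded_linear_right[of "S x"] diff(2)[OF p(1), of l u]]
        by (simp add: blinfun.scaleR_right)
      have "A x *v (g u - g l) = S x (LINT s|lborel. D l u s *\<^sub>R p s)"
        using o by (simp add: A g diff(1)[OF p(1)])
      also have "\<dots> = (LINT s|lborel. D l u s *\<^sub>R S x (p s))"
        by (subst integral_bounded_linear[OF blinfun.bounded_linear_right diff(2)[OF p(1)], symmetric])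
          (simp add: blinfun.scaleR_right)
      finally have "A x *v (g u - g l) - (abel 1 (\<lambda>s. S s (p s)) u - abel 1 (\<lambda>s. S s (p s)) l)
          = (LINT s|lborel. D l u s *\<^sub>R S x (p s) - D l u s *\<^sub>R S s (p s))"
        unfolding diff(1)[OF iSp] by (subst Bochner_Integration.integral_diff[OF iSx diff(2)[OF iSp]]) simp
      also have "norm \<dots> \<le> (LINT s|lborel. \<eta> * (D l u s *\<^sub>R norm (p s)))"
      proof (rule order_trans[OF integral_norm_bound integral_mono])
        show "integrable lborel (\<lambda>s. norm (D l u s *\<^sub>R S x (p s) - D l u s *\<^sub>R S s (p s)))"
          by (intro integrable_norm Bochner_Integration.integrable_diff iSx diff(2)[OF iSp])
        show "integrable lborel (\<lambda>s. \<eta> * (D l u s *\<^sub>R norm (p s)))"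
          by (intro integrable_mult_right diff(2)[OF np])
        fix s
        show "norm (D l u s *\<^sub>R S x (p s) - D l u s *\<^sub>R S s (p s)) \<le> \<eta> * (D l u s *\<^sub>R norm (p s))"
        proof (cases "D l u s = 0")
          case False
          then have s: "l \<le> s" "s < u" using D(2)[of l u s] o by auto
          have "dist x s < d" unfolding dist_real_def using s o by linarith
          then have "norm (S x - S s) \<le> \<eta>" using d(2)[of s x] s o by (auto simp: dist_norm)
          then have "norm (S x - S s) * norm (p s) \<le> \<eta> * norm (p s)" by (rule mult_right_mono) simp
          with norm_blinfun[of "S x - S s" "p s"] have "norm (S x (p s) - S s (p s)) \<le> \<eta> * norm (p s)"
            by (simp add: blinfun.diff_left)
          from mult_left_mono[OF this D(1)[of l u s]] o show ?thesis
            by (simp add: scaleR_diff_right [symmetric] D(1) mult_ac)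
        qed simp
      qed
      also have "\<dots> = \<eta> * (abel 1 (\<lambda>s. norm (p s)) u - abel 1 (\<lambda>s. norm (p s)) l)"
        unfolding diff(1)[OF np] by (rule integral_mult_right_zero)
      finally show "norm (A x *v (g u - g l) - (abel 1 (\<lambda>s. S s (p s)) u - abel 1 (\<lambda>s. S s (p s)) l))
        \<le> \<eta> * (abel 1 (\<lambda>s. norm (p s)) u - abel 1 (\<lambda>s. norm (p s)) l)" .
    qed
  qed (use t in simp)
  moreover have "abel 1 (\<lambda>s. S s (p s)) 0 = abel 1 (\<lambda>_. 0 :: real ^ 'n) 0"
    by (rule abel_cong) (auto simp: p(2) blinfun.zero_right)
  then have "abel 1 (\<lambda>s. S s (p s)) 0 = 0" by (simp add: abel_def)
  ultimately show "has_young_integral A g 0 t (abel 1 (\<lambda>s. S s (p s)) t)" by simp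
qed

text \<open>With F the primitive of \<open>h\<close>, the hypothesis reads F' <= C F, so exp(-C x)
  F(x) is nonincreasing and starts at 0.\<close>

lemma gronwall_zero:
  fixes h :: "real \<Rightarrow> real"
  assumes h: "continuous_on {0..T} h" and le: "\<And>t. t \<in> {0..T} \<Longrightarrow> h t \<le> C * integral {0..t} h"
    and nn: "\<And>t. t \<in> {0..T} \<Longrightarrow> 0 \<le> h t" and C: "0 \<le> C" and t: "t \<in> {0..T}"
  shows "h t = 0"
proof -
  define F where "F t = integral {0..t} h" for t
  have dF: "(F has_real_derivative h s) (at s within {0..T})" if "s \<in> {0..T}" for s
    using integral_has_real_derivative[OF h that] by (simp add: F_def [abs_def])
  have "exp (- C * 0) * F 0 \<ge> exp (- C * t) * F t"
  proof (rule DERIV_nonpos_imp_decreasing_open[where f = "\<lambda>x. exp (- C * x) * F x"])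
    fix x assume x: "0 < x" "x < t"
    then have "(F has_real_derivative h x) (at x)"
      using dF[of x] t by (simp add: at_within_Icc_at)
    then have "((\<lambda>x. exp (- C * x) * F x) has_real_derivative exp (- C * x) * (h x - C * F x)) (at x)"
      by (auto intro!: derivative_eq_intros simp: algebra_simps)
    moreover have "exp (- C * x) * (h x - C * F x) \<le> 0"
      using le[of x] x t by (auto simp: mult_le_0_iff F_def)
    ultimately show "\<exists>y. ((\<lambda>x. exp (- C * x) * F x) has_real_derivative y) (at x) \<and> y \<le> 0" by blast
  next
    have "continuous_on {0..T} F" using dF by (intro DERIV_continuous_on) auto
    then show "continuous_on {0..t} (\<lambda>x. exp (- C * x) * F x)"
      using t by (intro continuous_intros) (auto elim: continuous_on_subset)
  qed (use t in simp)
  then have "F t \<le> 0" by (simp add: F_def mult_le_0_iff)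
  then have "C * F t \<le> 0" using C by (simp add: mult_nonneg_nonpos)
  with le[OF t] nn[OF t] show ?thesis by (simp add: F_def)
qed

subsection \<open>A chain rule along absolutely continuous curves\<close>

lemma pker_one_integrable:
  fixes h :: "real \<Rightarrow> 'a::{banach,second_countable_topology}"
  assumes "integrable lborel h"
  shows "integrable lborel (\<lambda>s. pker 1 (t - s) *\<^sub>R h s)"
  by (rule Bochner_Integration.integrable_bound[OF assms]) (use assms in \<open>auto simp: pker_def integrable_iff_bounded\<close>)

lemma continuous_on_section:
  assumes "continuous_on (A \<times> UNIV) (\<lambda>(t, x). f t x)" "continuous_on A \<psi>"
  shows "continuous_on A (\<lambda>t. f t (\<psi> t))"
proof -
  have "continuous_on A (\<lambda>t. (\<lambda>(t, x). f t x) (t, \<psi> t))"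
    by (rule continuous_on_compose2[OF assms(1)]) (auto intro!: continuous_intros assms(2))
  then show ?thesis by simp
qed

lemma section_tendsto:
  assumes f: "continuous_on (A \<times> UNIV) (\<lambda>(t, x). f t x)" and t: "t \<in> A" and x: "(xs \<longlongrightarrow> x) net"
  shows "((\<lambda>n. f t (xs n)) \<longlongrightarrow> f t x) net"
proof -
  have "((\<lambda>n. (\<lambda>(t, x). f t x) (t, xs n)) \<longlongrightarrow> (\<lambda>(t, x). f t x) (t, x)) net"
    by (rule continuous_on_tendsto_compose[OF f]) (auto intro!: tendsto_intros x simp: t)
  then show ?thesis by simp
qed

locale C1_field =
  fixes T M :: real and F :: "real \<Rightarrow> 'a::euclidean_space \<Rightarrow> 'b::euclidean_space"
    and Ft :: "real \<Rightarrow> 'a \<Rightarrow> 'b" and Fx :: "real \<Rightarrow> 'a \<Rightarrow> 'a \<Rightarrow>\<^sub>L 'b"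
  assumes T: "0 < T"
    and F_cont: "continuous_on ({0..T} \<times> UNIV) (\<lambda>(t, x). F t x)"
    and Ft_cont: "continuous_on ({0..T} \<times> UNIV) (\<lambda>(t, x). Ft t x)"
    and Fx_cont: "continuous_on ({0..T} \<times> UNIV) (\<lambda>(t, x). Fx t x)"
    and Ft_bound: "\<And>t x. t \<in> {0..T} \<Longrightarrow> norm (Ft t x) \<le> M"
    and Fx_bound: "\<And>t x. t \<in> {0..T} \<Longrightarrow> norm (Fx t x) \<le> M"
    and Ft_deriv: "\<And>t x. t \<in> {0..T} \<Longrightarrow> ((\<lambda>s. F s x) has_vector_derivative Ft t x) (at t within {0..T})"
    and Fx_deriv: "\<And>t x. t \<in> {0..T} \<Longrightarrow> (F t has_derivative Fx t x) (at x)"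
begin

definition curve :: "'a \<Rightarrow> (real \<Rightarrow> 'a) \<Rightarrow> real \<Rightarrow> 'a" where
  "curve x0 q t = x0 + abel 1 q t"

definition density :: "'a \<Rightarrow> (real \<Rightarrow> 'a) \<Rightarrow> real \<Rightarrow> 'b" where
  "density x0 q s = indicator {0<..T} s *\<^sub>R Ft s (curve x0 q s) + Fx s (curve x0 q s) (q s)"

definition velocity :: "(real \<Rightarrow> 'a) \<Rightarrow> bool" where
  "velocity q \<longleftrightarrow> integrable lborel q \<and> (\<forall>s. s \<notin> {0<..T} \<longrightarrow> q s = 0)"

definition chain_rule :: "'a \<Rightarrow> (real \<Rightarrow> 'a) \<Rightarrow> bool" where
  "chain_rule x0 q \<longleftrightarrow> (\<forall>t\<in>{0..T}. F t (curve x0 q t) = F 0 x0 + abel 1 (density x0 q) t)"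

lemma M_nonneg: "0 \<le> M"
  using order_trans[OF norm_ge_zero Ft_bound[of 0 0]] T by simp

lemma indicator_integrable: "integrable lborel (indicator {0<..T} :: real \<Rightarrow> real)"
  using T by (intro integrable_real_indicator) auto

lemma curve_continuous: "velocity q \<Longrightarrow> continuous_on {0..T} (curve x0 q)"
  unfolding curve_def [abs_def] velocity_def
  by (rule continuous_on_add[OF continuous_on_const continuous_on_subset[OF abel_continuous[of 1 q T]]]) auto

lemma density_bound: "velocity q \<Longrightarrow> norm (density x0 q s) \<le> M * (indicator {0<..T} s + norm (q s))"
proof (cases "s \<in> {0<..T}")
  case True
  then have s: "s \<in> {0..T}" by simp
  have "norm (Fx s (curve x0 q s) (q s)) \<le> M * norm (q s)"
    by (rule order_trans[OF norm_blinfun mult_right_mono[OF Fx_bound[OF s]]]) simp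
  then show ?thesis
    using True Ft_bound[OF s, of "curve x0 q s"] norm_triangle_ineq[of "Ft s (curve x0 q s)" "Fx s (curve x0 q s) (q s)"]
    by (simp add: density_def algebra_simps)
qed (auto simp: velocity_def density_def blinfun.zero_right)

lemma density_measurable: "velocity q \<Longrightarrow> density x0 q \<in> borel_measurable borel"
proof -
  assume q: "velocity q"
  have [measurable]: "q \<in> borel_measurable borel"
    using q by (simp add: velocity_def integrable_iff_bounded)
  have "(\<lambda>s. indicator {0<..T} s *\<^sub>R Ft s (curve x0 q s)) \<in> borel_measurable borel"
    by (rule borel_measurable_continuous_on_indicator[OF _ continuous_on_subset[OF continuous_on_section[OF Ft_cont curve_continuous[OF q]]]]) auto
  moreover have "(\<lambda>s. Fx s (curve x0 q s) (q s)) \<in> borel_measurable borel"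
    by (rule blinfun_apply_borel[OF continuous_on_section[OF Fx_cont curve_continuous[OF q]]]) (use q in \<open>auto simp: velocity_def\<close>)
  ultimately show ?thesis unfolding density_def [abs_def] by (rule borel_measurable_add)
qed

lemma density_integrable: "velocity q \<Longrightarrow> integrable lborel (density x0 q)"
proof (rule Bochner_Integration.integrable_bound)
  assume q: "velocity q"
  then show "integrable lborel (\<lambda>s. M * (indicator {0<..T} s + norm (q s)))"
    by (intro integrable_mult_right Bochner_Integration.integrable_add integrable_norm indicator_integrable) (auto simp: velocity_def)
  show "AE s in lborel. norm (density x0 q s) \<le> norm (M * (indicator {0<..T} s + norm (q s)))"
    by (intro always_eventually allI le_norm_real density_bound q)
  show "density x0 q \<in> borel_measurable lborel" using density_measurable[OF q] by simp
qed

text \<open>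
  The rule holds for continuous velocities by the fundamental theorem of calculus; dominated limits
  lead first to bounded and then to integrable velocities.
\<close>

lemma chain_rule_limit:
  assumes q: "velocity q" and qn: "\<And>n. velocity (qn n)" "\<And>n. chain_rule x0 (qn n)"
    and lim: "AE s in lborel. (\<lambda>n. qn n s) \<longlonglongrightarrow> q s"
    and dom: "integrable lborel h" "\<And>n s. norm (qn n s) \<le> h s"
  shows "chain_rule x0 q"
  unfolding chain_rule_def
proof
  have [measurable]: "q \<in> borel_measurable borel" "\<And>n. qn n \<in> borel_measurable borel"
    using q qn by (simp_all add: velocity_def integrable_iff_bounded)
  have [measurable]: "density x0 q \<in> borel_measurable borel" "\<And>n. density x0 (qn n) \<in> borel_measurable borel"
    using q qn by (simp_all add: density_measurable)
  have clim: "(\<lambda>n. curve x0 (qn n) t) \<longlonglongrightarrow> curve x0 q t" for t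
  proof -
    have "(\<lambda>n. abel 1 (qn n) t) \<longlonglongrightarrow> abel 1 q t"
      unfolding abel_def
    proof (rule integral_dominated_convergence[where w = h])
      show "AE s in lborel. (\<lambda>n. pker 1 (t - s) *\<^sub>R qn n s) \<longlonglongrightarrow> pker 1 (t - s) *\<^sub>R q s"
        using lim by eventually_elim (intro tendsto_intros)
      show "AE s in lborel. norm (pker 1 (t - s) *\<^sub>R qn n s) \<le> h s" for n
        using dom(2)[of n] order_trans[OF norm_ge_zero dom(2)] by (auto simp: pker_def)
    qed (use dom in auto)
    then show ?thesis unfolding curve_def by (intro tendsto_intros)
  qed
  fix t assume t: "t \<in> {0..T}"
  have "(\<lambda>n. abel 1 (density x0 (qn n)) t) \<longlonglongrightarrow> abel 1 (density x0 q) t"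
    unfolding abel_def
  proof (rule integral_dominated_convergence[where w = "\<lambda>s. M * (indicator {0<..T} s + h s)"])
    show "AE s in lborel. (\<lambda>n. pker 1 (t - s) *\<^sub>R density x0 (qn n) s) \<longlonglongrightarrow> pker 1 (t - s) *\<^sub>R density x0 q s"
      using lim
    proof eventually_elim
      case (elim s)
      show ?case
      proof (cases "s \<in> {0<..T}")
        case True
        then have s: "s \<in> {0..T}" by simp
        show ?thesis unfolding density_def
          by (intro tendsto_intros section_tendsto[OF Ft_cont s clim] blinfun.tendsto section_tendsto[OF Fx_cont s clim] elim)
      next
        case False
        then show ?thesis using q qn by (simp add: density_def velocity_def blinfun.zero_right)
      qed
    qed
    have "norm (pker 1 (t - s) *\<^sub>R density x0 (qn n) s) \<le> M * (indicator {0<..T} s + h s)" for n s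
    proof -
      have b: "norm (density x0 (qn n) s) \<le> M * (indicator {0<..T} s + h s)"
        using density_bound[OF qn(1), of x0 n s] mult_left_mono[OF dom(2)[of n s] M_nonneg]
        by (simp add: algebra_simps)
      then show ?thesis using order_trans[OF norm_ge_zero b] by (simp add: pker_def)
    qed
    then show "AE s in lborel. norm (pker 1 (t - s) *\<^sub>R density x0 (qn n) s) \<le> M * (indicator {0<..T} s + h s)" for n
      by simp
    show "integrable lborel (\<lambda>s. M * (indicator {0<..T} s + h s))"
      by (intro integrable_mult_right Bochner_Integration.integrable_add indicator_integrable dom)
  qed measurable
  then have "(\<lambda>n. F 0 x0 + abel 1 (density x0 (qn n)) t) \<longlonglongrightarrow> F 0 x0 + abel 1 (density x0 q) t"
    by (intro tendsto_intros)
  moreover have "(\<lambda>n. F t (curve x0 (qn n) t)) = (\<lambda>n. F 0 x0 + abel 1 (density x0 (qn n)) t)"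
    using qn(2) t by (simp add: chain_rule_def)
  moreover have "(\<lambda>n. F t (curve x0 (qn n) t)) \<longlonglongrightarrow> F t (curve x0 q t)"
    by (rule section_tendsto[OF F_cont t clim])
  ultimately show "F t (curve x0 q t) = F 0 x0 + abel 1 (density x0 q) t"
    using LIMSEQ_unique by metis
qed

lemma velocity_cut:
  assumes "continuous_on UNIV (c :: real \<Rightarrow> 'a)"
  shows "velocity (\<lambda>s. indicator {0<..T} s *\<^sub>R c s)"
proof -
  have [measurable]: "c \<in> borel_measurable borel" using assms by (rule borel_measurable_continuous_onI)
  have i: "integrable lborel (\<lambda>s. indicator {0..T} s *\<^sub>R c s)"
    using borel_integrable_atLeastAtMost'[of 0 T c] assms continuous_on_subset
    by (auto simp: set_integrable_def)
  have ae: "AE s in lborel. indicator {0..T} s *\<^sub>R c s = indicator {0<..T} s *\<^sub>R c s"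
    using AE_lborel_singleton[of 0] by eventually_elim (auto split: split_indicator)
  have "integrable lborel (\<lambda>s. indicator {0<..T} s *\<^sub>R c s)"
    by (rule integrable_cong_AE_imp[OF i _ ae]) measurable
  then show ?thesis by (simp add: velocity_def)
qed

lemma chain_rule_continuous:
  fixes c :: "real \<Rightarrow> 'a"
  assumes c: "continuous_on UNIV c"
  shows "chain_rule x0 (\<lambda>s. indicator {0<..T} s *\<^sub>R c s)"
  unfolding chain_rule_def
proof
  let ?q = "\<lambda>s. indicator {0<..T} s *\<^sub>R c s"
  note q = velocity_cut[OF c]
  have qm: "?q \<in> borel_measurable borel" using q by (simp add: velocity_def integrable_iff_bounded)
  define \<psi> where "\<psi> t = x0 + integral {0..t} c" for t
  have cu: "curve x0 ?q t = \<psi> t" if "t \<in> {0..T}" for t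
  proof -
    have "abel 1 ?q t = integral {0..t} ?q"
      by (rule abel_one_eq_integral(1)[OF pker_one_integrable _ qm]) (use q in \<open>auto simp: velocity_def\<close>)
    also have "\<dots> = integral {0..t} c"
      by (rule integral_spike[where S = "{0}"]) (use that in auto)
    finally show ?thesis by (simp add: curve_def \<psi>_def)
  qed
  have d\<psi>: "(\<psi> has_vector_derivative c t) (at t within {0..T})" if "t \<in> {0..T}" for t
    unfolding \<psi>_def using integral_has_vector_derivative[OF continuous_on_subset[OF c] that]
    by (auto intro!: derivative_eq_intros)
  have \<psi>c: "continuous_on {0..T} \<psi>"
    by (rule continuous_on_vector_derivative[OF d\<psi>])
  let ?g = "\<lambda>s. Ft s (\<psi> s) + Fx s (\<psi> s) (c s)"
  have dF: "((\<lambda>t. F t (\<psi> t)) has_vector_derivative ?g t) (at t within {0..T})" if t: "t \<in> {0..T}" for t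
  proof -
    \<comment> \<open>Total differentiability along the curve, from the t-derivative at the point
      and the joint continuity of the x-derivative.\<close>
    have "((\<lambda>(t, x). F t x) has_derivative (\<lambda>(tx, ty). tx *\<^sub>R Ft t (\<psi> t) + Fx t (\<psi> t) ty)) (at (t, \<psi> t) within {0..T} \<times> UNIV)"
    proof (rule has_derivative_partialsI)
      show "((\<lambda>s. F s (\<psi> t)) has_derivative (\<lambda>tx. tx *\<^sub>R Ft t (\<psi> t))) (at t within {0..T})"
        using Ft_deriv[OF t] by (simp add: has_vector_derivative_def)
      show "continuous (at (t, \<psi> t) within {0..T} \<times> UNIV) (\<lambda>(t, x). Fx t x)"
        using Fx_cont t by (simp add: continuous_on_eq_continuous_within)
    qed (use Fx_deriv in auto)
    then have "((\<lambda>(t, x). F t x) has_derivative (\<lambda>(tx, ty). tx *\<^sub>R Ft t (\<psi> t) + Fx t (\<psi> t) ty)) (at (t, \<psi> t) within (\<lambda>t. (t, \<psi> t)) ` {0..T})"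
      by (rule has_derivative_subset) auto
    moreover have "((\<lambda>t. (t, \<psi> t)) has_derivative (\<lambda>h. (h, h *\<^sub>R c t))) (at t within {0..T})"
      using d\<psi>[OF t] by (auto simp: has_vector_derivative_def intro!: derivative_eq_intros)
    ultimately have "((\<lambda>t. (\<lambda>(t, x). F t x) (t, \<psi> t)) has_derivative (\<lambda>h. (\<lambda>(tx, ty). tx *\<^sub>R Ft t (\<psi> t) + Fx t (\<psi> t) ty) (h, h *\<^sub>R c t))) (at t within {0..T})"
      by (rule has_derivative_in_compose[rotated])
    then show ?thesis
      by (simp add: has_vector_derivative_def blinfun.scaleR_right scaleR_add_right)
  qed
  fix t assume t: "t \<in> {0..T}"
  have "(?g has_integral (F t (\<psi> t) - F 0 (\<psi> 0))) {0..t}"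
    by (rule fundamental_theorem_of_calculus)
      (use t has_vector_derivative_within_subset[OF dF] in auto)
  then have "integral {0..t} ?g = F t (\<psi> t) - F 0 x0"
    by (simp add: integral_unique \<psi>_def)
  moreover have "abel 1 (density x0 ?q) t = integral {0..t} ?g"
  proof -
    have "abel 1 (density x0 ?q) t = integral {0..t} (density x0 ?q)"
      by (rule abel_one_eq_integral(1)[OF pker_one_integrable[OF density_integrable[OF q]] _ density_measurable[OF q]])
        (simp add: density_def blinfun.zero_right)
    also have "\<dots> = integral {0..t} ?g"
      by (rule integral_spike[where S = "{0}"]) (use t in \<open>auto simp: density_def cu\<close>)
    finally show ?thesis .
  qed
  ultimately show "F t (curve x0 ?q t) = F 0 x0 + abel 1 (density x0 ?q) t"
    by (simp add: cu[OF t])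
qed

text \<open>A measurable velocity is the limit of continuous functions off a negligible set.
  Projecting these onto the ball of radius \<open>B\<close> supplies a common dominating function
  and preserves the limit, since \<open>q\<close> takes its values in that ball.\<close>

lemma chain_rule_bounded:
  assumes q: "velocity q" and B: "\<And>s. norm (q s) \<le> B"
  shows "chain_rule x0 q"
proof -
  have B0: "0 \<le> B" using B[of 0] norm_ge_zero order_trans by blast
  have qm: "q \<in> borel_measurable borel" using q by (simp add: velocity_def integrable_iff_bounded)
  then have "q \<in> borel_measurable (lebesgue_on UNIV)"
    by (intro measurable_restrict_space1 measurable_completion) simp
  then have "q measurable_on UNIV" by (simp add: measurable_on_iff_borel_measurable)
  then obtain N g where N: "negligible N" and g: "\<And>n. continuous_on UNIV (g n)"
    and lim: "\<And>x. x \<notin> N \<Longrightarrow> (\<lambda>n. g n x) \<longlonglongrightarrow> q x"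
    unfolding measurable_on_def by auto
  let ?P = "closest_point (cball (0::'a) B)"
  have Pc: "continuous_on UNIV ?P" using B0 by (intro continuous_on_closest_point) auto
  have gP: "continuous_on UNIV (\<lambda>s. ?P (g n s))" for n
    by (rule continuous_on_compose2[OF Pc g]) simp
  show ?thesis
  proof (rule chain_rule_limit[OF q, where qn = "\<lambda>n s. indicator {0<..T} s *\<^sub>R ?P (g n s)" and h = "\<lambda>s. B * indicator {0<..T} s"])
    have "AE s in lebesgue. (\<lambda>n. indicator {0<..T} s *\<^sub>R ?P (g n s)) \<longlonglongrightarrow> q s"
    proof (rule AE_I[where N = N])
      show "{s \<in> space lebesgue. \<not> (\<lambda>n. indicator {0<..T} s *\<^sub>R ?P (g n s)) \<longlonglongrightarrow> q s} \<subseteq> N"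
      proof (intro subsetI, rule ccontr)
        fix s assume s: "s \<in> {s \<in> space lebesgue. \<not> (\<lambda>n. indicator {0<..T} s *\<^sub>R ?P (g n s)) \<longlonglongrightarrow> q s}" "s \<notin> N"
        have "(\<lambda>n. ?P (g n s)) \<longlonglongrightarrow> ?P (q s)"
          by (rule continuous_on_tendsto_compose[OF Pc lim[OF s(2)]]) auto
        also have "?P (q s) = q s" using B[of s] by (intro closest_point_self) simp
        finally have "(\<lambda>n. indicator {0<..T} s *\<^sub>R ?P (g n s)) \<longlonglongrightarrow> indicator {0<..T} s *\<^sub>R q s"
          by (intro tendsto_intros)
        moreover have "indicator {0<..T} s *\<^sub>R q s = q s" using q by (auto simp: velocity_def split: split_indicator)
        ultimately show False using s(1) by simp
      qed
    qed (use N in \<open>auto simp: negligible_iff_null_sets\<close>)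
    then show "AE s in lborel. (\<lambda>n. indicator {0<..T} s *\<^sub>R ?P (g n s)) \<longlonglongrightarrow> q s"
      by (simp add: AE_completion_iff)
    show "norm (indicator {0<..T} s *\<^sub>R ?P (g n s)) \<le> B * indicator {0<..T} s" for n s
      using closest_point_in_set[of "cball (0::'a) B" "g n s"] B0 by (auto split: split_indicator)
  qed (use velocity_cut[OF gP] chain_rule_continuous[OF gP] indicator_integrable in auto)
qed

theorem chain_rule_velocity:
  assumes q: "velocity q"
  shows "chain_rule x0 q"
proof (rule chain_rule_limit[OF q, where qn = "\<lambda>n s. if norm (q s) \<le> real n then q s else 0" and h = "\<lambda>s. norm (q s)"])
  have [measurable]: "q \<in> borel_measurable borel" using q by (simp add: velocity_def integrable_iff_bounded)
  show v: "velocity (\<lambda>s. if norm (q s) \<le> real n then q s else 0)" for n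
    unfolding velocity_def
  proof
    show "integrable lborel (\<lambda>s. if norm (q s) \<le> real n then q s else 0)"
      by (rule Bochner_Integration.integrable_bound[of _ q]) (use q in \<open>auto simp: velocity_def\<close>)
  qed (use q in \<open>auto simp: velocity_def\<close>)
  show "chain_rule x0 (\<lambda>s. if norm (q s) \<le> real n then q s else 0)" for n
    by (rule chain_rule_bounded[OF v, where B = "real n"]) auto
  have "(\<lambda>n. if norm (q s) \<le> real n then q s else 0) \<longlonglongrightarrow> q s" for s
  proof (rule tendsto_eventually)
    obtain k :: nat where "norm (q s) \<le> real k" using real_arch_simple by blast
    then show "\<forall>\<^sub>F n in sequentially. (if norm (q s) \<le> real n then q s else 0) = q s"
      by (auto simp: eventually_sequentially intro!: exI[of _ k])
  qed
  then show "AE s in lborel. (\<lambda>n. if norm (q s) \<le> real n then q s else 0) \<longlonglongrightarrow> q s" by simp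
qed (use q in \<open>auto simp: velocity_def\<close>)

end

subsection \<open>The transformed operator\<close>

text \<open>These are the two analytic hypotheses of \<open>represented_smooth\<close>. The weights
  s^(-a) and s^a cancel, and the orders 1 - a and a combine to a plain primitive of
  \<open>V\<close>, so the bound depends on \<open>V\<close> only through its integral and is
  uniform in t.\<close>

lemma weighted_density_bounds:
  fixes p :: "real \<Rightarrow> 'a::{banach,second_countable_topology}"
  assumes a: "0 < a" "a < 1/2" and [measurable]: "p \<in> borel_measurable borel"
    and V: "integrable lborel V" "\<And>s. 0 \<le> V s"
    and p: "\<And>s. norm (p s) \<le> K * (indicator {0<..T} s + pker (1 + a) s * abel a V s)" and K: "0 \<le> K"
    and t: "t \<in> {0..T}"
  shows "integrable lborel (\<lambda>s. pker (1 - a) (t - s) *\<^sub>R (pker (1 - a) s *\<^sub>R p s))"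
    and "abel (1 - a) (\<lambda>s. pker (1 - a) s * norm (p s)) t
      \<le> K * (Beta (1 - a) (1 - a) * pker (2 - 2 * a) T + Beta (1 - a) a * (LINT s|lborel. V s))"
proof -
  have ab: "0 < 1 - a" using a by simp
  have [measurable]: "V \<in> borel_measurable borel" using V by (simp add: integrable_iff_bounded)
  have V1: "integrable lborel (\<lambda>s. pker (1 - a + a) (t - s) *\<^sub>R V s)"
    using pker_one_integrable[OF V(1), of t] by simp
  have i2: "integrable lborel (\<lambda>s. pker (1 - a) (t - s) *\<^sub>R abel a V s)"
    and v2: "abel (1 - a) (abel a V) t = Beta (1 - a) a * abel 1 V t"
    using abel_abel[OF _ ab a(1) V1] by simp_all
  have i1: "integrable lborel (\<lambda>s. pker (1 - a) (t - s) *\<^sub>R pker (1 - a) s)"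
    and v1: "abel (1 - a) (pker (1 - a)) t = Beta (1 - a) (1 - a) * pker (2 - 2 * a) t"
    using pker_beta0[OF ab ab, of t] by simp_all
  let ?w = "\<lambda>s. pker (1 - a) s * norm (p s)" and ?w' = "\<lambda>s. K *\<^sub>R (pker (1 - a) s + abel a V s)"
  have av: "0 \<le> abel a V s" for s by (rule abel_nonneg) (rule V)
  have le: "0 \<le> ?w s \<and> ?w s \<le> ?w' s" for s
  proof
    have "?w s \<le> pker (1 - a) s * (K * (indicator {0<..T} s + pker (1 + a) s * abel a V s))"
      by (intro mult_left_mono p) simp
    also have "\<dots> = K * (pker (1 - a) s * indicator {0<..T} s + (pker (1 - a) s * pker (1 + a) s) * abel a V s)"
      by (simp add: algebra_simps)
    also have "\<dots> \<le> K * (pker (1 - a) s * 1 + 1 * abel a V s)"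
    proof (intro mult_left_mono add_mono mult_right_mono K av)
      show "pker (1 - a) s * pker (1 + a) s \<le> 1"
        unfolding pker_mult by (simp add: pker_def)
    qed (auto split: split_indicator)
    finally show "?w s \<le> ?w' s" by simp
  qed simp
  have iw': "integrable lborel (\<lambda>s. pker (1 - a) (t - s) *\<^sub>R ?w' s)"
    using integrable_scaleR_right[OF Bochner_Integration.integrable_add[OF i1 i2], of K] by (simp add: algebra_simps)
  have "integrable lborel (\<lambda>s. norm (pker (1 - a) (t - s) *\<^sub>R (pker (1 - a) s *\<^sub>R p s)))"
    using abel_mono(2)[OF _ iw' le] by (simp add: mult_ac)
  then show "integrable lborel (\<lambda>s. pker (1 - a) (t - s) *\<^sub>R (pker (1 - a) s *\<^sub>R p s))"
    by (subst (asm) integrable_norm_iff) measurable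
  have "abel (1 - a) ?w t \<le> abel (1 - a) ?w' t"
    by (rule abel_mono(1)[OF _ iw' le]) measurable
  also have "\<dots> = K * (Beta (1 - a) (1 - a) * pker (2 - 2 * a) t + Beta (1 - a) a * abel 1 V t)"
    unfolding abel_scaleR abel_add[OF i1 i2] v1 v2 by simp
  also have "\<dots> \<le> K * (Beta (1 - a) (1 - a) * pker (2 - 2 * a) T + Beta (1 - a) a * (LINT s|lborel. V s))"
  proof -
    have "abel 1 V t \<le> (LINT s|lborel. V s)"
      unfolding abel_def using V by (intro integral_mono pker_one_integrable) (auto simp: pker_def)
    moreover have "pker (2 - 2 * a) t \<le> pker (2 - 2 * a) T"
      using a t by (intro pker_mono) auto
    moreover have "0 < Beta (1 - a) (1 - a)" "0 < Beta (1 - a) a" using a by (auto intro!: Beta_real_pos)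
    ultimately show ?thesis by (intro mult_left_mono add_mono K) auto
  qed
  finally show "abel (1 - a) ?w t
      \<le> K * (Beta (1 - a) (1 - a) * pker (2 - 2 * a) T + Beta (1 - a) a * (LINT s|lborel. V s))" .
qed

lift_definition coord_blinfun :: "'n::finite \<Rightarrow> (real ^ 'n) \<Rightarrow>\<^sub>L (real ^ 'n)" is "\<lambda>i v. (v $ i) *\<^sub>R axis i 1"
  by (intro bounded_linear_scaleR_const bounded_linear_vec_nth)

text \<open>A linear combination of fixed operators, so that continuity and differentiability in
  operator norm reduce to the scalar coefficients.\<close>

definition diag_blinfun :: "('n::finite \<Rightarrow> real) \<Rightarrow> (real ^ 'n) \<Rightarrow>\<^sub>L (real ^ 'n)" where
  "diag_blinfun f = (\<Sum>i\<in>UNIV. f i *\<^sub>R coord_blinfun i)"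

lemma diag_blinfun_nth: "diag_blinfun f v $ i = f i * v $ i"
proof -
  have "diag_blinfun f v $ i = (\<Sum>j\<in>UNIV. f j * (v $ j * axis j 1 $ i))"
    by (simp add: diag_blinfun_def blinfun.sum_left blinfun.scaleR_left coord_blinfun.rep_eq mult.assoc)
  also have "\<dots> = (\<Sum>j\<in>UNIV. if j = i then f i * v $ i else 0)"
    by (rule sum.cong) (auto simp: axis_def)
  finally show ?thesis by simp
qed

lemma diag_blinfun_derivative:
  assumes "\<And>i. ((\<lambda>t. f t i) has_real_derivative f' i) (at t within X)"
  shows "((\<lambda>t. diag_blinfun (f t)) has_vector_derivative diag_blinfun f') (at t within X)"
  unfolding diag_blinfun_def
  by (intro has_vector_derivative_sum) (use assms in \<open>auto intro!: derivative_eq_intros simp: has_real_derivative_iff_has_vector_derivative\<close>)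

lemma diag_blinfun_continuous:
  "(\<And>i. continuous_on X (\<lambda>t. f t i)) \<Longrightarrow> continuous_on X (\<lambda>t. diag_blinfun (f t))"
  unfolding diag_blinfun_def by (intro continuous_intros)

lemma admissible_diffusion_blinfun:
  assumes "admissible_diffusion T \<sigma>"
  obtains S S' L L' :: "real \<Rightarrow> (real ^ 'n) \<Rightarrow>\<^sub>L (real ^ 'n)"
  where "\<And>t. t \<in> {0..T} \<Longrightarrow> (S has_vector_derivative S' t) (at t within {0..T})" "continuous_on {0..T} S'"
    "\<And>t. t \<in> {0..T} \<Longrightarrow> (L has_vector_derivative L' t) (at t within {0..T})" "continuous_on {0..T} L'"
    "\<And>t v. t \<in> {0..T} \<Longrightarrow> \<sigma> t *v v = S t v"
    "\<And>t v. t \<in> {0..T} \<Longrightarrow> L t (S t v) = v" "\<And>t v. t \<in> {0..T} \<Longrightarrow> S t (L t v) = v"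
proof -
  have diag: "\<sigma> t $ i $ j = 0" if "t \<in> {0..T}" "i \<noteq> j" for t i j
    using assms that by (auto simp: admissible_diffusion_def)
  have pos: "0 < \<sigma> t $ i $ i" if "t \<in> {0..T}" for t i
  proof -
    have "\<forall>i. \<exists>m M. 0 < m \<and> (\<forall>t\<in>{0..T}. m \<le> \<sigma> t $ i $ i \<and> \<sigma> t $ i $ i \<le> M)"
      using assms by (simp add: admissible_diffusion_def)
    then obtain m where "0 < m" "\<forall>t\<in>{0..T}. m \<le> \<sigma> t $ i $ i" by meson
    then show ?thesis using that by force
  qed
  have "\<forall>i. \<exists>f'. continuous_on {0..T} f' \<and> (\<forall>t\<in>{0..T}. ((\<lambda>t. \<sigma> t $ i $ i) has_real_derivative f' t) (at t within {0..T}))"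
    using assms by (auto simp: admissible_diffusion_def C1_on_interval_def)
  then obtain f' where f': "\<And>i. continuous_on {0..T} (f' i)"
    "\<And>i t. t \<in> {0..T} \<Longrightarrow> ((\<lambda>t. \<sigma> t $ i $ i) has_real_derivative f' i t) (at t within {0..T})"
    by metis
  have c: "continuous_on {0..T} (\<lambda>t. \<sigma> t $ i $ i)" for i
    using f'(2) by (intro DERIV_continuous_on) auto
  show ?thesis
  proof
    show "((\<lambda>t. diag_blinfun (\<lambda>i. \<sigma> t $ i $ i)) has_vector_derivative diag_blinfun (\<lambda>i. f' i t)) (at t within {0..T})"
      if "t \<in> {0..T}" for t
      by (intro diag_blinfun_derivative f' that)
    show "continuous_on {0..T} (\<lambda>t. diag_blinfun (\<lambda>i. f' i t))"
      by (intro diag_blinfun_continuous f')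
    show "((\<lambda>t. diag_blinfun (\<lambda>i. inverse (\<sigma> t $ i $ i))) has_vector_derivative
        diag_blinfun (\<lambda>i. - (inverse (\<sigma> t $ i $ i) * f' i t * inverse (\<sigma> t $ i $ i)))) (at t within {0..T})"
      if "t \<in> {0..T}" for t
      using pos[OF that] by (intro diag_blinfun_derivative DERIV_inverse' f' that) (auto simp: less_imp_neq[THEN not_sym])
    show "continuous_on {0..T} (\<lambda>t. diag_blinfun (\<lambda>i. - (inverse (\<sigma> t $ i $ i) * f' i t * inverse (\<sigma> t $ i $ i))))"
      using pos by (intro diag_blinfun_continuous continuous_intros c f') (metis less_irrefl)+
    show "\<sigma> t *v v = diag_blinfun (\<lambda>i. \<sigma> t $ i $ i) v" if "t \<in> {0..T}" for t v
    proof -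
      have "(\<Sum>j\<in>UNIV. \<sigma> t $ i $ j * v $ j) = (\<Sum>j\<in>UNIV. if j = i then \<sigma> t $ i $ i * v $ i else 0)" for i
        by (rule sum.cong) (auto simp: diag[OF that])
      then show ?thesis by (simp add: vec_eq_iff diag_blinfun_nth matrix_vector_mult_def)
    qed
    show "diag_blinfun (\<lambda>i. inverse (\<sigma> t $ i $ i)) (diag_blinfun (\<lambda>i. \<sigma> t $ i $ i) v) = v" if "t \<in> {0..T}" for t v
      using pos[OF that] by (simp add: vec_eq_iff diag_blinfun_nth less_imp_neq[THEN not_sym] flip: mult.assoc)
    show "diag_blinfun (\<lambda>i. \<sigma> t $ i $ i) (diag_blinfun (\<lambda>i. inverse (\<sigma> t $ i $ i)) v) = v" if "t \<in> {0..T}" for t v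
      using pos[OF that] by (simp add: vec_eq_iff diag_blinfun_nth less_imp_neq[THEN not_sym] flip: mult.assoc)
  qed
qed

text \<open>\<open>S\<close> and \<open>L\<close> are \<open>\<sigma>\<close> and its inverse as bounded linear maps, \<open>S'\<close> and \<open>L'\<close> their time derivatives.\<close>

locale transformed_noise =
  fixes H T :: real and \<sigma> :: "real \<Rightarrow> real ^ 'n ^ 'n"
    and S S' L L' :: "real \<Rightarrow> (real ^ 'n) \<Rightarrow>\<^sub>L (real ^ 'n)"
  assumes H: "0 < H" "H < 1" and T: "0 < T"
    and S_deriv: "\<And>t. t \<in> {0..T} \<Longrightarrow> (S has_vector_derivative S' t) (at t within {0..T})"
    and S'_cont: "continuous_on {0..T} S'"
    and L_deriv: "\<And>t. t \<in> {0..T} \<Longrightarrow> (L has_vector_derivative L' t) (at t within {0..T})"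
    and L'_cont: "continuous_on {0..T} L'"
    and \<sigma>_S: "\<And>t v. t \<in> {0..T} \<Longrightarrow> \<sigma> t *v v = S t v"
    and LS: "\<And>t v. t \<in> {0..T} \<Longrightarrow> L t (S t v) = v" and SL: "\<And>t v. t \<in> {0..T} \<Longrightarrow> S t (L t v) = v"
begin

lemma S_cont: "continuous_on {0..T} S" and L_cont: "continuous_on {0..T} L"
  by (rule continuous_on_vector_derivative[OF S_deriv], assumption, rule continuous_on_vector_derivative[OF L_deriv], assumption)

lemma K_sigma_eq:
  assumes "u \<in> L2_fun T" "t \<in> {0..T}"
  shows "K_sigma H \<sigma> u t = S t (K_op H u t) - integral {0..t} (\<lambda>r. S' r (K_op H u r))"
  unfolding K_sigma_def
  by (rule young_integral_eqI[OF has_young_integral_C1[OF S_deriv S'_cont \<sigma>_S K_op_continuous[OF H T assms(1)] K_op_zero[OF H T] assms(2)]])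

lemma K_sigma_cont:
  assumes "u \<in> L2_fun T"
  shows "continuous_on {0..T} (K_sigma H \<sigma> u)"
proof -
  note g = K_op_continuous[OF H T assms]
  have "continuous_on {0..T} (\<lambda>t. S t (K_op H u t) - integral {0..t} (\<lambda>r. S' r (K_op H u r)))"
    by (intro continuous_intros S_cont S'_cont g indefinite_integral_continuous_1 integrable_continuous_real)
  then show ?thesis using K_sigma_eq[OF assms] by (subst continuous_on_cong[OF refl]) auto
qed

lemma K_sigma_diff:
  assumes u: "u \<in> L2_fun T" and v: "v \<in> L2_fun T" and uv: "(\<lambda>s. u s - v s) \<in> L2_fun T" and t: "t \<in> {0..T}"
  shows "K_sigma H \<sigma> (\<lambda>s. u s - v s) t = K_sigma H \<sigma> u t - K_sigma H \<sigma> v t"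
proof -
  have i: "(\<lambda>r. S' r (K_op H w r)) integrable_on {0..t}" if "w \<in> L2_fun T" for w
    using t by (intro integrable_continuous_real continuous_intros continuous_on_subset[OF S'_cont] continuous_on_subset[OF K_op_continuous[OF H T that]]) auto
  have "integral {0..t} (\<lambda>r. S' r (K_op H (\<lambda>s. u s - v s) r)) = integral {0..t} (\<lambda>r. S' r (K_op H u r) - S' r (K_op H v r))"
    using t by (intro integral_cong) (simp add: K_op_diff[OF H T u v] blinfun.diff_right)
  then show ?thesis
    using K_op_diff[OF H T u v t] i[OF u] i[OF v]
    by (simp add: K_sigma_eq[OF uv t] K_sigma_eq[OF u t] K_sigma_eq[OF v t] blinfun.diff_right integral_diff)
qed

text \<open>By \<open>K_sigma_eq\<close> the hypothesis is a homogeneous Volterra equation for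
  \<open>K_op H u\<close>. Applying \<open>L\<close> isolates the unknown, Gronwall makes it vanish,
  and \<open>K_op_inj\<close> concludes.\<close>

lemma K_sigma_inj:
  assumes u: "u \<in> L2_fun T" and z: "\<And>t. t \<in> {0..T} \<Longrightarrow> K_sigma H \<sigma> u t = 0"
  shows "AE s in lebesgue. s \<in> {0..T} \<longrightarrow> u s = 0"
proof (rule K_op_inj[OF H T u])
  fix t assume t: "t \<in> {0..T}"
  note g = K_op_continuous[OF H T u]
  obtain M where M: "0 < M" "\<And>t v. t \<in> {0..T} \<Longrightarrow> norm (S' t v) \<le> M * norm v"
    using blinfun_bounded_on_interval[OF S'_cont] by blast
  obtain M' where M': "0 < M'" "\<And>t v. t \<in> {0..T} \<Longrightarrow> norm (L t v) \<le> M' * norm v"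
    using blinfun_bounded_on_interval[OF L_cont] by blast
  have "norm (K_op H u t) = 0"
  proof (rule gronwall_zero[where h = "\<lambda>t. norm (K_op H u t)" and C = "M' * M", OF _ _ _ _ t])
    show "continuous_on {0..T} (\<lambda>t. norm (K_op H u t))" by (intro continuous_intros g)
    fix t assume t: "t \<in> {0..T}"
    have gt: "continuous_on {0..t} (K_op H u)" by (rule continuous_on_subset[OF g]) (use t in auto)
    have "K_op H u t = L t (S t (K_op H u t))" by (simp add: LS[OF t])
    also have "\<dots> = L t (integral {0..t} (\<lambda>r. S' r (K_op H u r)))"
      using K_sigma_eq[OF u t] z[OF t] by simp
    also have "norm \<dots> \<le> M' * norm (integral {0..t} (\<lambda>r. S' r (K_op H u r)))" by (rule M'(2)[OF t])
    also have "\<dots> \<le> M' * integral {0..t} (\<lambda>r. M * norm (K_op H u r))"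
    proof (intro mult_left_mono integral_norm_bound_integral)
      show "(\<lambda>r. S' r (K_op H u r)) integrable_on {0..t}"
        using t by (intro integrable_continuous_real continuous_intros gt continuous_on_subset[OF S'_cont]) auto
      show "(\<lambda>r. M * norm (K_op H u r)) integrable_on {0..t}"
        by (intro integrable_continuous_real continuous_intros gt)
    qed (use M M' t in auto)
    finally show "norm (K_op H u t) \<le> M' * M * integral {0..t} (\<lambda>t. norm (K_op H u t))" by simp
  qed (use M M' in auto)
  then show "K_op H u t = 0" by simp
qed

text \<open>The counterpart of injectivity: a zero norm shows a control to vanish only almost
  everywhere, and this carries the information over to the path.\<close>

lemma K_sigma_AE_zero:
  assumes u: "u \<in> L2_fun T" and z: "AE s in lebesgue. s \<in> {0..T} \<longrightarrow> u s = 0" and t: "t \<in> {0..T}"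
  shows "K_sigma H \<sigma> u t = 0"
proof -
  have "K_op H u r = 0" if "r \<in> {0..T}" for r
    unfolding K_op_def set_lebesgue_integral_def
    by (rule integral_eq_zero_AE) (use z in \<open>eventually_elim, use that in \<open>auto split: split_indicator\<close>\<close>)
  moreover from this have "integral {0..t} (\<lambda>r. S' r (K_op H u r)) = integral {0..t} (\<lambda>r. 0)"
    using t by (intro integral_cong) (auto simp: blinfun.zero_right)
  ultimately show ?thesis using K_sigma_eq[OF u t] t by (simp add: blinfun.zero_right)
qed

lemma K_sigma_density:
  assumes "integrable lborel p" "\<And>s. s \<notin> {0..T} \<Longrightarrow> p s = 0"
    and "\<And>t. t \<in> {0..T} \<Longrightarrow> K_op H u t = abel 1 p t" and "t \<in> {0..T}"
  shows "K_sigma H \<sigma> u t = abel 1 (\<lambda>s. S s (p s)) t" "integrable lborel (\<lambda>s. S s (p s))"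
  using has_young_integral_density[OF S_cont \<sigma>_S assms] unfolding K_sigma_def
  by (auto intro: young_integral_eqI)

end

section \<open>The drift along admissible paths\<close>

lemma bdd_contD:
  assumes "bdd_cont T f"
  shows "continuous_on ({0..T} \<times> UNIV) (\<lambda>(t, x). f t x)"
    and "\<exists>M>0. \<forall>t\<in>{0..T}. \<forall>x. norm (f t x) \<le> M"
proof -
  show "continuous_on ({0..T} \<times> UNIV) (\<lambda>(t, x). f t x)"
    using assms by (simp add: bdd_cont_def)
  have "bounded ((\<lambda>(t, x). f t x) ` ({0..T} \<times> UNIV))"
    using assms by (simp add: bdd_cont_def)
  then obtain M where M: "0 < M" "\<forall>y\<in>(\<lambda>(t, x). f t x) ` ({0..T} \<times> UNIV). norm y \<le> M"
    unfolding bounded_pos by blast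
  have "norm (f t x) \<le> M" if "t \<in> {0..T}" for t x
    using M(2) that by (force simp: image_iff)
  with M(1) show "\<exists>M>0. \<forall>t\<in>{0..T}. \<forall>x. norm (f t x) \<le> M" by blast
qed

lemma continuous_on_fst_comp:
  "continuous_on A S \<Longrightarrow> continuous_on (A \<times> UNIV) (\<lambda>(t, x). S t)"
  unfolding case_prod_beta by (rule continuous_on_compose2[of A S]) (auto intro: continuous_intros)

lemma set_integral_continuous:
  fixes h :: "real \<Rightarrow> 'a::euclidean_space"
  assumes "continuous_on {0..t} h"
  shows "(LINT s:{0..t}|lebesgue. h s) = integral {0..t} h"
  by (rule set_lebesgue_integral_eq_integral(2)) (use assms in \<open>rule absolutely_integrable_continuous_real\<close>)

lemma abel_one_cut:
  fixes h :: "real \<Rightarrow> 'a::euclidean_space"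
  assumes h: "continuous_on {0..T} h" and t: "t \<in> {0..T}"
  shows "abel 1 (\<lambda>s. indicator {0<..T} s *\<^sub>R h s) t = integral {0..t} h"
    and "integrable lborel (\<lambda>s. indicator {0<..T} s *\<^sub>R h s)"
    and "(\<lambda>s. indicator {0<..T} s *\<^sub>R h s) \<in> borel_measurable borel"
proof -
  show m: "(\<lambda>s. indicator {0<..T} s *\<^sub>R h s) \<in> borel_measurable borel"
    by (rule borel_measurable_continuous_on_indicator[OF _ continuous_on_subset[OF h]]) auto
  have "integrable lborel (\<lambda>s. indicator {0..T} s *\<^sub>R h s)"
    using borel_integrable_atLeastAtMost'[OF h] by (simp add: set_integrable_def)
  then show i: "integrable lborel (\<lambda>s. indicator {0<..T} s *\<^sub>R h s)"
    by (rule Bochner_Integration.integrable_bound) (use m in \<open>auto split: split_indicator\<close>)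
  have "abel 1 (\<lambda>s. indicator {0<..T} s *\<^sub>R h s) t = integral {0..t} (\<lambda>s. indicator {0<..T} s *\<^sub>R h s)"
    by (rule abel_one_eq_integral(1)[OF pker_one_integrable[OF i] _ m]) simp
  also have "\<dots> = integral {0..t} h"
    by (rule integral_spike[where S = "{0}"]) (use t in auto)
  finally show "abel 1 (\<lambda>s. indicator {0<..T} s *\<^sub>R h s) t = integral {0..t} h" .
qed

text \<open>The regularity of admissible paths for \<open>H > 1/2\<close>, where \<open>a = H - 1/2\<close>.\<close>

definition smooth_velocity :: "real \<Rightarrow> real \<Rightarrow> (real \<Rightarrow> 'a::euclidean_space) \<Rightarrow> bool" where
  "smooth_velocity a T \<psi> \<longleftrightarrow> (\<exists>q V K. integrable lborel q \<and> (\<forall>s. s \<notin> {0<..T} \<longrightarrow> q s = 0) \<and>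
     (\<forall>t\<in>{0..T}. \<psi> t = \<psi> 0 + abel 1 q t) \<and> integrable lborel V \<and> (\<forall>s. 0 \<le> (V s :: real)) \<and> 0 \<le> K \<and>
     (\<forall>s. norm (q s) \<le> K * (indicator {0<..T} s + pker (1 + a) s * abel a V s)))"

locale transformed_drift = transformed_noise H T \<sigma> S S' L L'
  for H T :: real and \<sigma> :: "real \<Rightarrow> real ^ 'n ^ 'n"
    and S S' L L' :: "real \<Rightarrow> (real ^ 'n) \<Rightarrow>\<^sub>L (real ^ 'n)" +
  fixes b :: "real \<Rightarrow> real ^ 'n \<Rightarrow> real ^ 'n"
  assumes b: "Cb13 T b"
begin

lemma b_cont: "continuous_on ({0..T} \<times> UNIV) (\<lambda>(t, x). b t x)"
  and b_bound: "\<exists>B>0. \<forall>t\<in>{0..T}. \<forall>x. norm (b t x) \<le> B"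
  using bdd_contD[of T b] b by (auto simp: Cb13_def)

lemma b_derivatives:
  obtains Dt D1 where "bdd_cont T Dt"
    "\<And>t x. t \<in> {0..T} \<Longrightarrow> ((\<lambda>s. b s x) has_vector_derivative Dt t x) (at t within {0..T})"
    "bdd_cont T D1" "\<And>t x. t \<in> {0..T} \<Longrightarrow> (b t has_derivative blinfun_apply (D1 t x)) (at x)"
proof -
  have "\<exists>Dt. bdd_cont T Dt \<and> (\<forall>t\<in>{0..T}. \<forall>x. ((\<lambda>s. b s x) has_vector_derivative Dt t x) (at t within {0..T}))"
    using b unfolding Cb13_def by (elim conjE)
  then obtain Dt where Dt: "bdd_cont T Dt" "\<forall>t\<in>{0..T}. \<forall>x. ((\<lambda>s. b s x) has_vector_derivative Dt t x) (at t within {0..T})"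
    by (elim exE conjE)
  have "\<exists>D1. bdd_cont T D1 \<and> (\<forall>t\<in>{0..T}. \<forall>x. (b t has_derivative blinfun_apply (D1 t x)) (at x))"
    using b unfolding Cb13_def by (elim conjE exE) (rule exI, rule conjI, assumption, blast)
  then obtain D1 where D1: "bdd_cont T D1" "\<forall>t\<in>{0..T}. \<forall>x. (b t has_derivative blinfun_apply (D1 t x)) (at x)"
    by (elim exE conjE)
  show ?thesis
    by (rule that[OF Dt(1) _ D1(1)]) (use Dt(2) D1(2) in blast)+
qed

lemma b_lipschitz:
  obtains K where "0 < K" "\<And>t x y. t \<in> {0..T} \<Longrightarrow> norm (b t x - b t y) \<le> K * norm (x - y)"
proof -
  obtain Dt D1 where Dt: "bdd_cont T Dt"
      "\<And>t x. t \<in> {0..T} \<Longrightarrow> ((\<lambda>s. b s x) has_vector_derivative Dt t x) (at t within {0..T})"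
    and D1: "bdd_cont T D1" "\<And>t x. t \<in> {0..T} \<Longrightarrow> (b t has_derivative blinfun_apply (D1 t x)) (at x)"
    by (rule b_derivatives) (rule that)
  obtain K where K: "0 < K" "\<And>t x. t \<in> {0..T} \<Longrightarrow> norm (D1 t x) \<le> K"
    using bdd_contD(2)[OF D1(1)] by blast
  show ?thesis
  proof (rule that[OF K(1)])
    fix t x y assume t: "t \<in> {0..T}"
    show "norm (b t x - b t y) \<le> K * norm (x - y)"
      by (rule differentiable_bound[of UNIV "b t" "\<lambda>x. blinfun_apply (D1 t x)"])
        (use D1(2)[OF t] K(2)[OF t] in \<open>auto simp: norm_blinfun.rep_eq[symmetric]\<close>)
  qed
qed

lemma transformed_C1_field: "\<exists>M Ft Fx. C1_field T M (\<lambda>t x. L t (b t x)) Ft Fx"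
proof -
  obtain Dt D1 where Dt: "bdd_cont T Dt"
      "\<And>t x. t \<in> {0..T} \<Longrightarrow> ((\<lambda>s. b s x) has_vector_derivative Dt t x) (at t within {0..T})"
    and D1: "bdd_cont T D1" "\<And>t x. t \<in> {0..T} \<Longrightarrow> (b t has_derivative blinfun_apply (D1 t x)) (at x)"
    by (rule b_derivatives) (rule that)
  obtain c0 where c0: "0 < c0" "\<And>t v. t \<in> {0..T} \<Longrightarrow> norm (L t v) \<le> c0 * norm v"
    using blinfun_bounded_on_interval[OF L_cont] by blast
  obtain c0' where c0': "0 < c0'" "\<And>t v. t \<in> {0..T} \<Longrightarrow> norm (L' t v) \<le> c0' * norm v"
    using blinfun_bounded_on_interval[OF L'_cont] by blast
  obtain B where B: "0 < B" "\<And>t x. t \<in> {0..T} \<Longrightarrow> norm (b t x) \<le> B" using b_bound by blast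
  obtain Bt where Bt: "0 < Bt" "\<And>t x. t \<in> {0..T} \<Longrightarrow> norm (Dt t x) \<le> Bt" using bdd_contD(2)[OF Dt(1)] by blast
  obtain B1 where B1: "0 < B1" "\<And>t x. t \<in> {0..T} \<Longrightarrow> norm (D1 t x) \<le> B1" using bdd_contD(2)[OF D1(1)] by blast
  note c = continuous_on_fst_comp[OF L_cont] continuous_on_fst_comp[OF L'_cont] b_cont bdd_contD(1)[OF Dt(1)] bdd_contD(1)[OF D1(1)]
  define M where "M = (c0' * B + c0 * Bt) + c0 * B1"
  have M: "c0' * B + c0 * Bt \<le> M" "c0 * B1 \<le> M" using c0 c0' B Bt B1 by (simp_all add: M_def)
  have "C1_field T M (\<lambda>t x. L t (b t x)) (\<lambda>t x. L' t (b t x) + L t (Dt t x)) (\<lambda>t x. L t o\<^sub>L D1 t x)"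
  proof
    show "continuous_on ({0..T} \<times> UNIV) (\<lambda>(t, x). L t (b t x))"
      "continuous_on ({0..T} \<times> UNIV) (\<lambda>(t, x). L' t (b t x) + L t (Dt t x))"
      "continuous_on ({0..T} \<times> UNIV) (\<lambda>(t, x). L t o\<^sub>L D1 t x)"
      unfolding case_prod_beta
      by (intro continuous_intros bounded_bilinear.continuous_on[OF bounded_bilinear_blinfun_compose] c[unfolded case_prod_beta])+
    fix t x assume t: "t \<in> {0..T}"
    show "norm (L' t (b t x) + L t (Dt t x)) \<le> M"
    proof -
      have "norm (L' t (b t x)) \<le> c0' * B"
        using c0'(2)[OF t, of "b t x"] mult_left_mono[OF B(2)[OF t, of x], of c0'] c0'(1) by linarith
      moreover have "norm (L t (Dt t x)) \<le> c0 * Bt"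
        using c0(2)[OF t, of "Dt t x"] mult_left_mono[OF Bt(2)[OF t, of x], of c0] c0(1) by linarith
      ultimately show ?thesis using M(1) norm_triangle_ineq[of "L' t (b t x)" "L t (Dt t x)"] by linarith
    qed
    have "norm (L t) \<le> c0"
      using c0(1) c0(2)[OF t] by (intro norm_blinfun_bound) auto
    then have "norm (L t) * norm (D1 t x) \<le> c0 * B1"
      using B1(2)[OF t, of x] c0(1) by (intro mult_mono) auto
    then show "norm (L t o\<^sub>L D1 t x) \<le> M"
      using norm_blinfun_compose[of "L t" "D1 t x"] M(2) by linarith
    have "((\<lambda>s. L s (b s x)) has_vector_derivative L t (Dt t x) + L' t (b t x)) (at t within {0..T})"
      by (rule bounded_bilinear.has_vector_derivative[OF bounded_bilinear_blinfun_apply L_deriv[OF t] Dt(2)[OF t]])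
    then show "((\<lambda>s. L s (b s x)) has_vector_derivative L' t (b t x) + L t (Dt t x)) (at t within {0..T})"
      by (simp add: add.commute)
    show "((\<lambda>x. L t (b t x)) has_derivative blinfun_apply (L t o\<^sub>L D1 t x)) (at x)"
      using bounded_linear.has_derivative[OF blinfun.bounded_linear_right D1(2)[OF t], of "L t"]
      by (simp add: blinfun_compose.rep_eq o_def)
  qed (rule T)
  then show ?thesis by blast
qed

text \<open>With f = \<sigma>\<open>^-1\<close> b(\<psi>), a control whose image under
  \<open>K_op\<close> is the primitive of f is mapped by \<open>K_sigma\<close> to the primitive of
  \<sigma> f = b(\<psi>). For H <= 1/2 boundedness of f suffices; for H > 1/2 the chain rule gives f
  a density with the bounds required by \<open>represented_smooth\<close>.\<close>

lemma drift_primitive_represented: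
  assumes \<psi>: "continuous_on {0..T} \<psi>" and smooth: "1/2 < H \<Longrightarrow> smooth_velocity (H - 1/2) T \<psi>"
  obtains u where "u \<in> L2_fun T" "\<And>t. t \<in> {0..T} \<Longrightarrow> K_sigma H \<sigma> u t = integral {0..t} (\<lambda>s. b s (\<psi> s))"
proof -
  obtain M Ft Fx where "C1_field T M (\<lambda>t x. L t (b t x)) Ft Fx"
    using transformed_C1_field by blast
  then interpret C1_field T M "\<lambda>t x. L t (b t x)" Ft Fx .
  define f where "f = (\<lambda>s. indicator {0<..T} s *\<^sub>R L s (b s (\<psi> s)))"
  have fc: "continuous_on {0..T} (\<lambda>s. L s (b s (\<psi> s)))"
    using continuous_on_section[OF F_cont \<psi>] .
  have T0: "0 \<in> {0..T}" using T by simp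
  have fm: "f \<in> borel_measurable borel" and fi: "integrable lborel f"
    unfolding f_def using abel_one_cut(2,3)[OF fc T0] by auto
  have f0: "f s = 0" if "s \<notin> {0<..T}" for s using that by (simp add: f_def)
  have "bounded ((\<lambda>s. L s (b s (\<psi> s))) ` {0..T})"
    by (intro compact_imp_bounded compact_continuous_image fc) auto
  then obtain B where B: "0 < B" "\<forall>y\<in>(\<lambda>s. L s (b s (\<psi> s))) ` {0..T}. norm y \<le> B"
    unfolding bounded_pos by blast
  have fb: "norm (f s) \<le> B" for s
    using B by (cases "s \<in> {0<..T}") (auto simp: f_def)
  have "represented (H - 1/2) T f"
  proof (cases "H \<le> 1/2")
    case True
    show ?thesis by (rule represented_rough[OF _ _ T fm fb]) (use H True in auto)
  next
    case False
    then have a: "0 < H - 1/2" "H - 1/2 < 1/2" using H by auto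
    obtain q V K where q: "integrable lborel q" "\<And>s. s \<notin> {0<..T} \<Longrightarrow> q s = 0" "\<And>t. t \<in> {0..T} \<Longrightarrow> \<psi> t = \<psi> 0 + abel 1 q t"
      and V: "integrable lborel V" "\<And>s. 0 \<le> (V s :: real)"
      and K: "0 \<le> K" "\<And>s. norm (q s) \<le> K * (indicator {0<..T} s + pker (1 + (H - 1/2)) s * abel (H - 1/2) V s)"
      using smooth False unfolding smooth_velocity_def by (metis not_le)
    let ?g = "\<lambda>s. indicator {0<..T} s + pker (1 + (H - 1/2)) s * abel (H - 1/2) V s"
    have vq: "velocity q" using q by (simp add: velocity_def)
    define p where "p = density (\<psi> 0) q"
    have pm: "p \<in> borel_measurable borel" unfolding p_def by (rule density_measurable[OF vq])
    have M: "0 \<le> M" by (rule M_nonneg)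
    \<comment> \<open>The time derivative contributes the indicator, which is at most
      \<open>?g\<close>, and the spatial derivative contributes the velocity, which is at most K
      times \<open>?g\<close>.\<close>
    have pb: "norm (p s) \<le> (M * (1 + K)) * ?g s" for s
    proof -
      have "0 \<le> abel (H - 1/2) V s" by (rule abel_nonneg) (rule V)
      then have n: "0 \<le> pker (1 + (H - 1/2)) s * abel (H - 1/2) V s" by simp
      have "norm (p s) \<le> M * (indicator {0<..T} s + norm (q s))"
        unfolding p_def by (rule density_bound[OF vq])
      also have "\<dots> \<le> M * (?g s
          + K * ?g s)"
        using K(2)[of s] n by (intro mult_left_mono M) linarith
      also have "\<dots> = (M * (1 + K)) * ?g s"
        by (simp add: algebra_simps)
      finally show ?thesis .
    qed
    have MK: "0 \<le> M * (1 + K)" using M K by simp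
    show ?thesis
    proof (rule represented_smooth[OF a T pm])
      show "p s = 0" if "s \<le> 0" for s
        using that q(2)[of s] by (simp add: p_def density_def blinfun.zero_right)
      show "f s = L 0 (b 0 (\<psi> 0)) + abel 1 p s" if "s \<in> {0<..T}" for s
      proof -
        have s: "s \<in> {0..T}" using that by simp
        have "f s = L s (b s (curve (\<psi> 0) q s))" using q(3)[OF s] that by (simp add: f_def curve_def)
        also have "\<dots> = L 0 (b 0 (\<psi> 0)) + abel 1 p s"
          using chain_rule_velocity[OF vq, of "\<psi> 0"] s unfolding chain_rule_def p_def by blast
        finally show ?thesis .
      qed
    qed (rule weighted_density_bounds[OF a pm V pb MK], assumption)+
  qed
  moreover have "f s = 0" if "s \<le> 0" for s using f0[of s] that by simp
  ultimately obtain u where u: "u \<in> L2_fun T" "\<And>t. t \<in> {0..T} \<Longrightarrow> K_op H u t = abel 1 f t"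
    using K_op_surj[OF H T _ fm fb] by blast
  show ?thesis
  proof (rule that[OF u(1)])
    fix t assume t: "t \<in> {0..T}"
    have "K_sigma H \<sigma> u t = abel 1 (\<lambda>s. S s (f s)) t"
      by (rule K_sigma_density(1)[OF fi _ u(2) t]) (auto simp: f_def)
    also have "(\<lambda>s. S s (f s)) = (\<lambda>s. indicator {0<..T} s *\<^sub>R b s (\<psi> s))"
      by (auto simp: f_def fun_eq_iff blinfun.scaleR_right SL split: split_indicator)
    also have "abel 1 (\<lambda>s. indicator {0<..T} s *\<^sub>R b s (\<psi> s)) t = integral {0..t} (\<lambda>s. b s (\<psi> s))"
      by (rule abel_one_cut(1)[OF continuous_on_section[OF b_cont \<psi>] t])
    finally show "K_sigma H \<sigma> u t = integral {0..t} (\<lambda>s. b s (\<psi> s))" .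
  qed
qed

text \<open>The velocity is \<sigma> applied to the density of \<open>K_op H v\<close>. Boundedness
  of \<sigma> transfers the bound of \<open>K_op_density\<close>, which has the shape demanded by
  \<open>smooth_velocity\<close>.\<close>

lemma K_sigma_smooth_velocity:
  assumes v: "v \<in> L2_fun T" and "1/2 < H" and \<psi>: "\<And>t. t \<in> {0..T} \<Longrightarrow> \<psi> t - x0 = K_sigma H \<sigma> v t"
  shows "smooth_velocity (H - 1/2) T \<psi>"
proof -
  obtain p V where p: "p \<in> borel_measurable borel" "\<And>s. s \<le> 0 \<Longrightarrow> p s = 0"
    "\<And>t. t \<in> {0..T} \<Longrightarrow> K_op H v t = abel 1 p t"
    "\<And>t. t \<in> {0..T} \<Longrightarrow> integrable lborel (\<lambda>s. pker 1 (t - s) *\<^sub>R p s)"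
    and V: "integrable lborel V" "\<And>s. 0 \<le> (V s :: real)" "\<And>s. s \<le> 0 \<Longrightarrow> V s = 0"
    and pV: "\<And>s. norm (p s) \<le> pker (1 + (H - 1/2)) s * abel (H - 1/2) V s"
    by (rule K_op_density[OF H T v \<open>1/2 < H\<close>]) (rule that)
  \<comment> \<open>The density is integrable only up to time T; the cut makes it integrable on the
    line.\<close>
  define p' where "p' = (\<lambda>s. indicator {0<..T} s *\<^sub>R p s)"
  have [measurable]: "p' \<in> borel_measurable borel" unfolding p'_def using p(1) by measurable
  have ae: "AE s in lborel. pker 1 (T - s) *\<^sub>R p s = p' s"
    using AE_lborel_singleton[of T]
    by eventually_elim (use p(2) in \<open>auto simp: p'_def pker_def split: split_indicator\<close>)
  have i: "integrable lborel p'"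
    by (rule integrable_cong_AE_imp[OF p(4) _ ae]) (use T in auto)
  have e: "K_op H v t = abel 1 p' t" if "t \<in> {0..T}" for t
    unfolding p(3)[OF that] by (rule abel_cong) (use that p(2) in \<open>auto simp: p'_def split: split_indicator\<close>)
  define q where "q = (\<lambda>s. S s (p' s))"
  have q: "K_sigma H \<sigma> v t = abel 1 q t" "integrable lborel q" if "t \<in> {0..T}" for t
    unfolding q_def using K_sigma_density[OF i _ e that] by (auto simp: p'_def)
  obtain M where M: "0 < M" "\<And>t v. t \<in> {0..T} \<Longrightarrow> norm (S t v) \<le> M * norm v"
    using blinfun_bounded_on_interval[OF S_cont] by blast
  let ?g = "\<lambda>s. indicator {0<..T} s + pker (1 + (H - 1/2)) s * abel (H - 1/2) V s"
  have av: "0 \<le> pker (1 + (H - 1/2)) s * abel (H - 1/2) V s" for s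
    using abel_nonneg[of V "H - 1/2" s] V(2) by simp
  have qb: "norm (q s) \<le> M * ?g s" for s
  proof (cases "s \<in> {0<..T}")
    case True
    then have "norm (q s) \<le> M * norm (p s)" using M(2)[of s "p s"] by (simp add: q_def p'_def)
    also have "\<dots> \<le> M * ?g s"
      using pV[of s] M(1) by (intro mult_left_mono add_increasing) auto
    finally show ?thesis .
  next
    case False
    then show ?thesis using av[of s] M(1) by (simp add: q_def p'_def blinfun.zero_right)
  qed
  have T0: "0 \<in> {0..T}" using T by simp
  have "abel 1 q 0 = abel 1 (\<lambda>_. 0) 0"
    by (rule abel_cong) (simp add: q_def p'_def blinfun.zero_right)
  then have "K_sigma H \<sigma> v 0 = 0" using q(1)[OF T0] by (simp add: abel_def)
  then have "\<psi> 0 = x0" using \<psi>[OF T0] by simp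
  then have "\<psi> t = \<psi> 0 + abel 1 q t" if "t \<in> {0..T}" for t
    using \<psi>[OF that] q(1)[OF that] by (simp add: algebra_simps)
  moreover have "q s = 0" if "s \<notin> {0<..T}" for s using that by (simp add: q_def p'_def blinfun.zero_right)
  ultimately show ?thesis
    unfolding smooth_velocity_def using q(2)[OF T0] V(1,2) qb M(1) less_imp_le by blast
qed

text \<open>The velocity is the drift itself, hence bounded, so \<open>V\<close> = 0 is a witness
  for every exponent.\<close>

lemma solution_smooth_velocity:
  assumes \<psi>: "continuous_on {0..T} \<psi>" and eq: "\<And>t. t \<in> {0..T} \<Longrightarrow> \<psi> t = \<psi> 0 + integral {0..t} (\<lambda>s. b s (\<psi> s))"
  shows "smooth_velocity a T \<psi>"
proof -
  obtain B where B: "0 < B" "\<And>t x. t \<in> {0..T} \<Longrightarrow> norm (b t x) \<le> B" using b_bound by blast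
  define q where "q = (\<lambda>s. indicator {0<..T} s *\<^sub>R b s (\<psi> s))"
  note c = abel_one_cut[OF continuous_on_section[OF b_cont \<psi>]]
  have T0: "0 \<in> {0..T}" using T by simp
  have q1: "\<psi> t = \<psi> 0 + abel 1 q t" if "t \<in> {0..T}" for t
    using eq[OF that] c(1)[OF that] by (simp add: q_def)
  have q2: "integrable lborel q" unfolding q_def by (rule c(2)[OF T0])
  have q3: "norm (q s) \<le> B * (indicator {0<..T} s + pker (1 + a) s * abel a (\<lambda>_. 0) s)" for s
    using B(2)[of s] by (auto simp: q_def abel_def split: split_indicator)
  have q4: "q s = 0" if "s \<notin> {0<..T}" for s using that by (simp add: q_def)
  show ?thesis
    unfolding smooth_velocity_def
    by (rule exI[of _ q], rule exI[of _ "\<lambda>_. 0"], rule exI[of _ B], intro conjI allI ballI impI)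
      (assumption | rule q2 | erule q4 | erule q1 | rule q3 | simp add: less_imp_le[OF B(1)])+
qed

end

section \<open>Vanishing energy and the integral equation\<close>

lemma L2_fun_diff:
  assumes "u \<in> L2_fun T" "v \<in> L2_fun T"
  shows "(\<lambda>s. u s - v s) \<in> L2_fun T"
proof -
  let ?I = "indicator {0..T} :: real \<Rightarrow> real"
  have m: "(\<lambda>s. ?I s *\<^sub>R u s) \<in> borel_measurable lebesgue" "(\<lambda>s. ?I s *\<^sub>R v s) \<in> borel_measurable lebesgue"
    using assms by (simp_all add: L2_fun_measurable)
  have md: "(\<lambda>s. ?I s *\<^sub>R (u s - v s)) \<in> borel_measurable lebesgue"
    unfolding scaleR_diff_right using m by (rule borel_measurable_diff)
  have i: "integrable lebesgue (\<lambda>s. 2 * (?I s *\<^sub>R (norm (u s))\<^sup>2) + 2 * (?I s *\<^sub>R (norm (v s))\<^sup>2))"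
    using assms by (intro Bochner_Integration.integrable_add integrable_mult_right) (simp_all add: L2_fun_def set_integrable_def)
  have "integrable lebesgue (\<lambda>s. ?I s *\<^sub>R (norm (u s - v s))\<^sup>2)"
  proof (rule Bochner_Integration.integrable_bound[OF i])
    have "(\<lambda>s. (norm (?I s *\<^sub>R (u s - v s)))\<^sup>2) \<in> borel_measurable lebesgue"
      using md by measurable
    also have "(\<lambda>s. (norm (?I s *\<^sub>R (u s - v s)))\<^sup>2) = (\<lambda>s. ?I s *\<^sub>R (norm (u s - v s))\<^sup>2)"
      by (auto simp: fun_eq_iff split: split_indicator)
    finally show "(\<lambda>s. ?I s *\<^sub>R (norm (u s - v s))\<^sup>2) \<in> borel_measurable lebesgue" .
    have le: "(norm (x - y))\<^sup>2 \<le> 2 * (norm x)\<^sup>2 + 2 * (norm y)\<^sup>2" for x y :: "real ^ 'n"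
    proof -
      have "(norm (x - y))\<^sup>2 \<le> (norm x + norm y)\<^sup>2"
        by (intro power_mono norm_triangle_ineq4) simp
      also have "\<dots> \<le> 2 * (norm x)\<^sup>2 + 2 * (norm y)\<^sup>2"
        using sum_squares_bound[of "norm x" "norm y"] by (simp add: power2_sum)
      finally show ?thesis .
    qed
    show "AE s in lebesgue. norm (?I s *\<^sub>R (norm (u s - v s))\<^sup>2)
        \<le> norm (2 * (?I s *\<^sub>R (norm (u s))\<^sup>2) + 2 * (?I s *\<^sub>R (norm (v s))\<^sup>2))"
      using le by (auto split: split_indicator)
  qed
  then show ?thesis using md by (simp add: L2_fun_def set_borel_measurable_def set_integrable_def)
qed

lemma L2_fun_norm_zero:
  assumes "u \<in> L2_fun T" "(LINT t:{0..T}|lebesgue. (norm (u t))\<^sup>2) \<le> 0"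
  shows "AE t in lebesgue. t \<in> {0..T} \<longrightarrow> u t = 0"
proof -
  have i: "integrable lebesgue (\<lambda>t. indicator {0..T} t *\<^sub>R (norm (u t))\<^sup>2)"
    using assms(1) by (simp add: L2_fun_def set_integrable_def)
  have nn: "AE t in lebesgue. 0 \<le> indicator {0..T} t *\<^sub>R (norm (u t))\<^sup>2" by simp
  have "(LINT t|lebesgue. indicator {0..T} t *\<^sub>R (norm (u t))\<^sup>2) = 0"
    using assms(2) integral_nonneg_AE[OF nn] unfolding set_lebesgue_integral_def by linarith
  then have "AE t in lebesgue. indicator {0..T} t *\<^sub>R (norm (u t))\<^sup>2 = 0"
    using integral_nonneg_eq_0_iff_AE[OF i nn] by simp
  then show ?thesis by eventually_elim auto
qed

context transformed_drift
begin

text \<open>The choice returns a genuine preimage as soon as some preimage is exhibited;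
  \<open>u\<close> plays no part beyond this existence.\<close>

lemma K_sigma_inv_props:
  assumes "u \<in> L2_fun T" "\<forall>t\<in>{0..T}. h t = K_sigma H \<sigma> u t"
  shows "K_sigma_inv H T \<sigma> h \<in> L2_fun T" "\<And>t. t \<in> {0..T} \<Longrightarrow> h t = K_sigma H \<sigma> (K_sigma_inv H T \<sigma> h) t"
proof -
  have "K_sigma_inv H T \<sigma> h \<in> L2_fun T \<and> (\<forall>t\<in>{0..T}. h t = K_sigma H \<sigma> (K_sigma_inv H T \<sigma> h) t)"
    unfolding K_sigma_inv_def by (rule someI[of _ u]) (use assms in blast)
  then show "K_sigma_inv H T \<sigma> h \<in> L2_fun T" "\<And>t. t \<in> {0..T} \<Longrightarrow> h t = K_sigma H \<sigma> (K_sigma_inv H T \<sigma> h) t"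
    by blast+
qed

lemma integral_equation_unique:
  assumes \<psi>: "continuous_on {0..T} \<psi>" "\<And>t. t \<in> {0..T} \<Longrightarrow> \<psi> t = x0 + integral {0..t} (\<lambda>s. b s (\<psi> s))"
    and X: "continuous_on {0..T} X" "\<And>t. t \<in> {0..T} \<Longrightarrow> X t = x0 + integral {0..t} (\<lambda>s. b s (X s))"
    and t: "t \<in> {0..T}"
  shows "\<psi> t = X t"
proof -
  obtain K where K: "0 < K" "\<And>t x y. t \<in> {0..T} \<Longrightarrow> norm (b t x - b t y) \<le> K * norm (x - y)"
    using b_lipschitz by blast
  have "norm (\<psi> t - X t) = 0"
  proof (rule gronwall_zero[where h = "\<lambda>t. norm (\<psi> t - X t)" and C = K, OF _ _ _ _ t])
    show "continuous_on {0..T} (\<lambda>t. norm (\<psi> t - X t))" by (intro continuous_intros \<psi> X)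
    fix t assume t: "t \<in> {0..T}"
    have c: "continuous_on {0..t} (\<lambda>s. b s (\<psi> s))" "continuous_on {0..t} (\<lambda>s. b s (X s))"
      "continuous_on {0..t} (\<lambda>s. norm (\<psi> s - X s))"
      using t by (auto intro!: continuous_on_subset[OF continuous_on_section[OF b_cont \<psi>(1)]]
          continuous_on_subset[OF continuous_on_section[OF b_cont X(1)]]
          continuous_on_norm continuous_on_diff continuous_on_subset[OF \<psi>(1)] continuous_on_subset[OF X(1)])
    note i = integrable_continuous_real[OF c(1)] integrable_continuous_real[OF c(2)] integrable_continuous_real[OF c(3)]
    have iK: "(\<lambda>s. K * norm (\<psi> s - X s)) integrable_on {0..t}"
      by (intro integrable_continuous_real continuous_on_mult continuous_on_const c(3))
    have "\<psi> t - X t = integral {0..t} (\<lambda>s. b s (\<psi> s) - b s (X s))"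
      using \<psi>(2)[OF t] X(2)[OF t] by (simp add: integral_diff[OF i(1,2)])
    also have "norm \<dots> \<le> integral {0..t} (\<lambda>s. K * norm (\<psi> s - X s))"
      by (rule integral_norm_bound_integral[OF integrable_diff[OF i(1,2)] iK]) (use K(2) t in auto)
    finally show "norm (\<psi> t - X t) \<le> K * integral {0..t} (\<lambda>s. norm (\<psi> s - X s))" by simp
  qed (use K in auto)
  then show ?thesis by simp
qed

end

theorem corollary4p11:
  fixes H T \<epsilon> :: real
    and b :: "real \<Rightarrow> real ^ 'n \<Rightarrow> real ^ 'n"
    and \<sigma> :: "real \<Rightarrow> real ^ 'n ^ 'n"
    and C :: "real \<Rightarrow> real"
    and x0 :: "real ^ 'n"
    and X :: "real \<Rightarrow> real ^ 'n"
  assumes "1/4 < H" and "H < 1" and "0 < T"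
    and "Cb13 T b"
    and "admissible_diffusion T \<sigma>"
    and "\<And>t x. t \<in> {0..T} \<Longrightarrow> divergence (b t) x = C t"
    and "0 < \<epsilon>"
    and "solves_ode T b x0 X"
  shows "unique_global_minimizer T (OM_functional H T b \<sigma> x0 \<epsilon>) (paths_from H T \<sigma> x0) X \<and>
         unique_global_minimizer T (OM_functional H T b \<sigma> x0 \<epsilon>) (paths_between H T \<sigma> x0 (X T)) X"
proof -
  let ?J = "OM_functional H T b \<sigma> x0 \<epsilon>" and ?P = "paths_from H T \<sigma> x0" and ?inv = "K_sigma_inv H T \<sigma>"
  obtain S S' L L' :: "real \<Rightarrow> (real ^ 'n) \<Rightarrow>\<^sub>L (real ^ 'n)"
  where SL: "\<And>t. t \<in> {0..T} \<Longrightarrow> (S has_vector_derivative S' t) (at t within {0..T})" "continuous_on {0..T} S'"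
    "\<And>t. t \<in> {0..T} \<Longrightarrow> (L has_vector_derivative L' t) (at t within {0..T})" "continuous_on {0..T} L'"
    "\<And>t v. t \<in> {0..T} \<Longrightarrow> \<sigma> t *v v = S t v"
    "\<And>t v. t \<in> {0..T} \<Longrightarrow> L t (S t v) = v" "\<And>t v. t \<in> {0..T} \<Longrightarrow> S t (L t v) = v"
    by (rule admissible_diffusion_blinfun[OF assms(5)]) (rule that)
  interpret transformed_drift H T \<sigma> S S' L L' b
    by unfold_locales (assumption | rule SL assms(2,3,4) | use assms(1) in linarith)+
  define h where "h \<psi> r = \<psi> r - x0 - (LINT s:{0..r}|lebesgue. b s (\<psi> s))" for \<psi> r
  define E where "E \<psi> = (LINT t:{0..T}|lebesgue. (norm (?inv (h \<psi>) t))\<^sup>2)" for \<psi>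
  \<comment> \<open>The divergence term: a number common to all paths, so that minimizing the
    functional amounts to minimizing \<open>E\<close>.\<close>
  define c where "c = d_const H / 2 * (LINT t:{0..T}|lebesgue. C t)"
  have J: "?J \<psi> = 1 / (2 * \<epsilon>) * E \<psi> + c" for \<psi>
  proof -
    have "(LINT t:{0..T}|lebesgue. divergence (b t) (\<psi> t)) = (LINT t:{0..T}|lebesgue. C t)"
      by (rule set_lebesgue_integral_cong) (simp_all add: assms(6))
    then show ?thesis by (simp add: OM_functional_def E_def h_def [abs_def] c_def)
  qed
  have E_nonneg: "0 \<le> E \<psi>" for \<psi>
    unfolding E_def set_lebesgue_integral_def by (intro integral_nonneg_AE) simp
  have hint: "h \<psi> t = \<psi> t - x0 - integral {0..t} (\<lambda>s. b s (\<psi> s))" if "continuous_on {0..T} \<psi>" "t \<in> {0..T}" for \<psi> t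
    unfolding h_def
    by (subst set_integral_continuous)
      (use that in \<open>auto intro!: continuous_on_subset[OF continuous_on_section[OF b_cont that(1)]]\<close>)
  have X0: "X 0 = x0" and Xd: "\<And>t. t \<in> {0..T} \<Longrightarrow> (X has_vector_derivative b t (X t)) (at t within {0..T})"
    using assms(8) by (auto simp: solves_ode_def)
  have Xc: "continuous_on {0..T} X" by (rule continuous_on_vector_derivative[OF Xd])
  have Xi: "X t = x0 + integral {0..t} (\<lambda>s. b s (X s))" if "t \<in> {0..T}" for t
  proof -
    have "((\<lambda>s. b s (X s)) has_integral (X t - X 0)) {0..t}"
      by (rule fundamental_theorem_of_calculus)
        (use that has_vector_derivative_within_subset[OF Xd] in auto)
    then show ?thesis by (simp add: integral_unique X0)
  qed
  have X_path: "X \<in> ?P"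
  proof -
    have sv: "smooth_velocity (H - 1/2) T X"
      by (rule solution_smooth_velocity[OF Xc]) (subst X0, rule Xi)
    obtain u where u: "u \<in> L2_fun T" "\<And>t. t \<in> {0..T} \<Longrightarrow> K_sigma H \<sigma> u t = integral {0..t} (\<lambda>s. b s (X s))"
      by (rule drift_primitive_represented[OF Xc sv]) (rule that)
    have "X t - x0 = K_sigma H \<sigma> u t" if "t \<in> {0..T}" for t
      unfolding u(2)[OF that] by (subst Xi[OF that]) simp
    then show ?thesis using u(1) unfolding paths_from_def CM_space_def by blast
  qed
  have zero: "(\<lambda>_. 0 :: real ^ 'n) \<in> L2_fun T"
    by (simp add: L2_fun_def set_borel_measurable_def set_integrable_def)
  have K_zero: "K_sigma H \<sigma> (\<lambda>_. 0) t = 0" if "t \<in> {0..T}" for t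
    by (rule K_sigma_AE_zero[OF zero _ that]) simp
  have E_X: "E X = 0"
  proof -
    have hX: "h X t = 0" if "t \<in> {0..T}" for t
      using Xi[OF that] hint[OF Xc that] by (simp add: diff_diff_eq)
    then have "\<forall>t\<in>{0..T}. h X t = K_sigma H \<sigma> (\<lambda>_. 0) t"
      using K_zero by simp
    note p = K_sigma_inv_props[OF zero this]
    \<comment> \<open>The chosen preimage of the zero path may differ from the zero control;
      injectivity shows that it does so only on a null set.\<close>
    have "K_sigma H \<sigma> (?inv (h X)) t = 0" if "t \<in> {0..T}" for t
      using p(2)[OF that] hX[OF that] by simp
    then have "AE t in lebesgue. t \<in> {0..T} \<longrightarrow> ?inv (h X) t = 0"
      by (rule K_sigma_inj[OF p(1)])
    then have "AE t in lebesgue. indicator {0..T} t *\<^sub>R (norm (?inv (h X) t))\<^sup>2 = 0"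
      by eventually_elim (auto split: split_indicator)
    then show ?thesis
      unfolding E_def set_lebesgue_integral_def by (rule integral_eq_zero_AE)
  qed
  have unique: "\<psi> t = X t" if \<psi>: "\<psi> \<in> ?P" and E: "E \<psi> \<le> 0" and t: "t \<in> {0..T}" for \<psi> t
  proof -
    obtain v where v: "v \<in> L2_fun T" "\<And>t. t \<in> {0..T} \<Longrightarrow> \<psi> t - x0 = K_sigma H \<sigma> v t"
      using \<psi> by (auto simp: paths_from_def CM_space_def)
    have "continuous_on {0..T} (\<lambda>t. x0 + K_sigma H \<sigma> v t)"
      by (intro continuous_intros K_sigma_cont v)
    then have \<psi>c: "continuous_on {0..T} \<psi>"
      using v(2) by (subst continuous_on_cong[OF refl, of _ _ "\<lambda>t. x0 + K_sigma H \<sigma> v t"]) (auto simp: algebra_simps)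
    \<comment> \<open>With \<open>u\<close> producing the drift primitive along \<psi>, the
      difference \<open>v - u\<close> is a preimage of h(\<psi>), so the inverse in the energy is
      meaningful for an arbitrary admissible path.\<close>
    obtain u where u: "u \<in> L2_fun T" "\<And>t. t \<in> {0..T} \<Longrightarrow> K_sigma H \<sigma> u t = integral {0..t} (\<lambda>s. b s (\<psi> s))"
      using drift_primitive_represented[OF \<psi>c K_sigma_smooth_velocity[OF v(1) _ v(2)]] by blast
    note d = L2_fun_diff[OF v(1) u(1)]
    have hd: "\<forall>t\<in>{0..T}. h \<psi> t = K_sigma H \<sigma> (\<lambda>s. v s - u s) t"
      by (simp add: hint[OF \<psi>c] v(2) u(2) K_sigma_diff[OF v(1) u(1) d])
    note p = K_sigma_inv_props[OF d hd]
    have "AE t in lebesgue. t \<in> {0..T} \<longrightarrow> ?inv (h \<psi>) t = 0"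
      by (rule L2_fun_norm_zero[OF p(1)]) (use E in \<open>simp add: E_def\<close>)
    then have "h \<psi> t = 0" if "t \<in> {0..T}" for t
      using p(2)[OF that] K_sigma_AE_zero[OF p(1) _ that] by simp
    then have "\<psi> t = x0 + integral {0..t} (\<lambda>s. b s (\<psi> s))" if "t \<in> {0..T}" for t
      using hint[OF \<psi>c that] that by (simp add: algebra_simps)
    then show ?thesis by (rule integral_equation_unique[OF \<psi>c _ Xc Xi t])
  qed
  \<comment> \<open>Any class of admissible paths containing \<open>X\<close> has \<open>X\<close>
    as its unique minimizer; free and fixed endpoints are two instances.\<close>
  have "unique_global_minimizer T ?J P X"
    if P: "P \<subseteq> ?P" "X \<in> P" for P
    unfolding unique_global_minimizer_def
  proof (intro conjI allI impI ballI)
    show "global_minimizer ?J P X"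
      using P E_nonneg assms(7) by (auto simp: global_minimizer_def J E_X)
    fix \<psi> t assume m: "global_minimizer ?J P \<psi>" and t: "t \<in> {0..T}"
    then have "1 / (2 * \<epsilon>) * E \<psi> + c \<le> 1 / (2 * \<epsilon>) * E X + c"
      using P by (auto simp: global_minimizer_def J)
    then have "E \<psi> \<le> 0" using assms(7) by (simp add: E_X divide_le_0_iff)
    then show "\<psi> t = X t" using unique t m P by (auto simp: global_minimizer_def)
  qed
  then show ?thesis using X_path by (auto simp: paths_between_def)
qed

end
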